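(* (i) Let $m\le n$ and $u\in C^2(\mathbf{I}(m,n))\cap C(\overline{\mathbf{I}(m,n)})$. Then $\Delta_1u=0$ on $\mathbf{I}(m,n)$ if and only if $\Delta_1^{jk}u=0$ on $\mathbf{I}(m,n)$ for all $1\le j,k\le m$. (ii) Let $u\in C^2(\mathbf{II}(n))\cap C(\overline{\mathbf{II}(n)})$. Then $\Delta_2u=0$ on $\mathbf{II}(n)$ if and only if $\Delta_2^{jk}u=0$ on $\mathbf{II}(n)$ for all $1\le j,k\le n$. (iii) Let $n$ be even and $u\in C^2(\mathbf{III}(n))\cap C(\overline{\mathbf{III}(n)})$. Then $\Delta_3u=0$ on $\mathbf{III}(n)$ if and only if $\Delta_3^{jk}u=0$ on $\mathbf{III}(n)$ for all $1\le j,k\le n$.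
   Context: Domains: $\mathbf{I}(m,n)=\{\mathbf{z}\in M^{m,n}(\mathbb{C}): I_m-\mathbf{z}\mathbf{z}^*>0\}$, $\mathbf{II}(n)=\{\mathbf{z}\in\mathbf{I}(n,n):\mathbf{z}^t=\mathbf{z}\}$, $\mathbf{III}(n)=\{\mathbf{z}\in\mathbf{I}(n,n):\mathbf{z}^t=-\mathbf{z}\}$. Write $V=V(\mathbf{z})=I_m-\mathbf{z}\mathbf{z}^*$ with entries $V_{jk}=\delta_{jk}-\sum_\ell z_{j\ell}\bar z_{k\ell}$. On $\mathbf{II}(n)$ the holomorphic coordinates are the entries $z_{j\alpha}$ ($j\le\alpha$) with $z_{\alpha j}=z_{j\alpha}$, and $\partial/\partial z_{\alpha j}=\partial/\partial z_{j\alpha}$ denotes differentiation with respect to that coordinate. On $\mathbf{III}(n)$ the coordinates are $z_{j\alpha}$ ($j<\alpha$) with $z_{\alpha j}=-z_{j\alpha}$, $z_{jj}=0$, and $\partial/\partial z_{\alpha j}=-\partial/\partial z_{j\alpha}$ (derivatives in $z_{jj}$ only appear with a vanishing coefficient). The operators (Hua operators, i.e. Laplace–Beltrami operators of the Bergman metrics, up to constants) are $\Delta_1=\sum_{j,k=1}^mV_{jk}\Delta_1^{jk}$, $\Delta_1^{jk}=\sum_{\alpha,\beta=1}^n\big(\delta_{\alpha\beta}-\sum_{\ell=1}^m z_{\ell\alpha}\bar z_{\ell\beta}\big)\frac{\partial^2}{\partial z_{j\alpha}\partial\bar z_{k\beta}}$; $\Delta_2=\frac14\sum_{j,k=1}^nV_{jk}\Delta_2^{jk}$,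 $\Delta_2^{jk}=\sum_{\alpha,\beta=1}^n\frac{V_{\alpha\beta}}{(1-\delta_{j\alpha}/2)(1-\delta_{k\beta}/2)}\frac{\partial^2}{\partial z_{j\alpha}\partial\bar z_{k\beta}}$; $\Delta_3=\frac14\sum_{j,k=1}^nV_{jk}\Delta_3^{jk}$, $\Delta_3^{jk}=\sum_{\alpha,\beta=1}^nV_{\alpha\beta}(1-\delta_{j\alpha})(1-\delta_{k\beta})\frac{\partial^2}{\partial z_{j\alpha}\partial\bar z_{k\beta}}$. *)

theory Defs
  imports "HOL-Analysis.Analysis"
begin

definition C2_on :: "'a::real_normed_vector set \<Rightarrow> ('a \<Rightarrow> 'b::real_normed_vector) \<Rightarrow> bool" where
  "C2_on S f \<longleftrightarrow> (\<exists>f' :: 'a \<Rightarrow> ('a \<Rightarrow>\<^sub>L 'b). \<exists>f'' :: 'a \<Rightarrow> ('a \<Rightarrow>\<^sub>L ('a \<Rightarrow>\<^sub>L 'b)).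
     (\<forall>x\<in>S. (f has_derivative blinfun_apply (f' x)) (at x)) \<and>
     (\<forall>x\<in>S. (f' has_derivative blinfun_apply (f'' x)) (at x)) \<and>
     continuous_on S f'')"

definition emat :: "complex \<Rightarrow> 'm \<Rightarrow> 'n \<Rightarrow> complex^'n^'m" where
  "emat c j a = (\<chi> p q. if p = j \<and> q = a then c else 0)"

definition wz :: "(complex^'n^'m \<Rightarrow> complex) \<Rightarrow> 'm \<Rightarrow> 'n \<Rightarrow> complex^'n^'m \<Rightarrow> complex" where
  "wz f j a x = (frechet_derivative f (at x) (emat 1 j a)
                  - \<i> * frechet_derivative f (at x) (emat \<i> j a)) / 2"

definition wzb :: "(complex^'n^'m \<Rightarrow> complex) \<Rightarrow> 'm \<Rightarrow> 'n \<Rightarrow> complex^'n^'m \<Rightarrow> complex" where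
  "wzb f j a x = (frechet_derivative f (at x) (emat 1 j a)
                  + \<i> * frechet_derivative f (at x) (emat \<i> j a)) / 2"

definition d2 :: "(complex^'n^'m \<Rightarrow> complex) \<Rightarrow> 'm \<Rightarrow> 'n \<Rightarrow> 'm \<Rightarrow> 'n \<Rightarrow> complex^'n^'m \<Rightarrow> complex" where
  "d2 f j a k b x = wz (\<lambda>y. wzb f k b y) j a x"

definition Vm :: "complex^'n^'m \<Rightarrow> 'm \<Rightarrow> 'm \<Rightarrow> complex" where
  "Vm z j k = (if j = k then 1 else 0) - (\<Sum>l\<in>UNIV. z$j$l * cnj (z$k$l))"

definition Wm :: "complex^'n^'m \<Rightarrow> 'n \<Rightarrow> 'n \<Rightarrow> complex" where
  "Wm z a b = (if a = b then 1 else 0) - (\<Sum>l\<in>UNIV. z$l$a * cnj (z$l$b))"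

definition domI :: "(complex^'n^'m) set" where
  "domI = {z. \<forall>v::complex^'m. v \<noteq> 0 \<longrightarrow>
              0 < Re (\<Sum>j\<in>UNIV. \<Sum>k\<in>UNIV. cnj (v$j) * Vm z j k * v$k)}"

definition domII :: "(complex^'n^'n) set" where
  "domII = {z \<in> domI. \<forall>j a. z$a$j = z$j$a}"

definition domIII :: "(complex^'n^'n) set" where
  "domIII = {z \<in> domI. \<forall>j a. z$a$j = - z$j$a}"

definition Delta1jk :: "(complex^'n^'m \<Rightarrow> complex) \<Rightarrow> 'm \<Rightarrow> 'm \<Rightarrow> complex^'n^'m \<Rightarrow> complex" where
  "Delta1jk u j k z = (\<Sum>a\<in>UNIV. \<Sum>b\<in>UNIV. Wm z a b * d2 u j a k b z)"

definition Delta1 :: "(complex^'n^'m \<Rightarrow> complex) \<Rightarrow> complex^'n^'m \<Rightarrow> complex" where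
  "Delta1 u z = (\<Sum>j\<in>UNIV. \<Sum>k\<in>UNIV. Vm z j k * Delta1jk u j k z)"

text \<open>Coordinates on II(n): z_{j alpha} with j <= alpha; a function u on symmetric
  matrices is read in these coordinates as u o symf (symf w fills the lower triangle
  from the upper one).  d/dz_{alpha j} = d/dz_{j alpha}.\<close>
definition symf :: "complex^('n::{finite,linorder})^('n::{finite,linorder}) \<Rightarrow> complex^('n::{finite,linorder})^('n::{finite,linorder})" where
  "symf w = (\<chi> p q. if p \<le> q then w$p$q else w$q$p)"

definition d2_II :: "(complex^('n::{finite,linorder})^('n::{finite,linorder}) \<Rightarrow> complex) \<Rightarrow> ('n::{finite,linorder}) \<Rightarrow> ('n::{finite,linorder}) \<Rightarrow> ('n::{finite,linorder}) \<Rightarrow> ('n::{finite,linorder}) \<Rightarrow> complex^('n::{finite,linorder})^('n::{finite,linorder}) \<Rightarrow> complex" where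
  "d2_II u j a k b z = d2 (u \<circ> symf) (min j a) (max j a) (min k b) (max k b) z"

definition Delta2jk :: "(complex^('n::{finite,linorder})^('n::{finite,linorder}) \<Rightarrow> complex) \<Rightarrow> ('n::{finite,linorder}) \<Rightarrow> ('n::{finite,linorder}) \<Rightarrow> complex^('n::{finite,linorder})^('n::{finite,linorder}) \<Rightarrow> complex" where
  "Delta2jk u j k z = (\<Sum>a\<in>UNIV. \<Sum>b\<in>UNIV.
      Vm z a b / ((1 - (if j = a then 1 else 0) / 2) * (1 - (if k = b then 1 else 0) / 2))
        * d2_II u j a k b z)"

definition Delta2 :: "(complex^('n::{finite,linorder})^('n::{finite,linorder}) \<Rightarrow> complex) \<Rightarrow> complex^('n::{finite,linorder})^('n::{finite,linorder}) \<Rightarrow> complex" where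
  "Delta2 u z = (1/4) * (\<Sum>j\<in>UNIV. \<Sum>k\<in>UNIV. Vm z j k * Delta2jk u j k z)"

text \<open>Coordinates on III(n): z_{j alpha} with j < alpha; z_{alpha j} = - z_{j alpha},
  z_{jj} = 0; d/dz_{alpha j} = - d/dz_{j alpha}.  Diagonal derivatives only occur with
  vanishing coefficient; we set them to 0 (sign 0).\<close>
definition asymf :: "complex^('n::{finite,linorder})^('n::{finite,linorder}) \<Rightarrow> complex^('n::{finite,linorder})^('n::{finite,linorder})" where
  "asymf w = (\<chi> p q. if p < q then w$p$q else if q < p then - w$q$p else 0)"

definition sgnIII :: "('n::{finite,linorder}) \<Rightarrow> ('n::{finite,linorder}) \<Rightarrow> complex" where
  "sgnIII j a = (if j < a then 1 else if a < j then -1 else 0)"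

definition d2_III :: "(complex^('n::{finite,linorder})^('n::{finite,linorder}) \<Rightarrow> complex) \<Rightarrow> ('n::{finite,linorder}) \<Rightarrow> ('n::{finite,linorder}) \<Rightarrow> ('n::{finite,linorder}) \<Rightarrow> ('n::{finite,linorder}) \<Rightarrow> complex^('n::{finite,linorder})^('n::{finite,linorder}) \<Rightarrow> complex" where
  "d2_III u j a k b z = sgnIII j a * sgnIII k b *
      d2 (u \<circ> asymf) (min j a) (max j a) (min k b) (max k b) z"

definition Delta3jk :: "(complex^('n::{finite,linorder})^('n::{finite,linorder}) \<Rightarrow> complex) \<Rightarrow> ('n::{finite,linorder}) \<Rightarrow> ('n::{finite,linorder}) \<Rightarrow> complex^('n::{finite,linorder})^('n::{finite,linorder}) \<Rightarrow> complex" where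
  "Delta3jk u j k z = (\<Sum>a\<in>UNIV. \<Sum>b\<in>UNIV.
      Vm z a b * (1 - (if j = a then 1 else 0)) * (1 - (if k = b then 1 else 0))
        * d2_III u j a k b z)"

definition Delta3 :: "(complex^('n::{finite,linorder})^('n::{finite,linorder}) \<Rightarrow> complex) \<Rightarrow> complex^('n::{finite,linorder})^('n::{finite,linorder}) \<Rightarrow> complex" where
  "Delta3 u z = (1/4) * (\<Sum>j\<in>UNIV. \<Sum>k\<in>UNIV. Vm z j k * Delta3jk u j k z)"

end

theory Submission
  imports Defs "HOL-Complex_Analysis.Great_Picard"
begin

text \<open>The Laplacian is invariant under the automorphisms of the domain, and the matrix of Hua operators
  transforms by congruence, so it suffices to show that the Hua matrix \<open>H\<close> of \<open>u\<close> vanishes at 0. A harmonic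
  function continuous up to the closure is bounded by its values on the Shilov boundary \<open>S\<close> (where
  \<open>z z\<^sup>* = 1\<close>). For a traceless matrix \<open>X\<close> the matrix-valued function \<open>u(z) X\<close> is averaged over the isotropy
  group \<open>K\<close> of 0, with \<open>K\<close> also acting by conjugation on the values. The stabiliser in \<open>K\<close> of a point of \<open>S\<close>
  fixes no nonzero traceless matrix, so the averages can be made arbitrarily small on \<open>S\<close>, hence on the
  domain, and then their Hessians at 0 are small too. But a suitable linear function of the Hessian is unchanged by
  averaging and equals the pairing of \<open>X\<close> with \<open>H\<close>. So \<open>H\<close> is a multiple of the identity, and its trace is
  the Laplacian of \<open>u\<close> at 0, which vanishes.\<close>

section \<open>Functions with a Hessian at a point\<close>

text \<open>The isotropy group conjugates the Hua matrix, so averaging \<open>u\<close> alone would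
  leave only its trace visible. Conjugating the values \<open>u(z) X\<close> at the same time
  compensates for this and keeps the pairing with \<open>X\<close> intact.

  Smallness of a function does not by itself bound its Hessian. In place of elliptic estimates there
  is the fact that the group acts by linear isometries: every average inherits the second-order
  Taylor remainder of \<open>u\<close> at 0, with the same radius and, up to the norm of
  \<open>X\<close>, the same constant. A step length fixed in advance then serves for all averages,
  and second differences of a small average bound its Hessian.

  The maximum principle is delicate because the topological boundary is in general much larger than
  \<open>S\<close> and the Laplacian degenerates on it. The comparison function \<open>|z|^2\<close>
  has a Laplacian that can be small only near \<open>S\<close>. Here the sizes of the matrices
  matter: for more rows than columns, and for antisymmetric matrices of odd order,
  \<open>z z^* = 1\<close> has no solution at all.\<close>

definition has_hess :: "('a::euclidean_space \<Rightarrow> 'b::real_normed_vector) \<Rightarrow> ('a \<Rightarrow> 'a \<Rightarrow> 'b) \<Rightarrow> ('a \<Rightarrow> 'a \<Rightarrow> 'b) \<Rightarrow> 'a \<Rightarrow> bool" where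
  "has_hess f f1 H p \<longleftrightarrow> (\<forall>\<^sub>F x in nhds p. (f has_derivative f1 x) (at x)) \<and>
     (\<forall>w. ((\<lambda>x. f1 x w) has_derivative (\<lambda>v. H v w)) (at p))"

lemma has_hess_linear_left: "has_hess f f1 H p \<Longrightarrow> bounded_linear (\<lambda>v. H v w)"
  unfolding has_hess_def using has_derivative_bounded_linear by blast

lemma has_hess_deriv: "has_hess f f1 H p \<Longrightarrow> (f has_derivative f1 p) (at p)"
  unfolding has_hess_def using eventually_nhds_x_imp_x by blast

text \<open>\<open>has_hess\<close> differentiates \<open>f1\<close> for one direction
  \<open>w\<close> at a time, so nothing in it makes \<open>H v w\<close> linear in
  \<open>w\<close>. Linearity comes from that of \<open>f1 x\<close> near \<open>p\<close> and from
  uniqueness of derivatives.\<close>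

lemma has_hess_linear_right:
  assumes "has_hess f f1 H p"
  shows "linear (H v)"
proof -
  have ev: "\<forall>\<^sub>F x in nhds p. linear (f1 x)"
    using assms unfolding has_hess_def
    by (auto elim!: eventually_mono dest: has_derivative_linear)
  have d: "((\<lambda>x. f1 x w) has_derivative (\<lambda>v. H v w)) (at p)" for w
    using assms unfolding has_hess_def by blast
  show ?thesis
  proof (rule linearI)
    fix a b
    have "((\<lambda>x. f1 x (a + b)) has_derivative (\<lambda>v. H v a + H v b)) (at p)"
    proof (rule has_derivative_transform_eventually[OF has_derivative_add[OF d[of a] d[of b]]])
      show "\<forall>\<^sub>F x in at p. f1 x a + f1 x b = f1 x (a + b)"
        using ev by (auto simp: eventually_at_filter linear_add elim: eventually_mono)
      show "f1 p a + f1 p b = f1 p (a + b)"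
        using eventually_nhds_x_imp_x[OF ev] by (simp add: linear_add)
    qed simp
    from has_derivative_unique[OF this d] show "H v (a + b) = H v a + H v b" by (simp add: fun_eq_iff)
  next
    fix r a
    have "((\<lambda>x. f1 x (r *\<^sub>R a)) has_derivative (\<lambda>v. r *\<^sub>R H v a)) (at p)"
    proof (rule has_derivative_transform_eventually[OF has_derivative_scaleR_right[OF d[of a]]])
      show "\<forall>\<^sub>F x in at p. r *\<^sub>R f1 x a = f1 x (r *\<^sub>R a)"
        using ev by (auto simp: eventually_at_filter linear_scale elim: eventually_mono)
      show "r *\<^sub>R f1 p a = f1 p (r *\<^sub>R a)"
        using eventually_nhds_x_imp_x[OF ev] by (simp add: linear_scale)
    qed simp
    from has_derivative_unique[OF this d] show "H v (r *\<^sub>R a) = r *\<^sub>R H v a" by (simp add: fun_eq_iff)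
  qed
qed

lemma has_hess_frechet_differentiable:
  assumes "has_hess f f1 H p"
  shows "((\<lambda>x. frechet_derivative f (at x) w) has_derivative (\<lambda>v. H v w)) (at p)"
proof -
  have ev: "\<forall>\<^sub>F x in nhds p. frechet_derivative f (at x) = f1 x"
    using assms unfolding has_hess_def by (auto elim!: eventually_mono intro: frechet_derivative_at[symmetric])
  have d: "((\<lambda>x. f1 x w) has_derivative (\<lambda>v. H v w)) (at p)"
    using assms unfolding has_hess_def by blast
  show ?thesis
    by (rule has_derivative_transform_eventually[OF d])
      (use eventually_nhds_x_imp_x[OF ev] in \<open>auto simp: eventually_at_filter intro: eventually_mono[OF ev]\<close>)
qed

lemma has_hess_frechet:
  "has_hess f f1 H p \<Longrightarrow> frechet_derivative (\<lambda>x. frechet_derivative f (at x) w) (at p) v = H v w"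
  using frechet_derivative_at[OF has_hess_frechet_differentiable] by metis

lemma has_hess_const: "has_hess (\<lambda>x. c) (\<lambda>x w. 0) (\<lambda>v w. 0) p"
  unfolding has_hess_def by auto

lemma has_hess_add:
  assumes "has_hess f f1 H p" "has_hess g g1 G p"
  shows "has_hess (\<lambda>x. f x + g x) (\<lambda>x w. f1 x w + g1 x w) (\<lambda>v w. H v w + G v w) p"
  using assms unfolding has_hess_def
  by (auto intro!: has_derivative_add elim: eventually_elim2)

lemma has_hess_bounded_linear:
  assumes "has_hess f f1 H p" "bounded_linear T"
  shows "has_hess (\<lambda>x. T (f x)) (\<lambda>x w. T (f1 x w)) (\<lambda>v w. T (H v w)) p"
  using assms unfolding has_hess_def
  by (auto elim!: eventually_mono intro: bounded_linear.has_derivative[OF assms(2)])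

lemma has_hess_sum:
  assumes "\<And>i. i \<in> I \<Longrightarrow> has_hess (f i) (f1 i) (H i) p"
  shows "has_hess (\<lambda>x. \<Sum>i\<in>I. f i x) (\<lambda>x w. \<Sum>i\<in>I. f1 i x w) (\<lambda>v w. \<Sum>i\<in>I. H i v w) p"
  using assms
proof (induction I rule: infinite_finite_induct)
  case (insert i I)
  then show ?case by (auto intro: has_hess_add)
qed (auto intro: has_hess_const)

lemma linear_expand_Basis:
  fixes g :: "'a::euclidean_space \<Rightarrow> 'b::real_vector"
  assumes "linear g"
  shows "g y = (\<Sum>b\<in>Basis. (y \<bullet> b) *\<^sub>R g b)"
proof -
  have "g y = g (\<Sum>b\<in>Basis. (y \<bullet> b) *\<^sub>R b)" by (simp add: euclidean_representation)
  also have "\<dots> = (\<Sum>b\<in>Basis. (y \<bullet> b) *\<^sub>R g b)"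
    by (simp add: linear_sum[OF assms] linear_scale[OF assms])
  finally show ?thesis .
qed

text \<open>Only the functions \<open>\<lambda>x. f1 x w\<close> with fixed \<open>w\<close> are
  known to be differentiable, whereas here the direction \<open>\<phi>1 x w\<close> moves with
  \<open>x\<close>. Expanding it in \<open>Basis\<close> reduces the claim to a product rule; the
  term with \<open>\<phi>2\<close> comes from the motion of the direction.\<close>

lemma has_hess_compose:
  fixes \<phi> :: "'c::euclidean_space \<Rightarrow> 'a::euclidean_space" and f :: "'a \<Rightarrow> 'b::real_normed_vector"
  assumes f: "has_hess f f1 H (\<phi> p)"
    and \<phi>: "\<forall>\<^sub>F x in nhds p. (\<phi> has_derivative \<phi>1 x) (at x)"
    and \<phi>2: "\<And>w. ((\<lambda>x. \<phi>1 x w) has_derivative (\<lambda>v. \<phi>2 v w)) (at p)"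
  shows "has_hess (\<lambda>x. f (\<phi> x)) (\<lambda>x w. f1 (\<phi> x) (\<phi>1 x w))
          (\<lambda>v w. H (\<phi>1 p v) (\<phi>1 p w) + f1 (\<phi> p) (\<phi>2 v w)) p"
proof -
  have dp: "(\<phi> has_derivative \<phi>1 p) (at p)" using \<phi> eventually_nhds_x_imp_x by blast
  then have "(\<phi> \<longlongrightarrow> \<phi> p) (nhds p)"
    using has_derivative_continuous continuous_at tendsto_at_iff_tendsto_nhds by blast
  then have ev: "\<forall>\<^sub>F x in nhds p. (f has_derivative f1 (\<phi> x)) (at (\<phi> x))"
    using f unfolding has_hess_def filterlim_iff by blast
  from ev \<phi> have 1: "\<forall>\<^sub>F x in nhds p. ((\<lambda>x. f (\<phi> x)) has_derivative (\<lambda>w. f1 (\<phi> x) (\<phi>1 x w))) (at x)"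
    by eventually_elim (auto intro: has_derivative_compose)
  have f1d: "((\<lambda>x. f1 (\<phi> x) b) has_derivative (\<lambda>v. H (\<phi>1 p v) b)) (at p)" for b
    using has_derivative_compose[OF dp, of "\<lambda>y. f1 y b" "\<lambda>v. H v b"] f unfolding has_hess_def by blast
  have lin: "\<forall>\<^sub>F x in nhds p. linear (f1 (\<phi> x))"
    using ev by eventually_elim (rule has_derivative_linear)
  note exp = linear_expand_Basis
  have 2: "((\<lambda>x. f1 (\<phi> x) (\<phi>1 x w)) has_derivative
     (\<lambda>v. H (\<phi>1 p v) (\<phi>1 p w) + f1 (\<phi> p) (\<phi>2 v w))) (at p)" for w
  proof -
    have "((\<lambda>x. \<Sum>b\<in>Basis. (\<phi>1 x w \<bullet> b) *\<^sub>R f1 (\<phi> x) b) has_derivative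
        (\<lambda>v. \<Sum>b\<in>Basis. ((\<phi>1 p w \<bullet> b) *\<^sub>R H (\<phi>1 p v) b + (\<phi>2 v w \<bullet> b) *\<^sub>R f1 (\<phi> p) b))) (at p)"
      by (intro has_derivative_sum has_derivative_scaleR has_derivative_inner_left \<phi>2 f1d)
    moreover have "(\<Sum>b\<in>Basis. ((\<phi>1 p w \<bullet> b) *\<^sub>R H (\<phi>1 p v) b + (\<phi>2 v w \<bullet> b) *\<^sub>R f1 (\<phi> p) b))
       = H (\<phi>1 p v) (\<phi>1 p w) + f1 (\<phi> p) (\<phi>2 v w)" for v
      by (simp add: sum.distrib exp[OF has_hess_linear_right[OF f], symmetric]
          exp[OF eventually_nhds_x_imp_x[OF lin], symmetric])
    ultimately have d: "((\<lambda>x. \<Sum>b\<in>Basis. (\<phi>1 x w \<bullet> b) *\<^sub>R f1 (\<phi> x) b) has_derivative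
        (\<lambda>v. H (\<phi>1 p v) (\<phi>1 p w) + f1 (\<phi> p) (\<phi>2 v w))) (at p)" by simp
    have ev2: "\<forall>\<^sub>F x in nhds p. (\<Sum>b\<in>Basis. (\<phi>1 x w \<bullet> b) *\<^sub>R f1 (\<phi> x) b) = f1 (\<phi> x) (\<phi>1 x w)"
      using lin by eventually_elim (rule exp[symmetric])
    show ?thesis
      by (rule has_derivative_transform_eventually[OF d])
       (use eventually_nhds_x_imp_x[OF ev2] in \<open>auto simp: eventually_at_filter intro: eventually_mono[OF ev2]\<close>)
  qed
  show ?thesis using 1 2 unfolding has_hess_def by blast
qed

lemma has_hess_compose_linear:
  fixes T :: "'c::euclidean_space \<Rightarrow> 'a::euclidean_space" and f :: "'a \<Rightarrow> 'b::real_normed_vector"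
  assumes f: "has_hess f f1 H (T p)" and T: "linear T"
  shows "has_hess (\<lambda>x. f (T x)) (\<lambda>x w. f1 (T x) (T w)) (\<lambda>v w. H (T v) (T w)) p"
proof -
  have "(T has_derivative T) (at x)" for x
    using T by (simp add: bounded_linear_imp_has_derivative linear_conv_bounded_linear)
  from has_hess_compose[where \<phi> = T and p = p and f = f, OF f, of "\<lambda>x. T" "\<lambda>v w. 0"] this
  have "has_hess (\<lambda>x. f (T x)) (\<lambda>x w. f1 (T x) (T w)) (\<lambda>v w. H (T v) (T w) + f1 (T p) 0) p" by simp
  moreover have "f1 (T p) 0 = 0"
    using has_hess_deriv[OF f] by (simp add: has_derivative_linear linear_0)
  ultimately show ?thesis by simp
qed

text \<open>Finitely many basis directions suffice for a bound uniform in \<open>w\<close>, hence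
  the tolerance \<open>e / DIM('a)\<close> for each of them and the minimum of their radii.\<close>

lemma has_hess_uniform:
  assumes f: "has_hess f f1 H p" and e: "0 < e"
  shows "\<exists>d>0. \<forall>x. norm (x - p) < d \<longrightarrow> (f has_derivative f1 x) (at x) \<and>
      (\<forall>w. norm (f1 x w - f1 p w - H (x - p) w) \<le> e * norm (x - p) * norm w)"
proof -
  obtain d0 where d0: "d0 > 0" "\<And>x. norm (x - p) < d0 \<Longrightarrow> (f has_derivative f1 x) (at x)"
    using f unfolding has_hess_def eventually_nhds_metric dist_norm by blast
  define e' where "e' = e / DIM('a)"
  have e': "e' > 0" using e by (simp add: e'_def)
  have "\<exists>d>0. \<forall>x. norm (x - p) < d \<longrightarrow> norm (f1 x b - f1 p b - H (x - p) b) \<le> e' * norm (x - p)" for b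
    using f e' unfolding has_hess_def has_derivative_at_alt by blast
  then obtain D where D: "\<And>b. D b > 0" "\<And>b x. norm (x - p) < D b \<Longrightarrow> norm (f1 x b - f1 p b - H (x - p) b) \<le> e' * norm (x - p)"
    by metis
  define d where "d = Min (insert d0 (D ` Basis))"
  have d: "d > 0" "d \<le> d0" "\<And>b. b \<in> Basis \<Longrightarrow> d \<le> D b"
    using d0(1) D(1) unfolding d_def by (simp, simp, (intro Min_le; simp))
  show ?thesis
  proof (intro exI[of _ d] conjI allI impI d(1))
    fix x assume x: "norm (x - p) < d"
    show dx: "(f has_derivative f1 x) (at x)" using d0 d x by auto
    fix w
    note exp = linear_expand_Basis
    have "linear (\<lambda>w. f1 x w - f1 p w - H (x - p) w)"
      using has_derivative_linear[OF dx] has_derivative_linear[OF has_hess_deriv[OF f]] has_hess_linear_right[OF f]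
      by (intro linear_compose_sub) auto
    from exp[OF this, of w]
    have "norm (f1 x w - f1 p w - H (x - p) w) \<le> (\<Sum>b\<in>Basis. norm ((w \<bullet> b) *\<^sub>R (f1 x b - f1 p b - H (x - p) b)))"
      by (simp add: sum_norm_le)
    also have "\<dots> \<le> (\<Sum>b\<in>(Basis::'a set). norm w * (e' * norm (x - p)))"
    proof (rule sum_mono)
      fix b :: 'a assume b: "b \<in> Basis"
      have "norm (f1 x b - f1 p b - H (x - p) b) \<le> e' * norm (x - p)" using D(2) d(3)[OF b] x by auto
      moreover have "\<bar>w \<bullet> b\<bar> \<le> norm w" using b by (rule Basis_le_norm)
      ultimately show "norm ((w \<bullet> b) *\<^sub>R (f1 x b - f1 p b - H (x - p) b)) \<le> norm w * (e' * norm (x - p))"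
        by (simp add: mult_mono)
    qed
    also have "\<dots> = e * norm (x - p) * norm w" by (simp add: e'_def)
    finally show "norm (f1 x w - f1 p w - H (x - p) w) \<le> e * norm (x - p) * norm w" .
  qed
qed

text \<open>The mean value inequality is applied along \<open>w\<close> to the increment in the
  direction \<open>v\<close>. Since \<open>f1\<close> is only known to be differentiable at
  \<open>p\<close> itself, the two first derivatives that occur are compared through their
  linearisation at \<open>p\<close>.\<close>

lemma has_hess_mixed_difference:
  assumes f: "has_hess f f1 H p" and e: "0 < e"
  shows "\<exists>d>0. \<forall>s\<in>{0<..<d}. norm (f (p + s *\<^sub>R v + s *\<^sub>R w) - f (p + s *\<^sub>R v) - f (p + s *\<^sub>R w) + f p - (s * s) *\<^sub>R H v w) \<le> e * s * s"
proof -
  define N where "N = norm v + norm w + 1"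
  have N: "N > 0" "norm v \<le> N" "norm w \<le> N" unfolding N_def by (auto simp: add_nonneg_pos)
  \<comment> \<open>One of the two evaluation points has distance at most \<open>2 * N * s\<close>
    from \<open>p\<close>, the other at most \<open>N * s\<close>. With the further factor
    \<open>norm w \<le> N\<close> this adds up to \<open>3 * N * N\<close>.\<close>
  define e' where "e' = e / (3 * N * N)"
  have e': "e' > 0" using e N by (simp add: e'_def)
  obtain d where d: "d > 0" "\<And>x. norm (x - p) < d \<Longrightarrow> (f has_derivative f1 x) (at x)"
      "\<And>x w. norm (x - p) < d \<Longrightarrow> norm (f1 x w - f1 p w - H (x - p) w) \<le> e' * norm (x - p) * norm w"
    using has_hess_uniform[OF f e'] by blast
  have lin: "H (a + b) w = H a w + H b w" "H (r *\<^sub>R a) w = r *\<^sub>R H a w" for a b r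
    using linear_simps[OF has_hess_linear_left[OF f]] by auto
  show ?thesis
  proof (intro exI[of _ "d / (2 * N)"] conjI ballI)
    show "0 < d / (2 * N)" using d N by simp
    fix s assume s: "s \<in> {0<..<d / (2 * N)}"
    then have s0: "s > 0" and sN: "2 * N * s < d" using N by (auto simp: field_simps)
    define G where "G x = f (p + s *\<^sub>R v + x *\<^sub>R w) - f (p + x *\<^sub>R w) - (x * s) *\<^sub>R H v w" for x
    have nb: "norm (a *\<^sub>R v + x *\<^sub>R w) \<le> 2 * N * s" if "x \<in> {0..s}" "a \<in> {0..s}" for x a
    proof -
      have "norm (a *\<^sub>R v + x *\<^sub>R w) \<le> a * norm v + x * norm w"
        using that norm_triangle_ineq[of "a *\<^sub>R v" "x *\<^sub>R w"] by simp
      also have "\<dots> \<le> s * N + s * N"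
        using that N by (intro add_mono mult_mono) auto
      finally show ?thesis by simp
    qed
    have "norm (G s - G 0) \<le> (e * s) * norm (s - 0)"
    proof (rule differentiable_bound[where S = "{0..s}" and f' = "\<lambda>x h. h *\<^sub>R (f1 (p + s *\<^sub>R v + x *\<^sub>R w) w - f1 (p + x *\<^sub>R w) w - s *\<^sub>R H v w)"])
      fix x assume x: "x \<in> {0..s}"
      have n1: "norm (p + s *\<^sub>R v + x *\<^sub>R w - p) \<le> 2 * N * s" using nb[OF x, of s] s0 by (simp add: algebra_simps)
      have n2: "norm (p + x *\<^sub>R w - p) \<le> 2 * N * s" using nb[OF x, of 0] s0 by (simp add: algebra_simps)
      have D1: "(f has_derivative f1 (p + s *\<^sub>R v + x *\<^sub>R w)) (at (p + s *\<^sub>R v + x *\<^sub>R w))"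
        using d n1 sN by auto
      have D2: "(f has_derivative f1 (p + x *\<^sub>R w)) (at (p + x *\<^sub>R w))"
        using d n2 sN by auto
      have l1: "f1 (p + s *\<^sub>R v + x *\<^sub>R w) (h *\<^sub>R w) = h *\<^sub>R f1 (p + s *\<^sub>R v + x *\<^sub>R w) w"
           "f1 (p + x *\<^sub>R w) (h *\<^sub>R w) = h *\<^sub>R f1 (p + x *\<^sub>R w) w" for h
        using has_derivative_linear[OF D1] has_derivative_linear[OF D2] by (auto simp: linear_scale)
      have C1: "((\<lambda>x. f (p + s *\<^sub>R v + x *\<^sub>R w)) has_derivative (\<lambda>h. f1 (p + s *\<^sub>R v + x *\<^sub>R w) (h *\<^sub>R w))) (at x within {0..s})"
        by (rule has_derivative_compose[where g = f and f = "\<lambda>x. p + s *\<^sub>R v + x *\<^sub>R w", OF _ D1]) (auto intro!: derivative_eq_intros)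
      have C2: "((\<lambda>x. f (p + x *\<^sub>R w)) has_derivative (\<lambda>h. f1 (p + x *\<^sub>R w) (h *\<^sub>R w))) (at x within {0..s})"
        by (rule has_derivative_compose[where g = f and f = "\<lambda>x. p + x *\<^sub>R w", OF _ D2]) (auto intro!: derivative_eq_intros)
      show "(G has_derivative (\<lambda>h. h *\<^sub>R (f1 (p + s *\<^sub>R v + x *\<^sub>R w) w - f1 (p + x *\<^sub>R w) w - s *\<^sub>R H v w))) (at x within {0..s})"
        unfolding G_def by (rule derivative_eq_intros C1 C2 refl)+ (simp only: l1, auto simp: algebra_simps)
      have "norm (f1 (p + s *\<^sub>R v + x *\<^sub>R w) w - f1 (p + x *\<^sub>R w) w - s *\<^sub>R H v w)
         = norm ((f1 (p + s *\<^sub>R v + x *\<^sub>R w) w - f1 p w - H (p + s *\<^sub>R v + x *\<^sub>R w - p) w)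
              - (f1 (p + x *\<^sub>R w) w - f1 p w - H (p + x *\<^sub>R w - p) w))"
        by (simp add: lin algebra_simps)
      also have "\<dots> \<le> e' * norm (p + s *\<^sub>R v + x *\<^sub>R w - p) * norm w + e' * norm (p + x *\<^sub>R w - p) * norm w"
        by (rule order_trans[OF norm_triangle_ineq4]) (rule add_mono[OF d(3)[OF le_less_trans[OF n1 sN]] d(3)[OF le_less_trans[OF n2 sN]]])
      also have "\<dots> \<le> e' * (2 * N * s) * N + e' * norm (p + x *\<^sub>R w - p) * norm w"
        using n1 e' N s0 by (intro add_mono mult_mono mult_left_mono) auto
      also have "norm (p + x *\<^sub>R w - p) = x * norm w" using x by simp
      also have "e' * (2 * N * s) * N + e' * (x * norm w) * norm w \<le> e' * (2 * N * s) * N + e' * (s * N) * N"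
        using x e' N s0 by (intro add_mono mult_mono mult_left_mono) auto
      also have "\<dots> = e * s" using N by (simp add: e'_def field_simps)
      finally have "norm (f1 (p + s *\<^sub>R v + x *\<^sub>R w) w - f1 (p + x *\<^sub>R w) w - s *\<^sub>R H v w) \<le> e * s" .
      then show "onorm (\<lambda>h. h *\<^sub>R (f1 (p + s *\<^sub>R v + x *\<^sub>R w) w - f1 (p + x *\<^sub>R w) w - s *\<^sub>R H v w)) \<le> e * s"
        by (intro onorm_le) (auto simp: mult.commute mult_left_mono)
    qed (use s0 in auto)
    then show "norm (f (p + s *\<^sub>R v + s *\<^sub>R w) - f (p + s *\<^sub>R v) - f (p + s *\<^sub>R w) + f p - (s * s) *\<^sub>R H v w) \<le> e * s * s"
      using s0 by (simp add: G_def algebra_simps)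
  qed
qed

text \<open>The second difference does not change when \<open>v\<close> and \<open>w\<close> are
  exchanged, while it approximates both \<open>H v w\<close> and \<open>H w v\<close>. No continuity
  of second derivatives enters.\<close>

lemma has_hess_symmetric:
  assumes f: "has_hess f f1 H p"
  shows "H v w = H w v"
proof (rule ccontr)
  assume "H v w \<noteq> H w v"
  define e where "e = norm (H v w - H w v) / 3"
  have e: "e > 0" using \<open>H v w \<noteq> H w v\<close> by (simp add: e_def)
  obtain d where d: "d > 0" "\<And>s. s \<in> {0<..<d} \<Longrightarrow> norm (f (p + s *\<^sub>R v + s *\<^sub>R w) - f (p + s *\<^sub>R v) - f (p + s *\<^sub>R w) + f p - (s * s) *\<^sub>R H v w) \<le> e * s * s"
    using has_hess_mixed_difference[OF f e] by blast
  obtain d' where d': "d' > 0" "\<And>s. s \<in> {0<..<d'} \<Longrightarrow> norm (f (p + s *\<^sub>R w + s *\<^sub>R v) - f (p + s *\<^sub>R w) - f (p + s *\<^sub>R v) + f p - (s * s) *\<^sub>R H w v) \<le> e * s * s"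
    using has_hess_mixed_difference[OF f e] by blast
  define s where "s = min d d' / 2"
  have s: "s > 0" "s \<in> {0<..<d}" "s \<in> {0<..<d'}" using d(1) d'(1) by (auto simp: s_def)
  define X where "X = f (p + s *\<^sub>R v + s *\<^sub>R w) - f (p + s *\<^sub>R v) - f (p + s *\<^sub>R w) + f p"
  have "norm (X - (s * s) *\<^sub>R H v w) \<le> e * s * s" "norm (X - (s * s) *\<^sub>R H w v) \<le> e * s * s"
    using d(2)[OF s(2)] d'(2)[OF s(3)] by (auto simp: X_def algebra_simps)
  then have "norm ((X - (s * s) *\<^sub>R H w v) - (X - (s * s) *\<^sub>R H v w)) \<le> e * s * s + e * s * s"
    by (intro order_trans[OF norm_triangle_ineq4[of "X - (s * s) *\<^sub>R H w v"]] add_mono)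
  then have "s * s * norm (H v w - H w v) \<le> 2 * e * (s * s)"
    by (simp add: scaleR_right_diff_distrib[symmetric])
  then have "norm (H v w - H w v) \<le> 2 * e" using s(1)
    by (metis mult.commute mult_le_cancel_left_pos mult_pos_pos)
  then show False using e by (simp add: e_def)
qed

text \<open>This form of Taylor's theorem survives averaging over linear isometries, radius
  included; see \<open>orbit_average_hess\<close>.\<close>

lemma has_hess_second_difference:
  assumes f: "has_hess f f1 H p" and e: "0 < e"
  shows "\<exists>d>0. \<forall>a. norm a < d \<longrightarrow> norm (f (p + a) + f (p - a) - 2 *\<^sub>R f p - H a a) \<le> e * (norm a)\<^sup>2"
proof -
  obtain d where d: "d > 0" "\<And>x. norm (x - p) < d \<Longrightarrow> (f has_derivative f1 x) (at x)"
      "\<And>x w. norm (x - p) < d \<Longrightarrow> norm (f1 x w - f1 p w - H (x - p) w) \<le> e/2 * norm (x - p) * norm w"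
    using has_hess_uniform[OF f, of "e/2"] e by auto
  have lin: "H (r *\<^sub>R a) w = r *\<^sub>R H a w" for a r w
    using linear_simps[OF has_hess_linear_left[OF f]] by auto
  have lin': "H w (r *\<^sub>R a) = r *\<^sub>R H w a" for a r w
    using has_hess_linear_right[OF f] by (simp add: linear_scale)
  show ?thesis
  proof (intro exI[of _ d] conjI allI impI d(1))
    fix a :: 'a assume a: "norm a < d"
    define G where "G t = f (p + t *\<^sub>R a) + f (p + (-t) *\<^sub>R a) - (t * t) *\<^sub>R H a a" for t
    have "norm (G 1 - G 0) \<le> (e * (norm a)\<^sup>2) * norm (1 - 0 :: real)"
    proof (rule differentiable_bound[where S = "{0..1}" and f' = "\<lambda>t h. h *\<^sub>R (f1 (p + t *\<^sub>R a) a - f1 (p + (-t) *\<^sub>R a) a - (2 * t) *\<^sub>R H a a)"])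
      fix t :: real assume t: "t \<in> {0..1}"
      have n: "norm (p + t *\<^sub>R a - p) \<le> norm a" "norm (p + (-t) *\<^sub>R a - p) \<le> norm a"
        using t by (auto simp: mult_left_le_one_le)
      have D1: "(f has_derivative f1 (p + t *\<^sub>R a)) (at (p + t *\<^sub>R a))"
       and D2: "(f has_derivative f1 (p + (-t) *\<^sub>R a)) (at (p + (-t) *\<^sub>R a))"
        using d n a by (meson le_less_trans)+
      have l1: "f1 (p + t *\<^sub>R a) (h *\<^sub>R a) = h *\<^sub>R f1 (p + t *\<^sub>R a) a"
           "f1 (p + (-t) *\<^sub>R a) (h *\<^sub>R a) = h *\<^sub>R f1 (p + (-t) *\<^sub>R a) a" for h
        using has_derivative_linear[OF D1] has_derivative_linear[OF D2] by (auto simp: linear_scale)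
      have C1: "((\<lambda>t. f (p + t *\<^sub>R a)) has_derivative (\<lambda>h. f1 (p + t *\<^sub>R a) (h *\<^sub>R a))) (at t within {0..1})"
        by (rule has_derivative_compose[where g = f and f = "\<lambda>t. p + t *\<^sub>R a", OF _ D1]) (auto intro!: derivative_eq_intros)
      have C2: "((\<lambda>t. f (p + (-t) *\<^sub>R a)) has_derivative (\<lambda>h. f1 (p + (-t) *\<^sub>R a) ((-h) *\<^sub>R a))) (at t within {0..1})"
        by (rule has_derivative_compose[where g = f and f = "\<lambda>t. p + (-t) *\<^sub>R a", OF _ D2]) (auto intro!: derivative_eq_intros)
      show "(G has_derivative (\<lambda>h. h *\<^sub>R (f1 (p + t *\<^sub>R a) a - f1 (p + (-t) *\<^sub>R a) a - (2 * t) *\<^sub>R H a a))) (at t within {0..1})"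
        unfolding G_def by (rule derivative_eq_intros C1 C2 refl)+ (simp only: l1, auto simp: algebra_simps scaleR_2)
      have "norm (f1 (p + t *\<^sub>R a) a - f1 (p + (-t) *\<^sub>R a) a - (2 * t) *\<^sub>R H a a)
         = norm ((f1 (p + t *\<^sub>R a) a - f1 p a - H (p + t *\<^sub>R a - p) a)
              - (f1 (p + (-t) *\<^sub>R a) a - f1 p a - H (p + (-t) *\<^sub>R a - p) a))"
        using lin[of t a a] lin[of "-t" a a] by (simp only: add_diff_cancel_left') (simp add: algebra_simps scaleR_2 flip: scaleR_scaleR)
      also have "\<dots> \<le> e/2 * norm (p + t *\<^sub>R a - p) * norm a + e/2 * norm (p + (-t) *\<^sub>R a - p) * norm a"
        by (rule order_trans[OF norm_triangle_ineq4], rule add_mono) (use d(3) n a in \<open>meson le_less_trans\<close>)+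
      also have "\<dots> \<le> e/2 * norm a * norm a + e/2 * norm a * norm a"
        using n e by (intro add_mono mult_mono mult_left_mono) auto
      also have "\<dots> = e * (norm a)\<^sup>2" by (simp add: power2_eq_square)
      finally have "norm (f1 (p + t *\<^sub>R a) a - f1 (p + (-t) *\<^sub>R a) a - (2 * t) *\<^sub>R H a a) \<le> e * (norm a)\<^sup>2" .
      then show "onorm (\<lambda>h. h *\<^sub>R (f1 (p + t *\<^sub>R a) a - f1 (p + (-t) *\<^sub>R a) a - (2 * t) *\<^sub>R H a a)) \<le> e * (norm a)\<^sup>2"
        by (intro onorm_le) (auto simp: mult.commute mult_left_mono)
    qed auto
    then show "norm (f (p + a) + f (p - a) - 2 *\<^sub>R f p - H a a) \<le> e * (norm a)\<^sup>2"
      by (simp add: G_def algebra_simps scaleR_2)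
  qed
qed

lemma has_hess_local_max:
  fixes f :: "'a::euclidean_space \<Rightarrow> real"
  assumes f: "has_hess f f1 H p" and d: "0 < d"
    and mx: "\<And>t. \<bar>t\<bar> < d \<Longrightarrow> f (p + t *\<^sub>R a) \<le> f p"
  shows "H a a \<le> 0"
proof (rule ccontr)
  assume "\<not> H a a \<le> 0"
  then have h: "H a a > 0" by simp
  have a0: "a \<noteq> 0"
    using h linear_0[OF has_hess_linear_right[OF f, of a]] by auto
  \<comment> \<open>With half of \<open>H a a\<close> relative to \<open>(norm a)\<^sup>2\<close>,
    the remainder cannot cancel the positive second-order term.\<close>
  define e where "e = H a a / (2 * (norm a)\<^sup>2)"
  have e: "e > 0" using h a0 by (simp add: e_def)
  obtain d' where d': "d' > 0" "\<And>b. norm b < d' \<Longrightarrow> norm (f (p + b) + f (p - b) - 2 *\<^sub>R f p - H b b) \<le> e * (norm b)\<^sup>2"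
    using has_hess_second_difference[OF f e] by blast
  define t where "t = min (d/2) (d' / (2 * norm a))"
  have t: "t > 0" "t < d" using d d' a0 by (auto simp: t_def)
  have tn: "t * norm a < d'"
  proof -
    have "t * norm a \<le> d' / (2 * norm a) * norm a" unfolding t_def by (intro mult_right_mono) auto
    then show ?thesis using a0 d'(1) by simp
  qed
  have lin: "H (t *\<^sub>R a) (t *\<^sub>R a) = t * t * H a a"
    using linear_simps[OF has_hess_linear_left[OF f]] has_hess_linear_right[OF f] by (simp add: linear_scale)
  have "norm (f (p + t *\<^sub>R a) + f (p - t *\<^sub>R a) - 2 *\<^sub>R f p - H (t *\<^sub>R a) (t *\<^sub>R a)) \<le> e * (norm (t *\<^sub>R a))\<^sup>2"
    using t tn by (intro d'(2)) auto
  moreover have "f (p + t *\<^sub>R a) \<le> f p" "f (p - t *\<^sub>R a) \<le> f p"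
    using mx[of t] mx[of "-t"] t by auto
  ultimately have "t * t * H a a \<le> e * (norm (t *\<^sub>R a))\<^sup>2" by (simp add: lin)
  also have "\<dots> = t * t * H a a / 2" using a0 by (simp add: e_def power2_eq_square)
  finally show False using t h by simp
qed

section \<open>Complex matrices and the matrix ball\<close>

definition adj :: "complex^'n^'m \<Rightarrow> complex^'m^'n" where
  "adj A = (\<chi> i j. cnj (A $ j $ i))"

text \<open>The complex structure of the matrix space, kept apart from its real scaling: Hessians
  are only real bilinear, so both are used side by side.\<close>

definition cscale :: "complex \<Rightarrow> complex^'n^'m \<Rightarrow> complex^'n^'m" where
  "cscale c x = (\<chi> i j. c * x $ i $ j)"

lemma adj_nth [simp]: "adj A $ i $ j = cnj (A $ j $ i)" by (simp add: adj_def)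
lemma cscale_nth [simp]: "cscale c x $ i $ j = c * x $ i $ j" by (simp add: cscale_def)

lemma adj_adj [simp]: "adj (adj A) = A" by (simp add: vec_eq_iff)
lemma adj_mat1 [simp]: "adj (mat 1) = mat 1" by (simp add: vec_eq_iff mat_def)
lemma adj_zero [simp]: "adj 0 = 0" by (simp add: vec_eq_iff)
lemma adj_add: "adj (A + B) = adj A + adj B" by (simp add: vec_eq_iff)
lemma adj_diff: "adj (A - B) = adj A - adj B" by (simp add: vec_eq_iff)
lemma adj_mult: "adj (A ** B) = adj B ** adj A"
  by (simp add: vec_eq_iff matrix_matrix_mult_def mult.commute)

lemma matrix_mul_nth: "(A ** B) $ i $ j = (\<Sum>k\<in>UNIV. A $ i $ k * B $ k $ j)"
  by (simp add: matrix_matrix_mult_def)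

lemma matrix_mul_sub_ldistrib: "(A :: 'a::ring_1^'n^'m) ** (B - C) = A ** B - A ** C"
  by (simp add: vec_eq_iff matrix_mul_nth sum_subtractf right_diff_distrib)
lemma matrix_mul_sub_rdistrib: "((B::'a::ring_1^'n^'m) - C) ** A = B ** A - C ** A"
  by (simp add: vec_eq_iff matrix_mul_nth sum_subtractf left_diff_distrib)
lemma matrix_mul_add_rdistrib: "((B::'a::ring_1^'n^'m) + C) ** A = B ** A + C ** A"
  by (simp add: vec_eq_iff matrix_mul_nth sum.distrib distrib_right)
lemma matrix_mul_uminus_l: "(- (B::'a::ring_1^'n^'m)) ** A = - (B ** A)"
  by (simp add: vec_eq_iff matrix_mul_nth sum_negf)
lemma matrix_mul_uminus_r: "(B::'a::ring_1^'n^'m) ** (- A) = - (B ** A)"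
  by (simp add: vec_eq_iff matrix_mul_nth sum_negf)

lemmas matrix_ring_simps = matrix_mul_sub_ldistrib matrix_mul_sub_rdistrib matrix_add_ldistrib
  matrix_mul_add_rdistrib adj_add adj_diff adj_mult

lemma cscale_mult_l: "cscale c A ** B = cscale c (A ** B)"
  by (simp add: vec_eq_iff matrix_mul_nth sum_distrib_left mult.assoc)
lemma cscale_mult_r: "A ** cscale c B = cscale c (A ** B)"
  by (simp add: vec_eq_iff matrix_mul_nth sum_distrib_left algebra_simps)
lemma cscale_add: "cscale c (A + B) = cscale c A + cscale c B" by (simp add: vec_eq_iff distrib_left)
lemma cscale_diff: "cscale c (A - B) = cscale c A - cscale c B" by (simp add: vec_eq_iff right_diff_distrib)
lemma cscale_minus: "cscale c (- A) = - cscale c A" by (simp add: vec_eq_iff)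
lemma cscale_cscale: "cscale c (cscale d A) = cscale (c * d) A" by (simp add: vec_eq_iff)
lemma cscale_ii [simp]: "cscale \<i> (cscale \<i> A) = - A" by (simp add: vec_eq_iff flip: mult.assoc)
lemma scaleR_cscale: "r *\<^sub>R A = cscale (of_real r) A" by (simp add: vec_eq_iff scaleR_conv_of_real[where 'a = complex])

lemma bounded_bilinear_matrix_mult:
  "bounded_bilinear ((**) :: complex^'n^'m \<Rightarrow> complex^'p^'n \<Rightarrow> complex^'p^'m)"
  unfolding bilinear_conv_bounded_bilinear[symmetric] bilinear_def
  by (auto intro!: linearI simp: matrix_mul_add_rdistrib matrix_add_ldistrib scaleR_cscale cscale_mult_l cscale_mult_r)

lemma bounded_linear_adj: "bounded_linear (adj :: complex^'n^'m \<Rightarrow> complex^'m^'n)"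
  unfolding linear_conv_bounded_linear[symmetric]
  by (rule linearI) (auto simp: vec_eq_iff)

lemma norm_sq_vec: "(norm x)\<^sup>2 = (\<Sum>i\<in>UNIV. (norm (x $ i))\<^sup>2)"
  by (simp add: norm_vec_def L2_set_def sum_nonneg)

lemma norm_sq_matrix: "(norm (x :: complex^'n^'m))\<^sup>2 = (\<Sum>i\<in>UNIV. \<Sum>j\<in>UNIV. (cmod (x $ i $ j))\<^sup>2)"
  by (simp add: norm_sq_vec)

definition cin :: "complex^'n \<Rightarrow> complex^'n \<Rightarrow> complex" where
  "cin x y = (\<Sum>i\<in>UNIV. cnj (x $ i) * y $ i)"

lemma cin_self: "cin x x = of_real ((norm x)\<^sup>2)"
  unfolding cin_def norm_sq_vec of_real_sum complex_norm_square by (simp add: mult.commute)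

lemma cin_adj: "cin x (A *v y) = cin (adj A *v x) y"
proof -
  have "cin x (A *v y) = (\<Sum>i\<in>UNIV. \<Sum>j\<in>UNIV. cnj (x $ i) * (A $ i $ j * y $ j))"
    by (simp add: cin_def matrix_vector_mult_def sum_distrib_left)
  also have "\<dots> = (\<Sum>j\<in>UNIV. \<Sum>i\<in>UNIV. cnj (x $ i) * (A $ i $ j * y $ j))"
    by (rule sum.swap)
  also have "\<dots> = cin (adj A *v x) y"
    by (simp add: cin_def matrix_vector_mult_def sum_distrib_left sum_distrib_right algebra_simps)
  finally show ?thesis .
qed

lemma cin_cnj: "cnj (cin x y) = cin y x"
  by (simp add: cin_def mult.commute)

lemma cin_right: "cin x (y + z) = cin x y + cin x z" "cin x (y - z) = cin x y - cin x z"
  "cin x (c *s y) = c * cin x y" "cin x (r *\<^sub>R y) = of_real r * cin x y" "cin x 0 = 0"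
  by (auto simp: cin_def sum.distrib sum_subtractf sum_distrib_left algebra_simps scaleR_conv_of_real[where 'a = complex])

lemma cin_left: "cin (x + y) z = cin x z + cin y z" "cin (x - y) z = cin x z - cin y z"
  "cin (c *s x) z = cnj c * cin x z" "cin (r *\<^sub>R x) z = of_real r * cin x z" "cin 0 z = 0"
  by (auto simp: cin_def sum.distrib sum_subtractf sum_distrib_left algebra_simps scaleR_conv_of_real[where 'a = complex])

lemma norm_cin_le: "cmod (cin x y) \<le> norm x * norm y"
proof -
  have "cmod (cin x y) \<le> (\<Sum>i\<in>UNIV. \<bar>norm (x $ i)\<bar> * \<bar>norm (y $ i)\<bar>)"
    unfolding cin_def by (intro order_trans[OF norm_sum]) (simp add: norm_mult)
  also have "\<dots> \<le> L2_set (\<lambda>i. norm (x $ i)) UNIV * L2_set (\<lambda>i. norm (y $ i)) UNIV"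
    by (rule L2_set_mult_ineq)
  finally show ?thesis by (simp add: norm_vec_def)
qed

definition Vmat :: "complex^'n^'m \<Rightarrow> complex^'m^'m" where "Vmat z = mat 1 - z ** adj z"
definition Wmat :: "complex^'n^'m \<Rightarrow> complex^'n^'n" where "Wmat z = mat 1 - adj z ** z"

lemma Vm_eq: "Vm z j k = Vmat z $ j $ k"
  by (simp add: Vm_def Vmat_def matrix_mul_nth mat_def)

text \<open>The indices are swapped because \<open>Wm\<close> conjugates the factor with the second
  index, whereas \<open>adj z ** z\<close> conjugates the one with the first.\<close>

lemma Wm_eq: "Wm z a b = Wmat z $ b $ a"
  by (simp add: Wm_def Wmat_def matrix_mul_nth mat_def mult.commute)

lemma adj_Vmat [simp]: "adj (Vmat z) = Vmat z" and adj_Wmat [simp]: "adj (Wmat z) = Wmat z"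
  by (simp_all add: Vmat_def Wmat_def adj_diff adj_mult)

lemma Vmat_adj: "Vmat (adj z) = Wmat z" by (simp add: Vmat_def Wmat_def)

lemma cin_Wmat: "cin v (Wmat z *v v) = of_real ((norm v)\<^sup>2 - (norm (z *v v))\<^sup>2)"
proof -
  have "Wmat z *v v = v - adj z *v (z *v v)"
    by (simp add: Wmat_def matrix_vector_mult_diff_rdistrib matrix_vector_mul_assoc)
  then show ?thesis by (simp add: cin_right cin_adj cin_self)
qed

lemma cin_Vmat: "cin v (Vmat z *v v) = of_real ((norm v)\<^sup>2 - (norm (adj z *v v))\<^sup>2)"
  using cin_Wmat[of v "adj z"] Vmat_adj[of "adj z"] by simp

text \<open>The square of \<open>norm (adj A *v w)\<close> is the product of \<open>w\<close> with
  \<open>A *v (adj A *v w)\<close>, so Cauchy-Schwarz and the bound for \<open>A\<close>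
  apply.\<close>

lemma norm_adj_le:
  assumes "\<And>v. norm (A *v v) \<le> norm v"
  shows "norm (adj A *v w) \<le> norm w"
proof (cases "adj A *v w = 0")
  case False
  let ?y = "adj A *v w"
  have "of_real ((norm ?y)\<^sup>2) = cin w (A *v ?y)" by (simp add: cin_adj cin_self)
  then have "(norm ?y)\<^sup>2 = cmod (cin w (A *v ?y))" by (metis abs_power2 norm_of_real)
  also have "\<dots> \<le> norm w * norm ?y"
    by (rule order_trans[OF norm_cin_le]) (simp add: assms mult_left_mono)
  finally show ?thesis using False by (simp add: power2_eq_square)
qed auto

lemma norm_adj_less:
  assumes "\<And>v. v \<noteq> 0 \<Longrightarrow> norm (A *v v) < norm v" "w \<noteq> 0"
  shows "norm (adj A *v w) < norm w"
proof (cases "adj A *v w = 0")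
  case False
  let ?y = "adj A *v w"
  have "of_real ((norm ?y)\<^sup>2) = cin w (A *v ?y)" by (simp add: cin_adj cin_self)
  then have "(norm ?y)\<^sup>2 = cmod (cin w (A *v ?y))" by (metis abs_power2 norm_of_real)
  also have "\<dots> \<le> norm w * norm (A *v ?y)" by (rule norm_cin_le)
  also have "\<dots> < norm w * norm ?y" using assms False by simp
  finally show ?thesis using False by (simp add: power2_eq_square)
qed (use assms in auto)

text \<open>The closed unit ball of the operator norm. It is compact, contains the closures of all
  three domains, and the automorphisms are still defined on it.\<close>

definition contractions :: "(complex^'n^'m) set" where "contractions = {z. \<forall>v. norm (z *v v) \<le> norm v}"

lemma domI_iff_adj: "z \<in> domI \<longleftrightarrow> (\<forall>v. v \<noteq> 0 \<longrightarrow> norm (adj z *v v) < norm v)"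
proof -
  have "(\<Sum>j\<in>UNIV. \<Sum>k\<in>UNIV. cnj (v$j) * Vm z j k * v$k) = cin v (Vmat z *v v)" for v
    by (simp add: cin_def matrix_vector_mult_def Vm_eq sum_distrib_left mult.assoc)
  moreover have "0 < a\<^sup>2 - b\<^sup>2 \<longleftrightarrow> b < a" if "0 \<le> a" "0 \<le> b" for a b :: real
    using power_mono_iff[OF that, of 2] by (simp flip: not_le)
  ultimately show ?thesis unfolding domI_def by (simp only: mem_Collect_eq cin_Vmat Re_complex_of_real norm_ge_zero)
qed

lemma domI_iff: "z \<in> domI \<longleftrightarrow> (\<forall>v. v \<noteq> 0 \<longrightarrow> norm (z *v v) < norm v)"
  unfolding domI_iff_adj using norm_adj_less[of z] norm_adj_less[of "adj z"] by auto

lemma domI_subset_contractions: "domI \<subseteq> contractions"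
  unfolding domI_iff contractions_def subset_iff mem_Collect_eq
  by (metis less_imp_le matrix_vector_mult_0_right order_refl norm_zero)

section \<open>Inverses and factorisation of positive definite Hermitian matrices\<close>

lemma det_zero_kernel:
  fixes M :: "complex^'n^'n"
  assumes "det M = 0" shows "\<exists>x. x \<noteq> 0 \<and> M *v x = 0"
  using assms invertible_det_nz[of M] matrix_left_invertible_ker[of M]
  by (metis invertible_left_inverse)

lemma invertible_if_inj:
  fixes M :: "complex^'n^'n"
  assumes "\<And>x. M *v x = 0 \<Longrightarrow> x = 0" shows "invertible M"
  using assms det_zero_kernel[of M] invertible_det_nz by blast

lemma matrix_inv_works:
  assumes "invertible A"
  shows "A ** matrix_inv A = mat 1" "matrix_inv A ** A = mat 1"
  using someI_ex[OF assms[unfolded invertible_def]] unfolding matrix_inv_def by auto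

text \<open>The columns of \<open>B\<close> form an orthonormal system for the form of
  \<open>H\<close>, built over growing finite sets of column indices. The factors of the
  automorphisms are obtained in this way.\<close>

lemma hermitian_gram_schmidt:
  fixes H :: "complex^'n^'n"
  assumes herm: "adj H = H" and pos: "\<And>v. v \<noteq> 0 \<Longrightarrow> 0 < Re (cin v (H *v v))"
  shows "\<exists>B::complex^'n^'n. adj B ** H ** B = mat 1"
proof -
  have fin: "finite F \<Longrightarrow> \<exists>b :: 'n \<Rightarrow> complex^'n. \<forall>i\<in>F. \<forall>j\<in>F. cin (b i) (H *v b j) = (if i = j then 1 else 0)" for F :: "'n set"
  proof (induction F rule: finite_induct)
    case (insert i F)
    then obtain b where b: "\<And>i j. i \<in> F \<Longrightarrow> j \<in> F \<Longrightarrow> cin (b i) (H *v b j) = (if i = j then 1 else 0)" by blast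
    \<comment> \<open>Row \<open>i\<close> vanishes because \<open>i\<close> is not in
      \<open>F\<close>, so \<open>M\<close> is singular. A kernel vector is orthogonal, with respect
      to \<open>H\<close>, to all vectors chosen so far; no projections have to be
      subtracted.\<close>
    define M :: "complex^'n^'n" where "M = (\<chi> j k. if j \<in> F then (\<Sum>l\<in>UNIV. cnj (b j $ l) * H $ l $ k) else 0)"
    have "row i M = 0" using insert.hyps by (simp add: M_def row_def vec_eq_iff)
    then have "det M = 0" by (rule det_zero_row)
    then obtain x where x: "x \<noteq> 0" "M *v x = 0" using det_zero_kernel by blast
    have Mx: "(M *v x) $ j = cin (b j) (H *v x)" if "j \<in> F" for j
    proof -
      have "(M *v x) $ j = (\<Sum>k\<in>UNIV. \<Sum>l\<in>UNIV. cnj (b j $ l) * H $ l $ k * x $ k)"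
        using that by (simp add: M_def matrix_vector_mult_def sum_distrib_right)
      also have "\<dots> = (\<Sum>l\<in>UNIV. \<Sum>k\<in>UNIV. cnj (b j $ l) * H $ l $ k * x $ k)" by (rule sum.swap)
      also have "\<dots> = cin (b j) (H *v x)" by (simp add: cin_def matrix_vector_mult_def sum_distrib_left mult.assoc)
      finally show ?thesis .
    qed
    have o1: "cin (b j) (H *v x) = 0" if "j \<in> F" for j using Mx[OF that] x(2) by simp
    have o2: "cin x (H *v b j) = 0" if "j \<in> F" for j
      using o1[OF that] by (metis cin_adj cin_cnj complex_cnj_zero herm)
    have im: "cin x (H *v x) = of_real (Re (cin x (H *v x)))"
      by (metis cin_adj cin_cnj complex_cnj_cancel_iff Reals_cnj_iff herm of_real_Re)
    define c where "c = Re (cin x (H *v x))"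
    have c: "c > 0" unfolding c_def by (rule pos[OF x(1)])
    have cc: "cin x (H *v x) = of_real c" using im c_def by simp
    define y where "y = (1 / sqrt c) *\<^sub>R x"
    have yH: "H *v y = (1 / sqrt c) *\<^sub>R (H *v x)"
      unfolding y_def by (simp add: vec_eq_iff matrix_vector_mult_def scaleR_sum_right)
    have "of_real (1 / sqrt c) * (of_real (1 / sqrt c) * of_real c) = (1::complex)"
      using c by (simp flip: of_real_mult add: real_div_sqrt)
    then have yy: "cin y (H *v y) = 1" unfolding yH by (simp only: y_def cin_left cin_right cc)
    have "cin ((b(i := y)) p) (H *v (b(i := y)) q) = (if p = q then 1 else 0)" if "p \<in> insert i F" "q \<in> insert i F" for p q
      using that b yy o1 o2 insert.hyps by (auto simp: yH, auto simp: y_def cin_left cin_right)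
    then show ?case by blast
  qed auto
  obtain b :: "'n \<Rightarrow> complex^'n" where b: "\<And>i j. cin (b i) (H *v b j) = (if i = j then 1 else 0)"
    using fin[of UNIV] by auto
  define B :: "complex^'n^'n" where "B = (\<chi> i j. b j $ i)"
  have "(adj B ** H ** B) $ i $ j = cin (b i) (H *v b j)" for i j
    unfolding matrix_mul_assoc[symmetric]
    by (simp add: matrix_mul_nth B_def cin_def matrix_vector_mult_def)
  then have "adj B ** H ** B = mat 1" by (simp add: vec_eq_iff b mat_def)
  then show ?thesis by blast
qed

lemma Vmat_posdef: "z \<in> domI \<Longrightarrow> v \<noteq> 0 \<Longrightarrow> 0 < Re (cin v (Vmat z *v v))"
  unfolding cin_Vmat domI_iff_adj by (simp add: power_strict_mono)
lemma Wmat_posdef: "z \<in> domI \<Longrightarrow> v \<noteq> 0 \<Longrightarrow> 0 < Re (cin v (Wmat z *v v))"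
  unfolding cin_Wmat domI_iff by (simp add: power_strict_mono)

section \<open>Automorphisms\<close>

text \<open>The automorphism \<open>\<phi>\<close> takes 0 to \<open>z0\<close>. Any factors \<open>A\<close>, \<open>D\<close> with the two stated
  properties will do, which avoids Hermitian square roots. The derivative of \<open>\<phi>\<close> at \<open>z\<close> is
  \<open>v \<mapsto> Q z ** v ** R z\<close>, and \<open>Q\<close>, \<open>R\<close> also transform \<open>Vmat\<close> and \<open>Wmat\<close>.\<close>

locale mobius =
  fixes z0 :: "complex^'n^'m" and A :: "complex^'m^'m" and D :: "complex^'n^'n"
  assumes z0: "z0 \<in> domI" and A: "adj A ** Vmat z0 ** A = mat 1" and D: "adj D ** Wmat z0 ** D = mat 1"
begin

definition "Mm z = adj z0 ** A ** z + D"
definition "Nm z = A ** z + z0 ** D"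
definition "\<phi> z = Nm z ** matrix_inv (Mm z)"
definition "Q z = A - \<phi> z ** adj z0 ** A"
definition "R z = matrix_inv (Mm z)"

text \<open>The pair \<open>Nm z\<close>, \<open>Mm z\<close> is the block matrix with rows
  \<open>A\<close>, \<open>z0 ** D\<close> and \<open>adj z0 ** A\<close>, \<open>D\<close> applied
  to the column of \<open>z\<close> and \<open>mat 1\<close>. That block matrix preserves the
  indefinite Hermitian form whose value on this column is \<open>Wmat z\<close>.\<close>

lemma MN: "adj (Mm z) ** Mm z - adj (Nm z) ** Nm z = Wmat z"
proof -
  have "adj (Mm z) ** Mm z - adj (Nm z) ** Nm z = adj D ** Wmat z0 ** D - adj z ** (adj A ** Vmat z0 ** A) ** z"
    unfolding Mm_def Nm_def Vmat_def Wmat_def by (simp add: matrix_ring_simps matrix_mul_assoc)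
  then show ?thesis unfolding A D by (simp add: Wmat_def)
qed

lemma Mm_inj:
  assumes "z \<in> contractions" "Mm z *v w = 0" shows "w = 0"
proof -
  have "cin w ((adj (Mm z) ** Mm z - adj (Nm z) ** Nm z) *v w) = of_real ((norm (Mm z *v w))\<^sup>2 - (norm (Nm z *v w))\<^sup>2)"
    by (simp add: matrix_vector_mult_diff_rdistrib matrix_vector_mul_assoc[symmetric] cin_right cin_adj cin_self)
  then have "(norm w)\<^sup>2 - (norm (z *v w))\<^sup>2 = (norm (Mm z *v w))\<^sup>2 - (norm (Nm z *v w))\<^sup>2"
    unfolding MN cin_Wmat using of_real_eq_iff by blast
  then have "(norm w)\<^sup>2 - (norm (z *v w))\<^sup>2 = - (norm (Nm z *v w))\<^sup>2" by (simp add: assms(2))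
  moreover have "(norm (z *v w))\<^sup>2 \<le> (norm w)\<^sup>2" using assms(1) by (simp add: contractions_def power_mono)
  ultimately have "(norm (Nm z *v w))\<^sup>2 \<le> 0" by linarith
  then have N0: "Nm z *v w = 0" by simp
  \<comment> \<open>This combination of \<open>Mm z\<close> and \<open>Nm z\<close> is
    \<open>adj D ** Wmat z0 ** D = mat 1\<close>, so the two have no common kernel.\<close>
  have "(adj D ** (Mm z - adj z0 ** Nm z)) *v w = 0"
    by (simp add: matrix_vector_mul_assoc[symmetric] matrix_vector_mult_diff_rdistrib N0 assms(2))
  moreover have "adj D ** (Mm z - adj z0 ** Nm z) = adj D ** Wmat z0 ** D"
    unfolding Mm_def Nm_def Wmat_def by (simp add: matrix_ring_simps matrix_mul_assoc)
  ultimately show ?thesis by (simp add: D)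
qed

lemma Mm_R: "z \<in> contractions \<Longrightarrow> Mm z ** R z = mat 1" "z \<in> contractions \<Longrightarrow> R z ** Mm z = mat 1"
  using invertible_if_inj[of "Mm z"] Mm_inj[of z] matrix_inv_works[of "Mm z"]
  unfolding R_def by auto

lemma R_inj: "z \<in> contractions \<Longrightarrow> R z *v w = 0 \<Longrightarrow> w = 0"
  by (metis Mm_R(1) matrix_vector_mul_assoc matrix_vector_mul_lid matrix_vector_mult_0_right)

lemma phi_Mm: "z \<in> contractions \<Longrightarrow> \<phi> z ** Mm z = Nm z"
  unfolding \<phi>_def R_def[symmetric] by (simp add: matrix_mul_assoc[symmetric] Mm_R)

text \<open>This writes the inverse of \<open>Mm z\<close> as an affine function of
  \<open>\<phi> z\<close>; bounds, continuity and the derivative of \<open>R\<close> are then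
  inherited from \<open>\<phi>\<close>.\<close>

lemma R_eq: assumes "z \<in> contractions" shows "R z = adj D - adj D ** adj z0 ** \<phi> z"
proof -
  have "(adj D - adj D ** adj z0 ** \<phi> z) ** Mm z = adj D ** Mm z - adj D ** adj z0 ** Nm z"
    by (simp add: matrix_ring_simps matrix_mul_assoc[symmetric] phi_Mm assms)
  also have "\<dots> = adj D ** Wmat z0 ** D"
    unfolding Mm_def Nm_def Wmat_def by (simp add: matrix_ring_simps matrix_mul_assoc)
  finally have "(adj D - adj D ** adj z0 ** \<phi> z) ** Mm z ** R z = R z" by (simp add: D)
  then show ?thesis by (simp add: matrix_mul_assoc[symmetric] Mm_R assms)
qed

lemma Wmat_phi: assumes "z \<in> contractions" shows "adj (R z) ** Wmat z ** R z = Wmat (\<phi> z)"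
proof -
  have "adj (R z) ** Wmat z ** R z = adj (Mm z ** R z) ** (Mm z ** R z) - adj (\<phi> z) ** \<phi> z"
    unfolding MN[symmetric] \<phi>_def R_def[symmetric]
    by (simp only: matrix_ring_simps matrix_mul_assoc)
  then show ?thesis by (simp add: Mm_R assms Wmat_def)
qed

text \<open>The identity is exact and not merely infinitesimal, since \<open>\<phi>\<close> is
  linear fractional. The Lipschitz bound, continuity and the derivative are all read off from
  it.\<close>

lemma phi_diff:
  assumes "z \<in> contractions" "p \<in> contractions"
  shows "\<phi> z - \<phi> p = Q p ** (z - p) ** R z"
proof -
  have "Q p ** (z - p) = (Nm z - \<phi> p ** Mm z) - (Nm p - \<phi> p ** Mm p)"
    unfolding Q_def Nm_def Mm_def by (simp add: matrix_ring_simps matrix_mul_assoc)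
  then have "Q p ** (z - p) = Nm z - \<phi> p ** Mm z" by (simp add: phi_Mm assms)
  then have "Q p ** (z - p) ** R z = Nm z ** R z - \<phi> p ** (Mm z ** R z)"
    by (simp add: matrix_ring_simps matrix_mul_assoc)
  then show ?thesis by (simp add: Mm_R assms) (simp add: \<phi>_def R_def)
qed

text \<open>\<open>A ** adj A\<close> and \<open>D ** adj D\<close> are the inverses of
  \<open>Vmat z0\<close> and \<open>Wmat z0\<close>, whichever factors were chosen. The last
  identity comes from \<open>Vmat z0 ** z0 = z0 ** Wmat z0\<close>.\<close>

lemma GG: "A ** adj A ** (z0 ** adj z0) = A ** adj A - mat 1" "adj z0 ** z0 ** (D ** adj D) = D ** adj D - mat 1"
  "A ** adj A ** z0 = z0 ** (D ** adj D)"
proof -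
  have 1: "A ** adj A ** Vmat z0 = mat 1"
    using A by (metis matrix_left_right_inverse matrix_mul_assoc)
  have 2: "Wmat z0 ** (D ** adj D) = mat 1"
    using D by (metis matrix_left_right_inverse matrix_mul_assoc)
  show "A ** adj A ** (z0 ** adj z0) = A ** adj A - mat 1"
    using 1 unfolding Vmat_def by (simp add: matrix_ring_simps algebra_simps)
  show "adj z0 ** z0 ** (D ** adj D) = D ** adj D - mat 1"
    using 2 unfolding Wmat_def by (simp add: matrix_ring_simps algebra_simps)
  have "Vmat z0 ** z0 = z0 ** Wmat z0"
    unfolding Vmat_def Wmat_def by (simp add: matrix_ring_simps matrix_mul_assoc)
  then have "A ** adj A ** Vmat z0 ** z0 ** (D ** adj D) = A ** adj A ** z0 ** (Wmat z0 ** (D ** adj D))"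
    by (metis matrix_mul_assoc)
  then show "A ** adj A ** z0 = z0 ** (D ** adj D)" by (simp add: 1 2)
qed

text \<open>\<open>Q z ** z\<close> equals \<open>(\<phi> z - z0) ** D\<close>. After this
  substitution the factors occur only as \<open>A ** adj A\<close> and \<open>D ** adj D\<close>,
  and \<open>GG\<close> cancels all terms that should not be there.\<close>

lemma Vmat_phi: assumes "z \<in> contractions" shows "Q z ** Vmat z ** adj (Q z) = Vmat (\<phi> z)"
proof -
  let ?p = "\<phi> z" let ?G = "A ** adj A" let ?K = "D ** adj D"
  have Qz: "Q z ** z = (?p - z0) ** D"
  proof -
    have "\<phi> z ** (adj z0 ** A ** z + D) = A ** z + z0 ** D" using phi_Mm[OF assms] by (simp add: Mm_def Nm_def)
    then have "\<phi> z ** adj z0 ** A ** z + \<phi> z ** D = A ** z + z0 ** D" by (simp add: matrix_ring_simps matrix_mul_assoc)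
    then show ?thesis unfolding Q_def by (simp add: matrix_ring_simps matrix_mul_assoc algebra_simps)
  qed
  have g3': "adj z0 ** ?G = ?K ** adj z0"
    using arg_cong[OF GG(3), of adj] by (simp add: adj_mult matrix_mul_assoc)
  have "Q z ** Vmat z ** adj (Q z) = Q z ** adj (Q z) - (Q z ** z) ** adj (Q z ** z)"
    unfolding Vmat_def by (simp add: matrix_ring_simps matrix_mul_assoc)
  also have "\<dots> = (?G - ?G ** z0 ** adj ?p - ?p ** (adj z0 ** ?G) + ?p ** (adj z0 ** (?G ** z0)) ** adj ?p)
     - (?p ** ?K ** adj ?p - ?p ** (?K ** adj z0) - z0 ** ?K ** adj ?p + z0 ** ?K ** adj z0)"
    unfolding Qz by (simp add: Q_def matrix_ring_simps matrix_mul_assoc)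
  also have "\<dots> = (?G - ?G ** z0 ** adj z0) + ?p ** (adj z0 ** z0 ** ?K - ?K) ** adj ?p"
    unfolding GG(3) g3' by (simp add: matrix_ring_simps matrix_mul_assoc)
  also have "?G ** z0 ** adj z0 = ?G - mat 1" using GG(1) by (simp add: matrix_mul_assoc)
  also have "?p ** (adj z0 ** z0 ** ?K - ?K) ** adj ?p = - (?p ** adj ?p)"
    unfolding GG(2) by (simp add: matrix_ring_simps matrix_mul_uminus_l matrix_mul_uminus_r)
  finally show ?thesis by (simp add: Vmat_def)
qed

lemma norm_phi_mult:
  assumes "z \<in> contractions"
  shows "(norm w)\<^sup>2 - (norm (\<phi> z *v w))\<^sup>2 = (norm (R z *v w))\<^sup>2 - (norm (z *v (R z *v w)))\<^sup>2"
proof -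
  have "cin w (Wmat (\<phi> z) *v w) = cin (R z *v w) (Wmat z *v (R z *v w))"
    unfolding Wmat_phi[OF assms, symmetric] by (simp add: matrix_vector_mul_assoc[symmetric] cin_adj)
  then show ?thesis unfolding cin_Wmat using of_real_eq_iff by blast
qed

lemma phi_contractions: assumes "z \<in> contractions" shows "\<phi> z \<in> contractions"
  unfolding contractions_def
proof (intro CollectI allI)
  fix w
  have "(norm (z *v (R z *v w)))\<^sup>2 \<le> (norm (R z *v w))\<^sup>2" using assms by (simp add: contractions_def power_mono)
  then have "(norm (\<phi> z *v w))\<^sup>2 \<le> (norm w)\<^sup>2"
    by (subst diff_ge_0_iff_ge[symmetric]) (simp only: norm_phi_mult[OF assms] diff_ge_0_iff_ge)
  then show "norm (\<phi> z *v w) \<le> norm w" by (rule power2_le_imp_le) simp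
qed

lemma phi_domI: assumes "z \<in> domI" shows "\<phi> z \<in> domI"
  unfolding domI_iff
proof (intro allI impI)
  fix w :: "complex^'n" assume w: "w \<noteq> 0"
  have z: "z \<in> contractions" using assms domI_subset_contractions by blast
  have "R z *v w \<noteq> 0" using R_inj[OF z] w by blast
  then have "(norm (z *v (R z *v w)))\<^sup>2 < (norm (R z *v w))\<^sup>2" using assms by (simp add: domI_iff power_strict_mono)
  then have "(norm (\<phi> z *v w))\<^sup>2 < (norm w)\<^sup>2"
    by (subst diff_gt_0_iff_gt[symmetric]) (simp only: norm_phi_mult[OF z] diff_gt_0_iff_gt)
  then show "norm (\<phi> z *v w) < norm w" by (rule power2_less_imp_less) simp
qed

lemma phi_0: "\<phi> 0 = z0"
proof -
  have z: "(0::complex^'n^'m) \<in> contractions" by (simp add: contractions_def)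
  have "Mm 0 = D" "Nm 0 = z0 ** D" by (simp_all add: Mm_def Nm_def)
  then show ?thesis using Mm_R(1)[OF z] unfolding \<phi>_def R_def by (simp add: matrix_mul_assoc[symmetric])
qed

end

section \<open>Topology of the matrix ball\<close>

lemma norm_matrix_vector_le: "norm ((A :: complex^'n^'m) *v v) \<le> norm A * norm v"
proof -
  have c: "cmod ((A *v v) $ i) \<le> norm (A $ i) * norm v" for i
  proof -
    have "(A *v v) $ i = cin (\<chi> j. cnj (A $ i $ j)) v"
      by (simp add: cin_def matrix_vector_mult_def)
    moreover have "norm (\<chi> j. cnj (A $ i $ j)) = norm (A $ i)" by (simp add: norm_vec_def)
    ultimately show ?thesis by (metis norm_cin_le)
  qed
  have "(norm (A *v v))\<^sup>2 \<le> (\<Sum>i\<in>UNIV. (norm (A $ i) * norm v)\<^sup>2)"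
    unfolding norm_sq_vec[of "A *v v"] by (intro sum_mono power_mono c) simp
  also have "\<dots> = (norm A * norm v)\<^sup>2"
    by (simp add: power_mult_distrib norm_sq_vec[of A] sum_distrib_right)
  finally show ?thesis by (rule power2_le_imp_le) simp
qed

lemma ball_subset_domI: "norm z < 1 \<Longrightarrow> z \<in> domI"
  unfolding domI_iff
proof (intro allI impI)
  fix v :: "complex^'a" assume "norm z < 1" "v \<noteq> 0"
  then have "norm z * norm v < 1 * norm v" by (intro mult_strict_right_mono) auto
  then show "norm (z *v v) < norm v" using norm_matrix_vector_le[of z v] by simp
qed

lemma matrix_vector_mult_scaleR_left: "(c *\<^sub>R (z::complex^'n^'m)) *v v = c *\<^sub>R (z *v v)"
  by (simp add: vec_eq_iff matrix_vector_mult_def scaleR_sum_right)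

text \<open>The operator norm is attained on the compact unit sphere, which makes the strict
  inequality uniform. The margin \<open>1 - c\<close> is the radius used for openness of
  \<open>domI\<close>.\<close>

lemma domI_strict_bound:
  fixes z :: "complex^'n^'m"
  assumes "z \<in> domI"
  shows "\<exists>c<1. 0 \<le> c \<and> (\<forall>v. norm (z *v v) \<le> c * norm v)"
proof -
  have cont: "continuous_on (sphere 0 1) (\<lambda>v. norm (z *v v))"
    by (intro continuous_intros linear_continuous_on matrix_vector_mul_bounded_linear)
  have "sphere (0::complex^'n) 1 \<noteq> {}" by simp
  from continuous_attains_sup[OF compact_sphere this cont]
  obtain v0 where v0: "norm v0 = 1" "\<And>v. norm v = 1 \<Longrightarrow> norm (z *v v) \<le> norm (z *v v0)" by auto
  have "v0 \<noteq> 0" using v0(1) by auto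
  then have l: "norm (z *v v0) < 1" using assms v0(1) unfolding domI_iff by metis
  have "norm (z *v v) \<le> norm (z *v v0) * norm v" for v
  proof (cases "v = 0")
    case False
    let ?u = "(1 / norm v) *\<^sub>R v"
    have "norm (z *v ?u) \<le> norm (z *v v0)" using False by (intro v0(2)) simp
    moreover have "z *v ?u = (1 / norm v) *\<^sub>R (z *v v)"
      by (simp add: vec_eq_iff matrix_vector_mult_def scaleR_sum_right)
    ultimately show ?thesis using False by (simp add: field_simps)
  qed simp
  with l show ?thesis by (intro exI[of _ "norm (z *v v0)"]) auto
qed

lemma open_domI: "open (domI :: (complex^'n^'m) set)"
  unfolding open_dist
proof (intro ballI)
  fix z :: "complex^'n^'m" assume "z \<in> domI"
  then obtain c where c: "c < 1" "\<And>v. norm (z *v v) \<le> c * norm v" using domI_strict_bound by blast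
  show "\<exists>e>0. \<forall>y. dist y z < e \<longrightarrow> y \<in> domI"
  proof (intro exI[of _ "1 - c"] conjI allI impI)
    fix y assume y: "dist y z < 1 - c"
    show "y \<in> domI" unfolding domI_iff
    proof (intro allI impI)
      fix v :: "complex^'n" assume v: "v \<noteq> 0"
      have "y *v v = (y - z) *v v + z *v v" by (simp add: matrix_vector_mult_diff_rdistrib)
      then have "norm (y *v v) \<le> norm (y - z) * norm v + c * norm v"
        using norm_triangle_ineq[of "(y - z) *v v" "z *v v"] norm_matrix_vector_le[of "y - z" v] c(2)[of v] by simp
      also have "\<dots> = (norm (y - z) + c) * norm v" by (simp add: distrib_right)
      also have "\<dots> < 1 * norm v" using y v by (intro mult_strict_right_mono) (auto simp: dist_norm)
      finally show "norm (y *v v) < norm v" by simp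
    qed
  qed (use c in auto)
qed

lemma closed_contractions: "closed (contractions :: (complex^'n^'m) set)"
proof -
  have *: "closed {z::complex^'n^'m. norm (z *v v) \<le> norm v}" for v
  proof (rule closed_Collect_le)
    have "linear (\<lambda>z::complex^'n^'m. z *v v)"
      by (rule linearI) (auto simp: matrix_vector_mult_add_rdistrib matrix_vector_mult_scaleR_left)
    then have "continuous_on UNIV (\<lambda>z::complex^'n^'m. z *v v)"
      by (simp add: linear_continuous_on linear_conv_bounded_linear)
    then show "continuous_on UNIV (\<lambda>z::complex^'n^'m. norm (z *v v))" by (rule continuous_on_norm)
  qed auto
  have "contractions = (\<Inter>v. {z::complex^'n^'m. norm (z *v v) \<le> norm v})" by (auto simp: contractions_def)
  then show ?thesis using closed_INT[of UNIV "\<lambda>v. {z::complex^'n^'m. norm (z *v v) \<le> norm v}"] * by simp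
qed

text \<open>Columns are images of unit vectors, so each has norm at most 1.\<close>

lemma contractions_column_bound: "z \<in> contractions \<Longrightarrow> (norm z)\<^sup>2 \<le> CARD('n)" for z :: "complex^'n^'m"
proof -
  assume z: "z \<in> contractions"
  have col: "(norm (z *v axis b 1))\<^sup>2 = (\<Sum>i\<in>UNIV. (cmod (z $ i $ b))\<^sup>2)" for b
    by (simp add: norm_sq_vec matrix_vector_mult_def axis_def if_distrib cong: if_cong)
  have "(norm z)\<^sup>2 = (\<Sum>b\<in>UNIV. (norm (z *v axis b 1))\<^sup>2)"
    unfolding norm_sq_matrix col by (rule sum.swap)
  also have "\<dots> \<le> (\<Sum>b\<in>(UNIV::'n set). 1)"
  proof (rule sum_mono)
    fix b
    have "norm (z *v axis b 1) \<le> norm (axis b 1 :: complex^'n)" using z unfolding contractions_def by blast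
    then have "(norm (z *v axis b 1))\<^sup>2 \<le> (norm (axis b 1 :: complex^'n))\<^sup>2" by (rule power_mono) simp
    also have "\<dots> = (\<Sum>i\<in>UNIV. if i = b then 1 else 0)"
      unfolding norm_sq_vec by (intro sum.cong) (auto simp: axis_def)
    also have "\<dots> = 1" by simp
    finally show "(norm (z *v axis b 1))\<^sup>2 \<le> 1" .
  qed
  finally show ?thesis by simp
qed

lemma bounded_contractions: "bounded (contractions :: (complex^'n^'m) set)"
  unfolding bounded_iff
  by (rule exI[of _ "sqrt (CARD('n))"]) (auto intro: real_le_rsqrt contractions_column_bound)

lemma continuous_on_adj [continuous_intros]: "continuous_on S f \<Longrightarrow> continuous_on S (\<lambda>x. adj (f x))"
  by (rule bounded_linear.continuous_on[OF bounded_linear_adj])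

lemma continuous_on_matrix_mult [continuous_intros]:
  "continuous_on S f \<Longrightarrow> continuous_on S g \<Longrightarrow> continuous_on S (\<lambda>x. f x ** g x)"
  for f :: "'z::topological_space \<Rightarrow> complex^'n^'m"
  by (rule bounded_bilinear.continuous_on[OF bounded_bilinear_matrix_mult])

lemma continuous_on_Vmat [continuous_intros]: "continuous_on S f \<Longrightarrow> continuous_on S (\<lambda>x. Vmat (f x))"
  unfolding Vmat_def by (intro continuous_intros)

section \<open>Differential calculus of the automorphisms\<close>

context mobius
begin

lemma phi_bound: obtains C where "C > 0" "\<And>z. z \<in> contractions \<Longrightarrow> norm (\<phi> z) \<le> C" "\<And>z. z \<in> contractions \<Longrightarrow> norm (R z) \<le> C"
  "\<And>z. z \<in> contractions \<Longrightarrow> norm (Q z) \<le> C"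
proof -
  obtain C1 where C1: "\<And>z. z \<in> contractions \<Longrightarrow> norm (\<phi> z) \<le> C1"
    using bounded_contractions phi_contractions unfolding bounded_iff by blast
  have blR: "bounded_linear (\<lambda>p. adj D ** adj z0 ** (p :: complex^'n^'m))"
    by (rule bounded_bilinear.bounded_linear_right[OF bounded_bilinear_matrix_mult])
  have "bounded_linear (\<lambda>p. (p :: complex^'n^'m) ** (adj z0 ** A))"
    by (rule bounded_bilinear.bounded_linear_left[OF bounded_bilinear_matrix_mult])
  then have blQ: "bounded_linear (\<lambda>p. (p :: complex^'n^'m) ** adj z0 ** A)" by (simp add: matrix_mul_assoc)
  obtain k1 where k1: "\<And>p::complex^'n^'m. norm (adj D ** adj z0 ** p) \<le> norm p * k1" "k1 > 0"
    using bounded_linear.pos_bounded[OF blR] by blast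
  obtain k2 where k2: "\<And>p::complex^'n^'m. norm (p ** adj z0 ** A) \<le> norm p * k2" "k2 > 0"
    using bounded_linear.pos_bounded[OF blQ] by blast
  define C where "C = \<bar>C1\<bar> + norm (adj D) + \<bar>C1\<bar> * k1 + norm A + \<bar>C1\<bar> * k2 + 1"
  have nn: "0 \<le> \<bar>C1\<bar> * k1" "0 \<le> \<bar>C1\<bar> * k2" using k1 k2 by auto
  have "norm (\<phi> z) \<le> C \<and> norm (R z) \<le> C \<and> norm (Q z) \<le> C" if z: "z \<in> contractions" for z
  proof -
    have p: "norm (\<phi> z) \<le> \<bar>C1\<bar>" using C1[OF z] by simp
    have "norm (adj D ** adj z0 ** \<phi> z) \<le> \<bar>C1\<bar> * k1" "norm (\<phi> z ** adj z0 ** A) \<le> \<bar>C1\<bar> * k2"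
      using k1 k2 p by (meson mult_right_mono order_trans less_imp_le)+
    moreover have "norm (R z) \<le> norm (adj D) + norm (adj D ** adj z0 ** \<phi> z)"
      unfolding R_eq[OF z] by (rule norm_triangle_ineq4)
    moreover have "norm (Q z) \<le> norm A + norm (\<phi> z ** adj z0 ** A)"
      unfolding Q_def by (rule norm_triangle_ineq4)
    moreover have "0 \<le> norm (adj D)" "0 \<le> norm A" "0 \<le> \<bar>C1\<bar>" by auto
    ultimately show ?thesis using p nn unfolding C_def by linarith
  qed
  moreover have "C > 0" unfolding C_def using nn by (intro add_nonneg_pos add_nonneg_nonneg) auto
  ultimately show ?thesis using that by blast
qed

lemma phi_lipschitz: obtains C where "C > 0" "\<And>z p. z \<in> contractions \<Longrightarrow> p \<in> contractions \<Longrightarrow> norm (\<phi> z - \<phi> p) \<le> C * norm (z - p)"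
proof -
  obtain C where C: "C > 0" "\<And>z. z \<in> contractions \<Longrightarrow> norm (R z) \<le> C" "\<And>z. z \<in> contractions \<Longrightarrow> norm (Q z) \<le> C"
    using phi_bound by metis
  obtain k where k: "k > 0" "\<And>a b. norm ((a::complex^'m^'m) ** (b::complex^'n^'m)) \<le> norm a * norm b * k"
    using bounded_bilinear.pos_bounded[OF bounded_bilinear_matrix_mult] by metis
  obtain k' where k': "k' > 0" "\<And>a b. norm ((a::complex^'n^'m) ** (b::complex^'n^'n)) \<le> norm a * norm b * k'"
    using bounded_bilinear.pos_bounded[OF bounded_bilinear_matrix_mult] by metis
  have "norm (\<phi> z - \<phi> p) \<le> (C * k * C * k') * norm (z - p)" if "z \<in> contractions" "p \<in> contractions" for z p
  proof -
    have "norm (\<phi> z - \<phi> p) \<le> norm (Q p ** (z - p)) * norm (R z) * k'"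
      unfolding phi_diff[OF that] by (rule k')
    also have "\<dots> \<le> (norm (Q p) * norm (z - p) * k) * norm (R z) * k'"
      using k k' by (intro mult_right_mono) auto
    also have "\<dots> \<le> (C * norm (z - p) * k) * C * k'"
      using C that k k' by (intro mult_right_mono mult_mono) (auto intro!: mult_nonneg_nonneg)
    finally show ?thesis by (simp add: algebra_simps)
  qed
  then show ?thesis using that[of "C * k * C * k'"] C k k' by simp
qed

lemma phi_continuous_on: "continuous_on contractions \<phi>"
proof -
  obtain C where C: "C > 0" "\<And>z p. z \<in> contractions \<Longrightarrow> p \<in> contractions \<Longrightarrow> norm (\<phi> z - \<phi> p) \<le> C * norm (z - p)"
    using phi_lipschitz by metis
  have "C-lipschitz_on contractions \<phi>"
    by (rule lipschitz_onI) (use C in \<open>auto simp: dist_norm\<close>)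
  then show ?thesis by (rule lipschitz_on_continuous_on)
qed

lemma R_continuous_on: "continuous_on contractions R"
proof -
  have "continuous_on contractions (\<lambda>z. adj D - adj D ** adj z0 ** \<phi> z)"
    by (intro continuous_intros phi_continuous_on)
  then show ?thesis by (rule continuous_on_eq) (simp add: R_eq)
qed

lemma domI_contractions: "p \<in> domI \<Longrightarrow> p \<in> contractions" using domI_subset_contractions by blast

lemma phi_has_derivative:
  assumes p: "p \<in> domI"
  shows "(\<phi> has_derivative (\<lambda>v. Q p ** v ** R p)) (at p)"
proof -
  have bl: "bounded_linear (\<lambda>v. Q p ** v ** R p)"
    using bounded_linear_compose[OF bounded_bilinear.bounded_linear_left[OF bounded_bilinear_matrix_mult, of "R p"]
       bounded_bilinear.bounded_linear_right[OF bounded_bilinear_matrix_mult, of "Q p"]] by simp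
  obtain k where k: "k > 0" "\<And>a b. norm ((a::complex^'m^'m) ** (b::complex^'n^'m)) \<le> norm a * norm b * k"
    using bounded_bilinear.pos_bounded[OF bounded_bilinear_matrix_mult] by metis
  obtain k' where k': "k' > 0" "\<And>a b. norm ((a::complex^'n^'m) ** (b::complex^'n^'n)) \<le> norm a * norm b * k'"
    using bounded_bilinear.pos_bounded[OF bounded_bilinear_matrix_mult] by metis
  define c where "c = norm (Q p) * k * k' + 1"
  have c: "c > 0" "norm (Q p) * k * k' \<le> c" unfolding c_def using k k' by (auto intro!: add_nonneg_pos)
  show ?thesis
    unfolding has_derivative_at_alt
  proof (intro conjI allI impI bl)
    fix e :: real assume e: "e > 0"
    have "isCont R p"
      using R_continuous_on open_domI p domI_subset_contractions continuous_on_subset continuous_on_eq_continuous_at by blast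
    then obtain d1 where d1: "d1 > 0" "\<And>z. norm (z - p) < d1 \<Longrightarrow> norm (R z - R p) < e / c"
      unfolding continuous_at_eps_delta using e c by (metis dist_norm divide_pos_pos)
    obtain d2 where d2: "d2 > 0" "\<And>z. norm (z - p) < d2 \<Longrightarrow> z \<in> domI"
      using open_domI p unfolding open_dist by (metis dist_norm)
    show "\<exists>d>0. \<forall>y. norm (y - p) < d \<longrightarrow> norm (\<phi> y - \<phi> p - Q p ** (y - p) ** R p) \<le> e * norm (y - p)"
    proof (intro exI[of _ "min d1 d2"] conjI allI impI)
      fix y assume y: "norm (y - p) < min d1 d2"
      have yc: "y \<in> contractions" "p \<in> contractions" using d2(2)[of y] y p domI_contractions by auto
      \<comment> \<open>By \<open>phi_diff\<close> the error is exactly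
        \<open>Q p ** (y - p) ** (R y - R p)\<close>, so continuity of \<open>R\<close> is all that
        is needed.\<close>
      have "norm (\<phi> y - \<phi> p - Q p ** (y - p) ** R p) = norm (Q p ** (y - p) ** (R y - R p))"
        unfolding phi_diff[OF yc] by (simp add: matrix_mul_sub_ldistrib)
      also have "\<dots> \<le> (norm (Q p) * norm (y - p) * k) * norm (R y - R p) * k'"
        by (rule order_trans[OF k'(2)]) (use k k' in \<open>intro mult_right_mono; auto\<close>)
      also have "\<dots> = (norm (Q p) * k * k') * (norm (R y - R p) * norm (y - p))" by (simp add: algebra_simps)
      also have "\<dots> \<le> c * ((e / c) * norm (y - p))"
        using c d1(2)[of y] y by (intro mult_mono mult_right_mono) auto
      also have "\<dots> = e * norm (y - p)" using c by simp
      finally show "norm (\<phi> y - \<phi> p - Q p ** (y - p) ** R p) \<le> e * norm (y - p)" .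
    qed (use d1 d2 in auto)
  qed
qed

text \<open>The second derivative of \<open>\<phi>\<close>: the product rule for
  \<open>Q x ** w ** R x\<close>, where \<open>Q\<close> and \<open>R\<close> are affine in
  \<open>\<phi>\<close> and the derivative of \<open>\<phi>\<close> is inserted.\<close>

definition "\<phi>2 p v w = - ((Q p ** v ** R p) ** adj z0 ** A) ** w ** R p - Q p ** w ** (adj D ** adj z0 ** (Q p ** v ** R p))"

lemma phi_has_derivative2:
  assumes p: "p \<in> domI"
  shows "((\<lambda>x. Q x ** w ** R x) has_derivative (\<lambda>v. \<phi>2 p v w)) (at p)"
proof -
  note bm = bounded_bilinear_matrix_mult
  note dp = phi_has_derivative[OF p]
  have dQ: "(Q has_derivative (\<lambda>v. - ((Q p ** v ** R p) ** adj z0 ** A))) (at p)"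
  proof -
    have "((\<lambda>x. A - \<phi> x ** adj z0 ** A) has_derivative (\<lambda>v. 0 - (Q p ** v ** R p) ** adj z0 ** A)) (at p)"
      by (intro has_derivative_diff has_derivative_const
         bounded_linear.has_derivative[OF bounded_bilinear.bounded_linear_left[OF bm]] dp)
    then show ?thesis unfolding Q_def[abs_def] by simp
  qed
  have dR: "(R has_derivative (\<lambda>v. - (adj D ** adj z0 ** (Q p ** v ** R p)))) (at p)"
  proof -
    have "((\<lambda>x. adj D - adj D ** adj z0 ** \<phi> x) has_derivative (\<lambda>v. 0 - adj D ** adj z0 ** (Q p ** v ** R p))) (at p)"
      by (intro has_derivative_diff has_derivative_const
         bounded_linear.has_derivative[OF bounded_bilinear.bounded_linear_right[OF bm]] dp)
    then have d: "((\<lambda>x. adj D - adj D ** adj z0 ** \<phi> x) has_derivative (\<lambda>v. - (adj D ** adj z0 ** (Q p ** v ** R p)))) (at p)"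
      by simp
    have ev: "\<forall>\<^sub>F x in at p. adj D - adj D ** adj z0 ** \<phi> x = R x"
      using eventually_at_in_open'[OF open_domI p] by eventually_elim (simp add: R_eq domI_contractions)
    show ?thesis
      by (rule has_derivative_transform_eventually[OF d ev]) (use p in \<open>auto simp: R_eq domI_contractions\<close>)
  qed
  have "((\<lambda>x. Q x ** w ** R x) has_derivative (\<lambda>v. (Q p ** w) ** - (adj D ** adj z0 ** (Q p ** v ** R p))
      + (- ((Q p ** v ** R p) ** adj z0 ** A) ** w) ** R p)) (at p)"
    by (rule bounded_bilinear.FDERIV[OF bm]
       bounded_linear.has_derivative[OF bounded_bilinear.bounded_linear_left[OF bm]] dQ dR)+
  then show ?thesis unfolding \<phi>2_def by (simp add: matrix_mul_uminus_l matrix_mul_uminus_r algebra_simps)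
qed

text \<open>Complex bilinearity expresses that \<open>\<phi>\<close> is holomorphic; it is the
  reason why the second derivative drops out of \<open>mix\<close>.\<close>

lemma phi2_complex: "\<phi>2 p (cscale c v) w = cscale c (\<phi>2 p v w)" "\<phi>2 p v (cscale c w) = cscale c (\<phi>2 p v w)"
  unfolding \<phi>2_def by (simp_all add: cscale_mult_l cscale_mult_r cscale_diff cscale_minus cscale_add flip: cscale_minus)

end

section \<open>The Hua matrix and the Laplacian\<close>

text \<open>For a real Hessian \<open>H\<close> this is the mixed derivative \<open>\<partial>\<^sub>v\<close> \<open>\<partial>\<close>-bar\<open>\<^sub>w\<close>;
  the holomorphic second derivatives of a coordinate change cancel in it.\<close>

definition mix :: "(complex^'n^'m \<Rightarrow> complex^'n^'m \<Rightarrow> complex) \<Rightarrow> complex^'n^'m \<Rightarrow> complex^'n^'m \<Rightarrow> complex" where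
  "mix H v w = (H v w + H (cscale \<i> v) (cscale \<i> w) + \<i> * (H v (cscale \<i> w) - H (cscale \<i> v) w)) / 4"

lemma cscale_zero: "cscale 0 x = 0" by (simp add: vec_eq_iff)

lemma cscale_split: "cscale c v = Re c *\<^sub>R v + Im c *\<^sub>R cscale \<i> v"
  by (simp add: vec_eq_iff scaleR_conv_of_real[where 'a = complex])
     (metis complex_eq distrib_right mult.assoc mult.commute)

lemma mix_sesq:
  assumes "bilinear H"
  shows "mix H (v + v') w = mix H v w + mix H v' w" "mix H v (w + w') = mix H v w + mix H v w'"
    "mix H (cscale c v) w = c * mix H v w" "mix H v (cscale c w) = cnj c * mix H v w"
proof -
  note b = bilinear_ladd[OF assms] bilinear_radd[OF assms] bilinear_lmul[OF assms] bilinear_rmul[OF assms]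
    bilinear_lneg[OF assms] bilinear_rneg[OF assms]
  show "mix H (v + v') w = mix H v w + mix H v' w" "mix H v (w + w') = mix H v w + mix H v w'"
    by (auto simp: mix_def cscale_add b algebra_simps add_divide_distrib diff_divide_distrib)
  have 1: "cscale \<i> (cscale c v) = Re c *\<^sub>R cscale \<i> v + (- Im c) *\<^sub>R v" for v :: "complex^'a^'b"
    by (simp add: vec_eq_iff complex_eq_iff algebra_simps)
  have "mix H (cscale c v) w = (of_real (Re c) + \<i> * of_real (Im c)) * mix H v w"
    unfolding mix_def 1 unfolding cscale_split[of c] b
    by (simp add: scaleR_conv_of_real field_simps)
  then show "mix H (cscale c v) w = c * mix H v w" by (simp flip: complex_eq)
  have "mix H v (cscale c w) = (of_real (Re c) - \<i> * of_real (Im c)) * mix H v w"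
    unfolding mix_def 1 unfolding cscale_split[of c] b
    by (simp add: scaleR_conv_of_real field_simps)
  moreover have "of_real (Re c) - \<i> * of_real (Im c) = cnj c" by (simp add: complex_eq_iff)
  ultimately show "mix H v (cscale c w) = cnj c * mix H v w" by simp
qed

lemma has_hess_bilinear: "has_hess f f1 H p \<Longrightarrow> bilinear H"
  unfolding bilinear_def using has_hess_linear_left has_hess_linear_right bounded_linear.linear by blast

lemma mix_sum:
  assumes "bilinear H"
  shows "mix H (\<Sum>i\<in>I. cscale (c i) (v i)) w = (\<Sum>i\<in>I. c i * mix H (v i) w)"
    "mix H w (\<Sum>i\<in>I. cscale (c i) (v i)) = (\<Sum>i\<in>I. cnj (c i) * mix H w (v i))"
proof -
  have z: "mix H 0 w = 0" "mix H w 0 = 0"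
    using mix_sesq(3)[OF assms, of 0 0 w] mix_sesq(4)[OF assms, of w 0 0] by (simp_all add: cscale_zero)
  show "mix H (\<Sum>i\<in>I. cscale (c i) (v i)) w = (\<Sum>i\<in>I. c i * mix H (v i) w)"
    by (induction I rule: infinite_finite_induct) (auto simp: z mix_sesq[OF assms])
  show "mix H w (\<Sum>i\<in>I. cscale (c i) (v i)) = (\<Sum>i\<in>I. cnj (c i) * mix H w (v i))"
    by (induction I rule: infinite_finite_induct) (auto simp: z mix_sesq[OF assms])
qed

text \<open>\<open>P\<close> supplies the tangent directions: the identity for rectangular matrices,
  \<open>symP\<close> otherwise. The weight \<open>Wm\<close> serves all cases because it agrees
  with \<open>Vm\<close> on symmetric and antisymmetric matrices.\<close>

definition hua :: "(complex^'n^'m \<Rightarrow> complex^'n^'m) \<Rightarrow> (complex^'n^'m \<Rightarrow> complex^'n^'m \<Rightarrow> complex) \<Rightarrow> complex^'n^'m \<Rightarrow> 'm \<Rightarrow> 'm \<Rightarrow> complex" where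
  "hua P H p j k = (\<Sum>a\<in>UNIV. \<Sum>b\<in>UNIV. Wm p a b * mix H (P (emat 1 j a)) (P (emat 1 k b)))"

definition lap :: "(complex^'n^'m \<Rightarrow> complex^'n^'m) \<Rightarrow> (complex^'n^'m \<Rightarrow> complex^'n^'m \<Rightarrow> complex) \<Rightarrow> complex^'n^'m \<Rightarrow> complex" where
  "lap P H p = (\<Sum>j\<in>UNIV. \<Sum>k\<in>UNIV. Vm p j k * hua P H p j k)"

lemma emat_nth [simp]: "emat c j a $ p $ q = (if p = j \<and> q = a then c else 0)"
  by (simp add: emat_def)

lemma emat_eq_cscale: "emat c j a = cscale c (emat 1 j a)" by (simp add: vec_eq_iff)

lemma mult_emat_mult: "Q ** emat 1 j a ** R = (\<Sum>(q, s)\<in>UNIV. cscale (Q $ q $ j * R $ a $ s) (emat 1 q s))"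
proof -
  have "(Q ** emat 1 j a ** R) $ p $ r = Q $ p $ j * R $ a $ r" for p r
  proof -
    have "(Q ** emat 1 j a) $ p $ b = (if b = a then Q $ p $ j else 0)" for b
      by (auto simp: matrix_mul_nth if_distrib cong: if_cong)
    then show ?thesis by (simp add: matrix_mul_nth[of _ R] if_distrib[of "\<lambda>x. x * _"] cong: if_cong)
  qed
  moreover have "(\<Sum>(q, s)\<in>UNIV. cscale (Q $ q $ j * R $ a $ s) (emat 1 q s)) $ p $ r = Q $ p $ j * R $ a $ r" for p r
  proof -
    have "(\<Sum>(q, s)\<in>UNIV. cscale (Q $ q $ j * R $ a $ s) (emat 1 q s)) $ p $ r
       = (\<Sum>x\<in>UNIV. if x = (p, r) then Q $ fst x $ j * R $ a $ snd x else 0)"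
      by (auto simp: case_prod_beta prod_eq_iff intro!: sum.cong)
    then show ?thesis by simp
  qed
  ultimately show ?thesis by (simp add: vec_eq_iff)
qed

text \<open>A map with derivative \<open>x \<mapsto> Q ** x ** R\<close> moves both indices of a
  coordinate direction. The sum weighted by \<open>Wm\<close> absorbs \<open>R\<close>, and only the
  congruence by \<open>Q\<close> survives.\<close>

lemma hua_transform:
  fixes P :: "complex^'n^'m \<Rightarrow> complex^'n^'m"
  assumes H: "bilinear H" and Padd: "\<And>x y. P (x + y) = P x + P y" and Pcsm: "\<And>c x. P (cscale c x) = cscale c (P x)"
    and QR: "\<And>x. Q ** P x ** R = P (Q ** x ** R)"
    and W: "Wmat p' = adj R ** Wmat p ** R"
    and H': "\<And>v w. mix H' v w = mix H (Q ** v ** R) (Q ** w ** R)"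
  shows "hua P H' p j k = (\<Sum>q\<in>UNIV. \<Sum>r\<in>UNIV. Q $ q $ j * cnj (Q $ r $ k) * hua P H p' q r)"
proof -
  have P0: "P 0 = 0" using Padd[of 0 0] by simp
  have Psum: "P (\<Sum>i\<in>I. cscale (c i) (v i)) = (\<Sum>i\<in>I. cscale (c i) (P (v i)))" for I :: "('m \<times> 'n) set" and c v
    by (induction I rule: infinite_finite_induct) (auto simp: P0 Padd Pcsm)
  define m where "m q s r t = mix H (P (emat 1 q s)) (P (emat 1 r t))" for q s r t
  have e: "mix H' (P (emat 1 j a)) (P (emat 1 k b))
     = (\<Sum>(q, s)\<in>UNIV. \<Sum>(r, t)\<in>UNIV. (Q $ q $ j * R $ a $ s) * (cnj (Q $ r $ k * R $ b $ t) * m q s r t))" for a b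
    unfolding H' QR mult_emat_mult case_prod_beta Psum mix_sum(1)[OF H]
    unfolding mix_sum(2)[OF H] by (simp add: sum_distrib_left m_def mult.assoc)
  have Ws: "(\<Sum>a\<in>UNIV. \<Sum>b\<in>UNIV. R $ a $ s * Wm p a b * cnj (R $ b $ t)) = Wm p' s t" for s t
  proof -
    have "Wm p' s t = (\<Sum>a\<in>UNIV. (\<Sum>b\<in>UNIV. cnj (R $ b $ t) * Wmat p $ b $ a) * R $ a $ s)"
      unfolding Wm_eq W by (simp add: matrix_mul_nth)
    then show ?thesis by (simp add: sum_distrib_right sum_distrib_left Wm_eq algebra_simps)
  qed
  have "hua P H' p j k = (\<Sum>a\<in>UNIV. \<Sum>b\<in>UNIV. Wm p a b *
      (\<Sum>q\<in>UNIV. \<Sum>s\<in>UNIV. \<Sum>r\<in>UNIV. \<Sum>t\<in>UNIV. (Q $ q $ j * R $ a $ s) * (cnj (Q $ r $ k * R $ b $ t) * m q s r t)))"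
    unfolding hua_def e UNIV_Times_UNIV[symmetric] sum.cartesian_product[symmetric] ..
  also have "\<dots> = (\<Sum>a\<in>UNIV. \<Sum>b\<in>UNIV. \<Sum>q\<in>UNIV. \<Sum>s\<in>UNIV. \<Sum>r\<in>UNIV. \<Sum>t\<in>UNIV.
      (Q $ q $ j * cnj (Q $ r $ k) * m q s r t) * (R $ a $ s * Wm p a b * cnj (R $ b $ t)))"
    by (simp add: sum_distrib_left algebra_simps)
  also have "\<dots> = (\<Sum>q\<in>UNIV. \<Sum>s\<in>UNIV. \<Sum>r\<in>UNIV. \<Sum>t\<in>UNIV. \<Sum>a\<in>UNIV. \<Sum>b\<in>UNIV.
      (Q $ q $ j * cnj (Q $ r $ k) * m q s r t) * (R $ a $ s * Wm p a b * cnj (R $ b $ t)))"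
  proof -
    let ?g = "\<lambda>a b q s r t. (Q $ q $ j * cnj (Q $ r $ k) * m q s r t) * (R $ a $ s * Wm p a b * cnj (R $ b $ t))"
    have "(\<Sum>a\<in>UNIV. \<Sum>b\<in>UNIV. \<Sum>q\<in>UNIV. \<Sum>s\<in>UNIV. \<Sum>r\<in>UNIV. \<Sum>t\<in>UNIV. ?g a b q s r t)
       = (\<Sum>(a,b)\<in>UNIV. \<Sum>(q,s,r,t)\<in>UNIV. ?g a b q s r t)"
      unfolding UNIV_Times_UNIV[symmetric] sum.cartesian_product[symmetric] ..
    also have "\<dots> = (\<Sum>(q,s,r,t)\<in>UNIV. \<Sum>(a,b)\<in>UNIV. ?g a b q s r t)"
      unfolding case_prod_beta by (rule sum.swap)
    also have "\<dots> = (\<Sum>q\<in>UNIV. \<Sum>s\<in>UNIV. \<Sum>r\<in>UNIV. \<Sum>t\<in>UNIV. \<Sum>a\<in>UNIV. \<Sum>b\<in>UNIV. ?g a b q s r t)"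
      unfolding UNIV_Times_UNIV[symmetric] sum.cartesian_product[symmetric] ..
    finally show ?thesis .
  qed
  also have "\<dots> = (\<Sum>q\<in>UNIV. \<Sum>s\<in>UNIV. \<Sum>r\<in>UNIV. \<Sum>t\<in>UNIV. (Q $ q $ j * cnj (Q $ r $ k) * m q s r t) * Wm p' s t)"
    by (simp add: sum_distrib_left[symmetric] Ws)
  also have "\<dots> = (\<Sum>q\<in>UNIV. \<Sum>r\<in>UNIV. \<Sum>s\<in>UNIV. \<Sum>t\<in>UNIV. (Q $ q $ j * cnj (Q $ r $ k) * m q s r t) * Wm p' s t)"
    by (rule sum.cong[OF refl], rule sum.swap)
  also have "\<dots> = (\<Sum>q\<in>UNIV. \<Sum>r\<in>UNIV. Q $ q $ j * cnj (Q $ r $ k) * hua P H p' q r)"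
    unfolding hua_def m_def by (simp add: sum_distrib_left algebra_simps)
  finally show ?thesis .
qed

text \<open>The Laplacian contracts \<open>Vm\<close> with the Hua matrix, so the congruence by
  \<open>Q\<close> on one side is absorbed by that of \<open>Vmat\<close> on the other.\<close>

lemma lap_transform:
  fixes Q :: "complex^'m^'m"
  assumes V: "Vmat p' = Q ** Vmat p ** adj Q"
    and h: "\<And>j k. hua P H' p j k = (\<Sum>q\<in>UNIV. \<Sum>r\<in>UNIV. Q $ q $ j * cnj (Q $ r $ k) * hua P H p' q r)"
  shows "lap P H' p = lap P H p'"
proof -
  have Vs: "(\<Sum>j\<in>UNIV. \<Sum>k\<in>UNIV. Q $ q $ j * Vm p j k * cnj (Q $ r $ k)) = Vm p' q r" for q r
  proof -
    have "Vm p' q r = (\<Sum>k\<in>UNIV. (\<Sum>j\<in>UNIV. Q $ q $ j * Vmat p $ j $ k) * cnj (Q $ r $ k))"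
      unfolding Vm_eq V by (simp add: matrix_mul_nth)
    also have "\<dots> = (\<Sum>k\<in>UNIV. \<Sum>j\<in>UNIV. Q $ q $ j * Vm p j k * cnj (Q $ r $ k))"
      by (simp add: sum_distrib_right Vm_eq)
    finally show ?thesis by (subst sum.swap) (rule sym)
  qed
  let ?g = "\<lambda>j k q r. hua P H p' q r * (Q $ q $ j * Vm p j k * cnj (Q $ r $ k))"
  have "lap P H' p = (\<Sum>j\<in>UNIV. \<Sum>k\<in>UNIV. \<Sum>q\<in>UNIV. \<Sum>r\<in>UNIV. ?g j k q r)"
    unfolding lap_def h by (simp add: sum_distrib_left algebra_simps)
  also have "\<dots> = (\<Sum>(j,k)\<in>UNIV. \<Sum>(q,r)\<in>UNIV. ?g j k q r)"
    unfolding UNIV_Times_UNIV[symmetric] sum.cartesian_product[symmetric] ..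
  also have "\<dots> = (\<Sum>(q,r)\<in>UNIV. \<Sum>(j,k)\<in>UNIV. ?g j k q r)"
    unfolding case_prod_beta by (rule sum.swap)
  also have "\<dots> = (\<Sum>q\<in>UNIV. \<Sum>r\<in>UNIV. \<Sum>j\<in>UNIV. \<Sum>k\<in>UNIV. ?g j k q r)"
    unfolding UNIV_Times_UNIV[symmetric] sum.cartesian_product[symmetric] ..
  also have "\<dots> = lap P H p'"
    unfolding lap_def sum_distrib_left[symmetric] Vs by (simp only: mult.commute)
  finally show ?thesis .
qed

lemma mix_compose:
  assumes H: "bilinear H" and L: "linear L" and T: "\<And>v. T (cscale \<i> v) = cscale \<i> (T v)"
    and B: "\<And>v w. B (cscale \<i> v) w = cscale \<i> (B v w)" "\<And>v w. B v (cscale \<i> w) = cscale \<i> (B v w)"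
  shows "mix (\<lambda>v w. H (T v) (T w) + L (B v w)) v w = mix H (T v) (T w)"
  by (simp add: mix_def T B linear_neg[OF L] algebra_simps)

section \<open>Twice differentiable functions and the comparison function
  \<open>|z|^2\<close>\<close>

definition hessian :: "('a::euclidean_space \<Rightarrow> complex) \<Rightarrow> 'a \<Rightarrow> 'a \<Rightarrow> 'a \<Rightarrow> complex" where
  "hessian f p = (\<lambda>v w. frechet_derivative (\<lambda>x. frechet_derivative f (at x) w) (at p) v)"

definition twice_diff :: "('a::euclidean_space \<Rightarrow> complex) \<Rightarrow> 'a \<Rightarrow> bool" where
  "twice_diff f p \<longleftrightarrow> (\<exists>f1 H. has_hess f f1 H p)"

lemma has_hess_hessian: "has_hess f f1 H p \<Longrightarrow> hessian f p = H"
  unfolding hessian_def by (intro ext) (rule has_hess_frechet)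

lemma twice_diff_hessian: "twice_diff f p \<Longrightarrow> \<exists>f1. has_hess f f1 (hessian f p) p"
  unfolding twice_diff_def using has_hess_hessian by metis

lemma twice_diffI: "has_hess f f1 H p \<Longrightarrow> twice_diff f p" unfolding twice_diff_def by blast

definition mat_ip :: "complex^'n^'m \<Rightarrow> complex^'n^'m \<Rightarrow> complex" where
  "mat_ip v w = (\<Sum>i\<in>UNIV. \<Sum>j\<in>UNIV. v $ i $ j * cnj (w $ i $ j))"

lemma inner_mat_ip: "v \<bullet> w = Re (mat_ip v w)"
  by (simp add: mat_ip_def inner_vec_def inner_complex_def)

lemma mat_ip_cscale: "mat_ip (cscale c v) w = c * mat_ip v w" "mat_ip v (cscale c w) = cnj c * mat_ip v w"
  by (simp_all add: mat_ip_def sum_distrib_left algebra_simps)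

definition normsq_hess :: "complex^'n^'m \<Rightarrow> complex^'n^'m \<Rightarrow> complex" where
  "normsq_hess v w = of_real (2 * (v \<bullet> w))"

lemma mix_normsq_hess: "mix normsq_hess v w = mat_ip v w"
  by (simp add: mix_def normsq_hess_def inner_mat_ip mat_ip_cscale complex_eq_iff)

lemma has_hess_normsq: "has_hess (\<lambda>z. complex_of_real ((norm z)\<^sup>2)) (\<lambda>x w. of_real (2 * (x \<bullet> w))) normsq_hess p"
  unfolding has_hess_def normsq_hess_def power2_norm_eq_inner
  by (auto intro!: always_eventually derivative_eq_intros simp: inner_commute)

text \<open>Symmetry of the Hessian removes the imaginary part, so the sign at a maximum can be read
  off from two pure second derivatives.\<close>

lemma Re_mix_self:
  assumes "has_hess f f1 H p"
  shows "mix H v v = (H v v + H (cscale \<i> v) (cscale \<i> v)) / 4"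
  using has_hess_symmetric[OF assms, of v "cscale \<i> v"] by (simp add: mix_def)

lemma Vmat_0 [simp]: "Vmat 0 = mat 1" and Wmat_0 [simp]: "Wmat 0 = mat 1"
  by (simp_all add: Vmat_def Wmat_def)

lemma lap_0: "lap P H 0 = (\<Sum>j\<in>UNIV. \<Sum>a\<in>UNIV. mix H (P (emat 1 j a)) (P (emat 1 j a)))"
  by (simp add: lap_def hua_def Vm_eq Wm_eq mat_def if_distrib[of "\<lambda>x. x * _"] cong: if_cong)

lemma hua_0: "hua P H 0 j k = (\<Sum>a\<in>UNIV. mix H (P (emat 1 j a)) (P (emat 1 k a)))"
  by (simp add: hua_def Wm_eq mat_def if_distrib[of "\<lambda>x. x * _"] cong: if_cong)

lemma mix_plus: "mix (\<lambda>v w. H v w + G v w) v w = mix H v w + mix G v w"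
  by (simp add: mix_def algebra_simps add_divide_distrib diff_divide_distrib)
lemma mix_times: "mix (\<lambda>v w. c * H v w) v w = c * mix H v w"
  by (simp add: mix_def algebra_simps)
lemma hua_plus: "hua P (\<lambda>v w. H v w + G v w) p j k = hua P H p j k + hua P G p j k"
  by (simp add: hua_def mix_plus algebra_simps sum.distrib)
lemma hua_times: "hua P (\<lambda>v w. c * H v w) p j k = c * hua P H p j k"
  by (simp add: hua_def mix_times algebra_simps sum_distrib_left)
lemma lap_plus: "lap P (\<lambda>v w. H v w + G v w) p = lap P H p + lap P G p"
  by (simp add: lap_def hua_plus algebra_simps sum.distrib)
lemma lap_times: "lap P (\<lambda>v w. c * H v w) p = c * lap P H p"
  by (simp add: lap_def hua_times algebra_simps sum_distrib_left)

lemma has_hess_cmult: "has_hess f f1 H p \<Longrightarrow> has_hess (\<lambda>x. c * f x) (\<lambda>x w. c * f1 x w) (\<lambda>v w. c * H v w) p"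
  for c :: complex
  by (rule has_hess_bounded_linear[OF _ bounded_linear_mult_right])

text \<open>For a contraction \<open>Vmat z\<close> is positive semidefinite, so its trace can
  vanish only with the whole matrix. This lets the trace measure the distance from the Shilov
  boundary.\<close>

lemma Vmat_zero_if_trace_zero:
  fixes z :: "complex^'n^'m"
  assumes z: "z \<in> contractions" and t: "Re (\<Sum>j\<in>UNIV. Vmat z $ j $ j) \<le> 0"
  shows "Vmat z = 0"
proof -
  have pos: "0 \<le> Re (cin v (Vmat z *v v))" for v
  proof -
    have "norm (adj z *v v) \<le> norm v" by (rule norm_adj_le) (use z in \<open>auto simp: contractions_def\<close>)
    then show ?thesis by (simp add: cin_Vmat power_mono)
  qed
  have Vmat_mv: "(Vmat z *v axis j 1) $ i = Vmat z $ i $ j" for i j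
    by (simp add: matrix_vector_mult_def axis_def if_distrib cong: if_cong)
  have ax: "cin (axis j 1) x = x $ j" for j and x :: "complex^'m"
    by (simp add: cin_def axis_def if_distrib[of cnj] if_distrib[of "\<lambda>x. x * _"] cong: if_cong)
  have d0: "0 \<le> Re (Vmat z $ j $ j)" for j
    using pos[of "axis j 1"] by (simp add: ax Vmat_mv)
  have "(\<Sum>j\<in>UNIV. Re (Vmat z $ j $ j)) = 0"
    using t sum_nonneg[of UNIV "\<lambda>j. Re (Vmat z $ j $ j)"] d0 by simp
  then have dz: "Re (Vmat z $ j $ j) = 0" for j
    using d0 by (simp add: sum_nonneg_eq_0_iff)
  have herm: "Vmat z $ k $ j = cnj (Vmat z $ j $ k)" for j k
    using adj_nth[of "Vmat z" k j] by simp
  have "Vmat z $ j $ k = 0" for j k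
  proof -
    \<comment> \<open>With both diagonal entries zero, this coefficient makes the form at
      \<open>v\<close> equal to \<open>-2\<close> times the squared modulus of the off-diagonal
      entry.\<close>
    define a where "a = - (Vmat z $ j $ k)"
    define v :: "complex^'m" where "v = a *s axis j 1 + axis k 1"
    have sm: "Vmat z *v (a *s axis j 1) = a *s (Vmat z *v axis j 1)"
      by (simp add: vec_eq_iff matrix_vector_mult_def sum_distrib_left algebra_simps)
    have "cin v (Vmat z *v v) = cnj a * a * Vmat z $ j $ j + Vmat z $ k $ k + cnj a * Vmat z $ j $ k + a * Vmat z $ k $ j"
      unfolding v_def matrix_vector_right_distrib sm
      by (simp add: cin_left cin_right ax Vmat_mv algebra_simps)
    also have "Re \<dots> = - 2 * (cmod (Vmat z $ j $ k))\<^sup>2"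
      using dz herm[of j k] unfolding a_def cmod_power2
      by (simp add: power2_eq_square)
    finally have "(cmod (Vmat z $ j $ k))\<^sup>2 \<le> 0" using pos[of v] by simp
    then show ?thesis by simp
  qed
  then show ?thesis by (simp add: vec_eq_iff)
qed

text \<open>A common setting for the three domains \<open>domI \<inter> L\<close>. The direction \<open>P (emat 1 j a)\<close> is the one in which
  the (weighted) coordinate derivative of the paper differentiates, and \<open>K\<close> consists of pairs acting
  by \<open>z \<mapsto> k ** z ** h\<close>. By \<open>K_stab\<close> the stabiliser of a point of the Shilov boundary fixes no
  nonzero traceless matrix under conjugation. The hypotheses \<open>CARD('m) \<le> CARD('n)\<close> and \<open>even CARD('n)\<close>
  of the theorem enter only through \<open>lap_low\<close>.\<close>

locale hua_domain =
  fixes P :: "complex^'n^'m \<Rightarrow> complex^'n^'m" and L :: "(complex^'n^'m) set"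
    and K :: "((complex^'m^'m) \<times> (complex^'n^'n)) set"
  assumes P_add: "\<And>x y. P (x + y) = P x + P y" and P_cscale: "\<And>c x. P (cscale c x) = cscale c (P x)"
    and P_L: "\<And>x. P x \<in> L"
    and L_add: "\<And>x y. x \<in> L \<Longrightarrow> y \<in> L \<Longrightarrow> x + y \<in> L" and L_cscale: "\<And>c x. x \<in> L \<Longrightarrow> cscale c x \<in> L"
    and mobius_ex: "\<And>z0. z0 \<in> domI \<Longrightarrow> z0 \<in> L \<Longrightarrow> \<exists>A D. mobius z0 A D \<and>
        (\<forall>z\<in>contractions \<inter> L. mobius.\<phi> z0 A D z \<in> L \<and>
           (\<forall>x. mobius.Q z0 A D z ** P x ** mobius.R z0 A D z = P (mobius.Q z0 A D z ** x ** mobius.R z0 A D z)))"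
    and K_unitary: "\<And>k h. (k, h) \<in> K \<Longrightarrow> adj k ** k = mat 1 \<and> adj h ** h = mat 1"
    and K_L: "\<And>k h z. (k, h) \<in> K \<Longrightarrow> z \<in> L \<Longrightarrow> k ** z ** h \<in> L"
    and K_P: "\<And>k h x. (k, h) \<in> K \<Longrightarrow> k ** P x ** h = P (k ** x ** h)"
    and K_one: "(mat 1, mat 1) \<in> K"
    and K_stab: "\<And>\<xi> Y. \<xi> \<in> L \<Longrightarrow> Vmat \<xi> = 0 \<Longrightarrow> (\<Sum>i\<in>UNIV. Y $ i $ i) = 0 \<Longrightarrow>
        (\<And>k h. (k, h) \<in> K \<Longrightarrow> k ** \<xi> ** h = \<xi> \<Longrightarrow> adj k ** Y ** k = Y) \<Longrightarrow> Y = 0"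
    and lap_low: "\<exists>c>0. \<forall>z\<in>domI \<inter> L. c * (Re (\<Sum>j\<in>UNIV. Vmat z $ j $ j))\<^sup>2 \<le> Re (lap P normsq_hess z)"
begin

definition "DL = domI \<inter> L"
definition "SL = {z\<in>L. Vmat z = 0}"

lemma L_0: "0 \<in> L" using P_L[of 0] P_cscale[of 0 0] by (metis cscale_zero)

lemma L_scaleR: "x \<in> L \<Longrightarrow> r *\<^sub>R x \<in> L" by (simp add: scaleR_cscale L_cscale)

lemma closed_L: "closed L"
  by (rule closed_subspace) (auto simp: subspace_def L_0 L_add L_scaleR)

lemma closure_DL: "closure DL \<subseteq> contractions \<inter> L"
  unfolding DL_def by (rule closure_minimal) (use domI_subset_contractions closed_L closed_contractions in auto)

lemma compact_closure_DL: "compact (closure DL)"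
  using closure_DL bounded_contractions by (meson bounded_subset bounded_Int closed_closure compact_eq_bounded_closed)

lemma zero_DL: "0 \<in> DL" unfolding DL_def using L_0 ball_subset_domI[of 0] by simp

text \<open>What is needed of an automorphism, stated without its factors: it acts on the Hua matrix
  by congruence and leaves the Laplacian alone.\<close>

definition "pulls_back \<psi> Q p \<longleftrightarrow> (\<forall>f f1 H. has_hess f f1 H (\<psi> p) \<longrightarrow> (\<exists>g1 H'. has_hess (\<lambda>x. f (\<psi> x) :: complex) g1 H' p \<and>
   (\<forall>j k. hua P H' p j k = (\<Sum>q\<in>UNIV. \<Sum>r\<in>UNIV. Q $ q $ j * cnj (Q $ r $ k) * hua P H (\<psi> p) q r)) \<and>
   lap P H' p = lap P H (\<psi> p)))"

lemma pulls_backD: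
  assumes "pulls_back \<psi> Q p" "has_hess f f1 H (\<psi> p)"
  shows "\<exists>g1 H'. has_hess (\<lambda>x. f (\<psi> x) :: complex) g1 H' p \<and>
   (\<forall>j k. hua P H' p j k = (\<Sum>q\<in>UNIV. \<Sum>r\<in>UNIV. Q $ q $ j * cnj (Q $ r $ k) * hua P H (\<psi> p) q r)) \<and>
   lap P H' p = lap P H (\<psi> p)"
  using assms unfolding pulls_back_def by blast

text \<open>Invertibility of \<open>Q 0\<close> follows from
  \<open>Vmat z0 = Q 0 ** adj (Q 0)\<close>; it allows the vanishing of the Hua matrix at 0 to be
  carried back to \<open>z0\<close>.\<close>

lemma chart_obtain:
  assumes z0: "z0 \<in> DL"
  obtains \<psi> Q where "\<psi> 0 = z0" "\<And>z. z \<in> DL \<Longrightarrow> \<psi> z \<in> DL" "continuous_on contractions \<psi>"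
    "\<And>p. p \<in> DL \<Longrightarrow> pulls_back \<psi> (Q p) p" "invertible (Q 0)"
proof -
  obtain A D where m: "mobius z0 A D"
    and LL: "\<And>z. z \<in> contractions \<inter> L \<Longrightarrow> mobius.\<phi> z0 A D z \<in> L"
    and PP: "\<And>z x. z \<in> contractions \<inter> L \<Longrightarrow> mobius.Q z0 A D z ** P x ** mobius.R z0 A D z = P (mobius.Q z0 A D z ** x ** mobius.R z0 A D z)"
    using mobius_ex[of z0] z0 unfolding DL_def by blast
  interpret mobius z0 A D by (rule m)
  show ?thesis
  proof (rule that[of \<phi> Q])
    show "\<phi> 0 = z0" by (rule phi_0)
    show "\<And>z. z \<in> DL \<Longrightarrow> \<phi> z \<in> DL" unfolding DL_def using phi_domI LL domI_contractions by blast
    show "continuous_on contractions \<phi>" by (rule phi_continuous_on)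
    have z: "(0::complex^'n^'m) \<in> contractions" by (simp add: contractions_def)
    have "invertible (Vmat z0)"
      by (rule invertible_if_inj) (metis Vmat_posdef[OF mobius.z0[OF m]] cin_right(5) less_irrefl zero_complex.simps(1))
    moreover have "Vmat z0 = Q 0 ** (Vmat 0 ** adj (Q 0))"
      using Vmat_phi[OF z] phi_0 by (simp add: matrix_mul_assoc)
    ultimately show "invertible (Q 0)" by (metis det_mul invertible_det_nz mult_eq_0_iff)
  next
    fix p assume p: "p \<in> DL"
    show "pulls_back \<phi> (Q p) p" unfolding pulls_back_def
    proof (intro allI impI)
      fix f f1 H assume f: "has_hess (f :: _ \<Rightarrow> complex) f1 H (\<phi> p)"
      have pd: "p \<in> domI" "p \<in> contractions" "p \<in> L" using p domI_contractions by (auto simp: DL_def)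
      have ev: "\<forall>\<^sub>F x in nhds p. (\<phi> has_derivative (\<lambda>v. Q x ** v ** R x)) (at x)"
        using eventually_nhds_in_open[OF open_domI pd(1)] by eventually_elim (rule phi_has_derivative)
      define H' where "H' = (\<lambda>v w. H (Q p ** v ** R p) (Q p ** w ** R p) + f1 (\<phi> p) (\<phi>2 p v w))"
      have h: "has_hess (\<lambda>x. f (\<phi> x)) (\<lambda>x w. f1 (\<phi> x) (Q x ** w ** R x)) H' p"
        unfolding H'_def using has_hess_compose[where \<phi> = \<phi> and p = p and f = f, OF f, of "\<lambda>x v. Q x ** v ** R x", OF ev phi_has_derivative2[OF pd(1)]] .
      have mx: "mix H' v w = mix H (Q p ** v ** R p) (Q p ** w ** R p)" for v w
        unfolding H'_def
        by (rule mix_compose[OF has_hess_bilinear[OF f] has_derivative_linear[OF has_hess_deriv[OF f]]])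
           (simp_all add: cscale_mult_l cscale_mult_r phi2_complex)
      have hu: "hua P H' p j k = (\<Sum>q\<in>UNIV. \<Sum>r\<in>UNIV. Q p $ q $ j * cnj (Q p $ r $ k) * hua P H (\<phi> p) q r)" for j k
        by (rule hua_transform[OF has_hess_bilinear[OF f] P_add P_cscale])
           (use PP pd Wmat_phi mx in auto)
      have "lap P H' p = lap P H (\<phi> p)"
        by (rule lap_transform[OF _ hu]) (simp add: Vmat_phi pd)
      with h hu show "\<exists>g1 H'. has_hess (\<lambda>x. f (\<phi> x)) g1 H' p \<and>
         (\<forall>j k. hua P H' p j k = (\<Sum>q\<in>UNIV. \<Sum>r\<in>UNIV. Q p $ q $ j * cnj (Q p $ r $ k) * hua P H (\<phi> p) q r)) \<and>
         lap P H' p = lap P H (\<phi> p)" by blast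
    qed
  qed
qed

lemma chart_exists:
  assumes "z0 \<in> DL"
  shows "\<exists>\<psi> Q. \<psi> 0 = z0 \<and> (\<forall>z\<in>DL. \<psi> z \<in> DL) \<and> continuous_on contractions \<psi> \<and> (\<forall>p\<in>DL. pulls_back \<psi> (Q p) p) \<and> invertible (Q 0)"
  by (rule chart_obtain[OF assms]) blast

section \<open>The maximum principle for the Shilov boundary\<close>

text \<open>In the chart centred at \<open>y\<close> the Laplacian is a plain sum of terms
  \<open>mix H' v v\<close> with \<open>v = P (emat 1 j a)\<close>. The real part of each is a
  positive multiple of a sum of two pure second derivatives along \<open>L\<close>, which are
  nonpositive at a maximum.\<close>

lemma local_max_lap:
  assumes y: "y \<in> DL" and F: "has_hess F f1 H y" and d: "0 < d"
    and mx: "\<And>x. x \<in> DL \<Longrightarrow> norm (x - y) < d \<Longrightarrow> Re (F x) \<le> Re (F y)"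
  shows "Re (lap P H y) \<le> 0"
proof -
  obtain \<psi> Q where psi0: "\<psi> 0 = y" and psiD: "\<And>z. z \<in> DL \<Longrightarrow> \<psi> z \<in> DL" and psic: "continuous_on contractions \<psi>"
    and tr: "\<And>p. p \<in> DL \<Longrightarrow> pulls_back \<psi> (Q p) p" and "invertible (Q 0)"
    using chart_exists[OF y] by blast
  obtain g1 H' where g: "has_hess (\<lambda>x. F (\<psi> x)) g1 H' 0" "lap P H' 0 = lap P H y"
    using pulls_backD[OF tr[OF zero_DL], of F f1 H] F psi0 by auto
  have gR: "has_hess (\<lambda>x. Re (F (\<psi> x))) (\<lambda>x w. Re (g1 x w)) (\<lambda>v w. Re (H' v w)) 0"
    by (rule has_hess_bounded_linear[OF g(1) bounded_linear_Re])
  have neg: "Re (H' v v) \<le> 0" if v: "v \<in> L" for v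
  proof -
    have "isCont \<psi> 0"
      using psic open_domI domI_subset_contractions zero_DL continuous_on_subset continuous_on_eq_continuous_at
      unfolding DL_def by blast
    then obtain d1 where d1: "d1 > 0" "\<And>x. norm x < d1 \<Longrightarrow> norm (\<psi> x - y) < d"
      unfolding continuous_at_eps_delta dist_norm using d psi0 by (metis diff_zero)
    define d2 where "d2 = min d1 1 / (norm v + 1)"
    have n: "0 < norm v + 1" by (simp add: add_nonneg_pos)
    have d2: "d2 > 0" unfolding d2_def using d1(1) n by simp
    show ?thesis
    proof (rule has_hess_local_max[OF gR d2])
      fix t :: real assume t: "\<bar>t\<bar> < d2"
      have "norm (t *\<^sub>R v) \<le> \<bar>t\<bar> * (norm v + 1)" by (simp add: algebra_simps)
      also have "\<dots> < min d1 1" using t n unfolding d2_def by (simp add: pos_less_divide_eq)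
      finally have s: "norm (t *\<^sub>R v) < d1" "norm (t *\<^sub>R v) < 1" by auto
      have "t *\<^sub>R v \<in> DL" unfolding DL_def using ball_subset_domI[OF s(2)] v by (simp add: L_scaleR)
      then show "Re (F (\<psi> (0 + t *\<^sub>R v))) \<le> Re (F (\<psi> 0))"
        using mx[OF psiD d1(2)[OF s(1)]] psi0 by simp
    qed
  qed
  have "Re (mix H' (P x) (P x)) \<le> 0" for x
    unfolding Re_mix_self[OF g(1)] using neg[OF P_L[of x]] neg[OF L_cscale[OF P_L[of x], of \<i>]] by simp
  then have "Re (lap P H' 0) \<le> 0" unfolding lap_0 by (simp add: sum_nonpos)
  with g(2) show ?thesis by simp
qed

definition harmonic :: "(complex^'n^'m \<Rightarrow> complex) \<Rightarrow> bool" where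
  "harmonic f \<longleftrightarrow> (\<forall>p\<in>DL. twice_diff f p \<and> lap P (hessian f p) p = 0) \<and> continuous_on (closure DL) f"

lemma harmonicI:
  assumes "\<And>p. p \<in> DL \<Longrightarrow> \<exists>f1 H. has_hess f f1 H p \<and> lap P H p = 0" "continuous_on (closure DL) f"
  shows "harmonic f"
  unfolding harmonic_def using assms has_hess_hessian twice_diffI by metis

lemma harmonicD: "harmonic f \<Longrightarrow> p \<in> DL \<Longrightarrow> \<exists>f1 H. has_hess f f1 H p \<and> lap P H p = 0"
  unfolding harmonic_def using twice_diff_hessian by blast

lemma lap_normsq_hess_bounded: "\<exists>C. \<forall>z\<in>contractions. Re (lap P normsq_hess z) \<le> C"
proof -
  have V: "continuous_on contractions (\<lambda>z::complex^'n^'m. Vm z j k)" and W: "continuous_on contractions (\<lambda>z::complex^'n^'m. Wm z a b)" for j k a b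
    unfolding Vm_def Wm_def by (intro continuous_intros)+
  have "continuous_on contractions (\<lambda>z. lap P normsq_hess z)"
    unfolding lap_def hua_def by (intro continuous_on_sum continuous_on_mult V W continuous_on_const)
  then have "continuous_on contractions (\<lambda>z. Re (lap P normsq_hess z))" by (intro continuous_intros)
  then have "bounded ((\<lambda>z. Re (lap P normsq_hess z)) ` contractions)"
    using compact_continuous_image compact_eq_bounded_closed bounded_contractions closed_contractions compact_imp_bounded by blast
  then show ?thesis unfolding bounded_iff by (metis abs_le_D1 imageI real_norm_def)
qed

text \<open>The function \<open>w = Re g + \<epsilon> |z|\<^sup>2\<close> is strictly subharmonic away from the Shilov boundary, because the
  Laplacian of \<open>|z|\<^sup>2\<close> is at least \<open>c (tr Vmat z)\<^sup>2\<close>. If \<open>w\<close> came close to a too large supremum at \<open>z1\<close>, then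
  in the chart centred at \<open>z1\<close> the function \<open>w - \<kappa> |y|\<^sup>2\<close> would have an interior maximum on a ball of
  fixed radius; the Laplacian of \<open>|y|\<^sup>2\<close> is bounded there independently of \<open>z1\<close>.\<close>

lemma max_principle:
  assumes g: "harmonic g" and B: "\<And>\<xi>. \<xi> \<in> SL \<Longrightarrow> Re (g \<xi>) \<le> B" and zs: "zs \<in> DL"
  shows "Re (g zs) \<le> B"
proof (rule ccontr)
  assume "\<not> Re (g zs) \<le> B"
  define \<eta> where "\<eta> = (Re (g zs) - B) / 2"
  have eta: "\<eta> > 0" using \<open>\<not> Re (g zs) \<le> B\<close> by (simp add: \<eta>_def)
  define N where "N = real CARD('n)"
  have N: "N > 0" by (simp add: N_def)
  have nb: "(norm z)\<^sup>2 \<le> N" if "z \<in> contractions" for z :: "complex^'n^'m"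
    using contractions_column_bound[OF that] by (simp add: N_def)
  \<comment> \<open>This keeps the perturbation \<open>\<epsilon> * (norm z)\<^sup>2\<close> at most
    \<open>\<eta>\<close> on all contractions.\<close>
  define \<epsilon> where "\<epsilon> = \<eta> / N"
  have eps: "\<epsilon> > 0" "\<epsilon> * N = \<eta>" using eta N by (simp_all add: \<epsilon>_def)
  define w where "w z = Re (g z) + \<epsilon> * (norm z)\<^sup>2" for z
  have wc: "continuous_on (closure DL) w"
    unfolding w_def using g unfolding harmonic_def by (intro continuous_intros) auto
  have wS: "w \<xi> \<le> B + \<eta>" if "\<xi> \<in> SL" "\<xi> \<in> contractions" for \<xi>
  proof -
    have "\<epsilon> * (norm \<xi>)\<^sup>2 \<le> \<epsilon> * N" using nb[OF that(2)] eps(1) by (simp add: mult_left_mono)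
    then show ?thesis using B[OF that(1)] eps(2) unfolding w_def by linarith
  qed
  have wz: "w zs \<ge> B + 2 * \<eta>"
    unfolding w_def \<eta>_def using eps(1) by (simp add: field_simps)
  have zc: "zs \<in> closure DL" using zs closure_subset by blast
  have ne: "closure DL \<noteq> {}" using zc by (metis empty_iff)
  obtain m where m: "m \<in> closure DL" "\<And>z. z \<in> closure DL \<Longrightarrow> w z \<le> w m"
    by (rule bexE[OF continuous_attains_sup[OF compact_closure_DL ne wc]]) (rule that, assumption, erule bspec)
  have wm: "w m \<ge> B + 2 * \<eta>" using m(2)[OF zc] wz by linarith
  define tr where "tr z = Re (\<Sum>j\<in>UNIV. Vmat z $ j $ j)" for z :: "complex^'n^'m"
  \<comment> \<open>On the Shilov boundary \<open>w\<close> is at most \<open>B + \<eta>\<close>.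
    This compact superlevel set therefore avoids it, and the trace of \<open>Vmat\<close> has a
    positive minimum \<open>h0\<close> there.\<close>
  define T where "T = closure DL \<inter> w -` {B + 3/2 * \<eta>..}"
  have cT: "compact T" unfolding T_def
    by (metis wc closed_atLeast closed_closure compact_Int_closed compact_closure_DL continuous_closed_preimage inf.idem Int_assoc)
  have trc: "continuous_on T tr"
    unfolding tr_def Vmat_def by (intro continuous_intros)
  have "zs \<in> T" unfolding T_def using zc wz eta by simp
  then obtain t0 where t0: "t0 \<in> T" "\<And>z. z \<in> T \<Longrightarrow> tr t0 \<le> tr z"
    using continuous_attains_inf[OF cT _ trc] by blast
  define h0 where "h0 = tr t0"
  have h0: "h0 > 0"
  proof (rule ccontr)
    assume "\<not> h0 > 0"
    have c: "t0 \<in> contractions" "t0 \<in> L" using t0(1) closure_DL unfolding T_def by auto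
    have "Vmat t0 = 0" by (rule Vmat_zero_if_trace_zero[OF c(1)]) (use \<open>\<not> h0 > 0\<close> in \<open>simp add: h0_def tr_def\<close>)
    then have "w t0 \<le> B + \<eta>" using c by (intro wS) (auto simp: SL_def)
    then show False using t0(1) eta unfolding T_def by simp
  qed
  obtain c where c: "c > 0" "\<And>z. z \<in> DL \<Longrightarrow> c * (tr z)\<^sup>2 \<le> Re (lap P normsq_hess z)"
    using lap_low unfolding DL_def tr_def by blast
  obtain C0 where C0: "\<And>z. z \<in> contractions \<Longrightarrow> Re (lap P normsq_hess z) \<le> C0" using lap_normsq_hess_bounded by blast
  define C where "C = max C0 1"
  have C: "C > 0" "\<And>z. z \<in> contractions \<Longrightarrow> Re (lap P normsq_hess z) \<le> C" unfolding C_def using C0 by (auto simp: le_max_iff_disj)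
  \<comment> \<open>The first bound makes the Laplacian of the penalty, at most
    \<open>\<kappa> * C\<close>, smaller than \<open>\<epsilon> * c * h0\<^sup>2\<close>. The second
    gives \<open>\<kappa> / 8 \<le> \<eta> / 2\<close>, so that points where \<open>w\<close> is
    within \<open>\<kappa> / 8\<close> of its maximum lie in \<open>T\<close>.\<close>
  define \<kappa> where "\<kappa> = min (\<epsilon> * c * h0\<^sup>2 / (2 * C)) (4 * \<eta>)"
  have kap: "\<kappa> > 0" "\<kappa> / 8 \<le> \<eta> / 2" unfolding \<kappa>_def using eps c h0 C eta by auto
  have "\<kappa> * C \<le> \<epsilon> * c * h0\<^sup>2 / (2 * C) * C" unfolding \<kappa>_def using C by (intro mult_right_mono) auto
  also have "\<dots> = \<epsilon> * c * h0\<^sup>2 / 2" using C by simp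
  also have "\<dots> < \<epsilon> * c * h0\<^sup>2" using eps c h0 by simp
  finally have kC: "\<kappa> * C < \<epsilon> * c * h0\<^sup>2" .
  \<comment> \<open>The gap \<open>\<kappa> / 8\<close> is half of the penalty
    \<open>\<kappa> / 4\<close> on the sphere of radius 1/2 in the chart, so the maximum of
    \<open>G\<close> below cannot lie on that sphere.\<close>
  have "\<exists>z1\<in>DL. w z1 > w m - \<kappa> / 8"
  proof (rule ccontr)
    assume "\<not> (\<exists>z1\<in>DL. w z1 > w m - \<kappa> / 8)"
    then have "\<And>z. z \<in> DL \<Longrightarrow> w z \<le> w m - \<kappa> / 8" by force
    from continuous_le_on_closure[OF wc m(1) this] show False using kap by simp
  qed
  then obtain z1 where z1: "z1 \<in> DL" "w z1 > w m - \<kappa> / 8" by blast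
  obtain \<psi> Q where psi0: "\<psi> 0 = z1" and psiD: "\<And>z. z \<in> DL \<Longrightarrow> \<psi> z \<in> DL" and psic: "continuous_on contractions \<psi>"
    and tr': "\<And>p. p \<in> DL \<Longrightarrow> pulls_back \<psi> (Q p) p" and "invertible (Q 0)"
    using chart_exists[OF z1(1)] by blast
  define Y where "Y = L \<inter> cball 0 (1/2)"
  have YD: "y \<in> DL" if "y \<in> Y" for y
    using that ball_subset_domI[of y] unfolding Y_def DL_def by auto
  have cY: "compact Y" unfolding Y_def using closed_L by (simp add: closed_Int_compact)
  define G where "G y = w (\<psi> y) - \<kappa> * (norm y)\<^sup>2" for y
  have psY: "continuous_on Y \<psi>" "\<psi> ` Y \<subseteq> closure DL"
  proof -
    have "Y \<subseteq> contractions" using YD domI_subset_contractions unfolding DL_def by blast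
    then show "continuous_on Y \<psi>" by (rule continuous_on_subset[OF psic])
    show "\<psi> ` Y \<subseteq> closure DL"
      using psiD[OF YD] closure_subset[of DL] by (intro image_subsetI) (rule subsetD)
  qed
  have Gc: "continuous_on Y G"
    unfolding G_def using continuous_on_compose2[OF wc psY] by (intro continuous_intros) auto
  have Y0: "0 \<in> Y" unfolding Y_def using L_0 by simp
  obtain y1 where y1: "y1 \<in> Y" "\<And>y. y \<in> Y \<Longrightarrow> G y \<le> G y1"
    using continuous_attains_sup[OF cY _ Gc] Y0 by blast
  have G1: "G y1 > w m - \<kappa> / 8" using y1(2)[OF Y0] z1(2) psi0 unfolding G_def by simp
  have y1D: "y1 \<in> DL" by (rule YD[OF y1(1)])
  have pD: "\<psi> y1 \<in> DL" by (rule psiD[OF y1D])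
  then have pc: "\<psi> y1 \<in> closure DL" using closure_subset by blast
  have y1n: "norm y1 < 1/2"
  proof (rule ccontr)
    assume "\<not> norm y1 < 1/2"
    then have n: "norm y1 = 1/2" using y1(1) unfolding Y_def by auto
    have "G y1 \<le> w m - \<kappa> / 4" unfolding G_def n using m(2)[OF pc] by (simp add: power2_eq_square)
    then show False using G1 kap by simp
  qed
  have "w (\<psi> y1) > w m - \<kappa> / 8" using G1 kap unfolding G_def by (smt (verit) mult_nonneg_nonneg zero_le_power2)
  then have "\<psi> y1 \<in> T" unfolding T_def using pc wm kap by simp
  then have hp: "h0 \<le> tr (\<psi> y1)" using t0(2) unfolding h0_def by blast
  obtain g1 Hg where Hg: "has_hess g g1 Hg (\<psi> y1)" "lap P Hg (\<psi> y1) = 0" using harmonicD[OF g pD] by blast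
  have f: "has_hess (\<lambda>z. g z + of_real \<epsilon> * complex_of_real ((norm z)\<^sup>2)) (\<lambda>x w. g1 x w + of_real \<epsilon> * of_real (2 * (x \<bullet> w)))
      (\<lambda>v w. Hg v w + of_real \<epsilon> * normsq_hess v w) (\<psi> y1)"
    by (intro has_hess_add Hg has_hess_cmult has_hess_normsq)
  obtain f1 H' where H': "has_hess (\<lambda>x. g (\<psi> x) + of_real \<epsilon> * complex_of_real ((norm (\<psi> x))\<^sup>2)) f1 H' y1"
     "lap P H' y1 = lap P (\<lambda>v w. Hg v w + of_real \<epsilon> * normsq_hess v w) (\<psi> y1)"
    using pulls_backD[OF tr'[OF y1D] f] by blast
  have F: "has_hess (\<lambda>x. (g (\<psi> x) + of_real \<epsilon> * complex_of_real ((norm (\<psi> x))\<^sup>2)) + of_real (-\<kappa>) * complex_of_real ((norm x)\<^sup>2))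
      (\<lambda>x w. f1 x w + of_real (-\<kappa>) * of_real (2 * (x \<bullet> w))) (\<lambda>v w. H' v w + of_real (-\<kappa>) * normsq_hess v w) y1"
    by (intro has_hess_add H' has_hess_cmult has_hess_normsq)
  have "Re (lap P (\<lambda>v w. H' v w + of_real (-\<kappa>) * normsq_hess v w) y1) \<le> 0"
  proof (rule local_max_lap[OF y1D F])
    show "0 < 1/2 - norm y1" using y1n by simp
    fix x assume x: "x \<in> DL" "norm (x - y1) < 1/2 - norm y1"
    have "norm x \<le> norm (x - y1) + norm y1" using norm_triangle_ineq[of "x - y1" y1] by simp
    then have "x \<in> Y" using x unfolding Y_def DL_def by simp
    from y1(2)[OF this] show "Re (g (\<psi> x) + of_real \<epsilon> * complex_of_real ((norm (\<psi> x))\<^sup>2) + of_real (-\<kappa>) * complex_of_real ((norm x)\<^sup>2))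
       \<le> Re (g (\<psi> y1) + of_real \<epsilon> * complex_of_real ((norm (\<psi> y1))\<^sup>2) + of_real (-\<kappa>) * complex_of_real ((norm y1)\<^sup>2))"
      unfolding G_def w_def by (simp del: of_real_power)
  qed
  then have le: "\<epsilon> * Re (lap P normsq_hess (\<psi> y1)) - \<kappa> * Re (lap P normsq_hess y1) \<le> 0"
    by (simp add: lap_plus lap_times H'(2) Hg(2) del: of_real_minus)
  have "\<epsilon> * (c * h0\<^sup>2) \<le> \<epsilon> * (c * (tr (\<psi> y1))\<^sup>2)"
    using hp h0 eps c by (intro mult_left_mono power_mono) auto
  also have "\<dots> \<le> \<epsilon> * Re (lap P normsq_hess (\<psi> y1))" using c(2)[OF pD] eps by (intro mult_left_mono) auto
  also have "\<dots> \<le> \<kappa> * Re (lap P normsq_hess y1)" using le by simp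
  also have "\<dots> \<le> \<kappa> * C" using C(2)[of y1] kap y1D domI_subset_contractions unfolding DL_def by (intro mult_left_mono) auto
  finally show False using kC by simp
qed

lemma harmonic_cmult: assumes "harmonic f" shows "harmonic (\<lambda>x. c * f x)"
proof (rule harmonicI)
  show "continuous_on (closure DL) (\<lambda>x. c * f x)" using assms unfolding harmonic_def by (intro continuous_intros) auto
  fix p assume "p \<in> DL"
  then obtain f1 H where "has_hess f f1 H p" "lap P H p = 0" using harmonicD[OF assms] by blast
  then show "\<exists>f1 H. has_hess (\<lambda>x. c * f x) f1 H p \<and> lap P H p = 0"
    by (intro exI conjI) (rule has_hess_cmult, assumption, simp add: lap_times)
qed

lemma harmonic_add: assumes "harmonic f" "harmonic g" shows "harmonic (\<lambda>x. f x + g x)"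
proof (rule harmonicI)
  show "continuous_on (closure DL) (\<lambda>x. f x + g x)" using assms unfolding harmonic_def by (intro continuous_intros) auto
  fix p assume p: "p \<in> DL"
  obtain f1 H where f: "has_hess f f1 H p" "lap P H p = 0" using harmonicD[OF assms(1) p] by blast
  obtain g1 G where g: "has_hess g g1 G p" "lap P G p = 0" using harmonicD[OF assms(2) p] by blast
  show "\<exists>f1 H. has_hess (\<lambda>x. f x + g x) f1 H p \<and> lap P H p = 0"
    by (intro exI conjI) (rule has_hess_add[OF f(1) g(1)], simp add: lap_plus f g)
qed

lemma harmonic_const: "harmonic (\<lambda>x. c)"
proof (rule harmonicI)
  fix p
  have "lap P (\<lambda>v w. 0) p = 0" using lap_times[of P 0 "\<lambda>v w. 0" p] by simp
  then show "\<exists>f1 H. has_hess (\<lambda>x. c) f1 H p \<and> lap P H p = 0" using has_hess_const by blast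
qed (rule continuous_on_const)

lemma harmonic_sum: "(\<And>i. i \<in> I \<Longrightarrow> harmonic (f i)) \<Longrightarrow> harmonic (\<lambda>x. \<Sum>i\<in>I. f i x)"
  by (induction I rule: infinite_finite_induct) (auto intro: harmonic_add harmonic_const)

lemma max_modulus:
  assumes g: "harmonic g" and B: "\<And>\<xi>. \<xi> \<in> SL \<Longrightarrow> cmod (g \<xi>) \<le> B" and z: "z \<in> DL"
  shows "cmod (g z) \<le> B"
proof (cases "g z = 0")
  case True
  have "Re (g z) \<le> B"
    by (rule max_principle[OF g _ z]) (use B complex_Re_le_cmod order_trans in blast)
  then show ?thesis using True by simp
next
  case False
  define c where "c = cnj (g z) / cmod (g z)"
  have c: "cmod c = 1" using False by (simp add: c_def norm_divide)
  have "Re (c * g z) \<le> B"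
  proof (rule max_principle[OF harmonic_cmult[OF g] _ z])
    fix \<xi> assume "\<xi> \<in> SL"
    have "Re (c * g \<xi>) \<le> cmod (c * g \<xi>)" by (rule complex_Re_le_cmod)
    also have "\<dots> \<le> B" using B[OF \<open>\<xi> \<in> SL\<close>] by (simp add: norm_mult c)
    finally show "Re (c * g \<xi>) \<le> B" .
  qed
  moreover have "c * g z = of_real ((cmod (g z))\<^sup>2) / of_real (cmod (g z))"
    unfolding c_def complex_norm_square by simp
  ultimately show ?thesis using False by (simp add: power2_eq_square)
qed

end

section \<open>Norms under unitary factors and strict convexity\<close>

lemma norm_sq_trace: "complex_of_real ((norm Y)\<^sup>2) = (\<Sum>j\<in>UNIV. (adj Y ** Y) $ j $ j)" for Y :: "complex^'n^'m"
proof -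
  have "complex_of_real ((norm Y)\<^sup>2) = (\<Sum>i\<in>UNIV. \<Sum>j\<in>UNIV. cnj (Y $ i $ j) * Y $ i $ j)"
    unfolding norm_sq_matrix of_real_sum complex_norm_square by (simp add: mult.commute)
  also have "\<dots> = (\<Sum>j\<in>UNIV. \<Sum>i\<in>UNIV. cnj (Y $ i $ j) * Y $ i $ j)" by (rule sum.swap)
  finally show ?thesis by (simp add: matrix_mul_nth)
qed

lemma norm_eqI_trace: "adj Y ** Y = adj Z ** Z \<Longrightarrow> norm Y = norm Z" for Y :: "complex^'n^'m" and Z :: "complex^'n^'k"
proof -
  assume "adj Y ** Y = adj Z ** Z"
  then have "complex_of_real ((norm Y)\<^sup>2) = complex_of_real ((norm Z)\<^sup>2)" by (simp only: norm_sq_trace)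
  then have "(norm Y)\<^sup>2 = (norm Z)\<^sup>2" by (simp only: of_real_eq_iff)
  then show "norm Y = norm Z" by simp
qed

lemma norm_adj: "norm (adj Y) = norm Y" for Y :: "complex^'n^'m"
proof -
  have "(norm (adj Y))\<^sup>2 = (norm Y)\<^sup>2"
    unfolding norm_sq_matrix by (simp add: sum.swap[of "\<lambda>i j. (cmod (Y $ i $ j))\<^sup>2" UNIV UNIV])
  then show ?thesis by simp
qed

lemma unitary_comm: "adj k ** k = mat 1 \<Longrightarrow> k ** adj k = mat 1" for k :: "complex^'m^'m"
  by (simp add: matrix_left_right_inverse[of "adj k" k])

lemma norm_unitary_l: "adj k ** k = mat 1 \<Longrightarrow> norm (k ** Y) = norm Y" for Y :: "complex^'n^'m" and k :: "complex^'m^'m"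
proof (rule norm_eqI_trace)
  assume k: "adj k ** k = mat 1"
  have "adj (k ** Y) ** (k ** Y) = adj Y ** (adj k ** k) ** Y" by (simp only: adj_mult matrix_mul_assoc)
  then show "adj (k ** Y) ** (k ** Y) = adj Y ** Y" by (simp add: k)
qed

lemma norm_unitary_r: "adj k ** k = mat 1 \<Longrightarrow> norm (Y ** k) = norm Y" for Y :: "complex^'n^'m" and k :: "complex^'n^'n"
  using norm_unitary_l[of "adj k" "adj Y"] unitary_comm[of k] norm_adj[of "Y ** k"] norm_adj[of Y]
  by (simp add: adj_mult)

lemma norm_vec_unitary: "adj k ** k = mat 1 \<Longrightarrow> norm (k *v v) = norm v"
proof -
  assume k: "adj k ** k = mat 1"
  have "complex_of_real ((norm (k *v v))\<^sup>2) = cin v ((adj k ** k) *v v)"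
    using cin_adj[of v "adj k" "k *v v"] by (simp add: cin_self matrix_vector_mul_assoc del: of_real_power)
  then have "complex_of_real ((norm (k *v v))\<^sup>2) = complex_of_real ((norm v)\<^sup>2)" by (simp add: k cin_self)
  then have "(norm (k *v v))\<^sup>2 = (norm v)\<^sup>2" by (simp only: of_real_eq_iff)
  then show ?thesis by simp
qed

lemma entry_norm_le: "cmod (Y $ a $ b) \<le> norm Y"
  by (meson Finite_Cartesian_Product.norm_nth_le order_trans)

lemma norm_le_entries:
  assumes "\<And>a b. cmod (Y $ a $ b) \<le> B" shows "norm (Y :: complex^'n^'m) \<le> real CARD('m) * real CARD('n) * B"
proof -
  have "norm Y \<le> (\<Sum>a\<in>UNIV. norm (Y $ a))" unfolding norm_vec_def by (rule L2_set_le_sum) simp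
  also have "\<dots> \<le> (\<Sum>a\<in>(UNIV::'m set). \<Sum>b\<in>(UNIV::'n set). B)"
  proof (rule sum_mono)
    fix a
    have "norm (Y $ a) \<le> (\<Sum>b\<in>UNIV. cmod (Y $ a $ b))" unfolding norm_vec_def[of "Y $ a"] by (rule L2_set_le_sum) simp
    also have "\<dots> \<le> (\<Sum>b\<in>(UNIV::'n set). B)" by (intro sum_mono assms)
    finally show "norm (Y $ a) \<le> (\<Sum>b\<in>(UNIV::'n set). B)" .
  qed
  finally show ?thesis by (simp add: mult.assoc)
qed

text \<open>By the parallelogram law the midpoint of two different points of a ball is
  interior.\<close>

lemma strict_convex_sum:
  fixes a b :: "'a::real_inner"
  assumes "norm a \<le> N" "norm b \<le> N" "a \<noteq> b"
  shows "norm (a + b) < 2 * N"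
proof -
  have "(norm (a + b))\<^sup>2 + (norm (a - b))\<^sup>2 = 2 * (norm a)\<^sup>2 + 2 * (norm b)\<^sup>2"
    by (simp add: power2_norm_eq_inner inner_add inner_diff inner_commute)
  moreover have "(norm a)\<^sup>2 \<le> N\<^sup>2" "(norm b)\<^sup>2 \<le> N\<^sup>2" using assms by (auto intro: power_mono)
  moreover have "0 < (norm (a - b))\<^sup>2" using assms by simp
  ultimately have "(norm (a + b))\<^sup>2 < 4 * N\<^sup>2" by linarith
  also have "\<dots> = (2 * N)\<^sup>2" by (simp add: power_mult_distrib)
  finally have "(norm (a + b))\<^sup>2 < (2 * N)\<^sup>2" .
  moreover have "0 \<le> 2 * N" using assms(1) norm_ge_zero[of a] by linarith
  ultimately show ?thesis by (rule power2_less_imp_less)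
qed

section \<open>Averages over the isotropy group\<close>

text \<open>The values are conjugated by the left factor in order to cancel the congruence that
  \<open>hua\<close> undergoes under \<open>z \<mapsto> k ** z ** h\<close>.\<close>

definition act :: "(complex^'m^'m) \<times> (complex^'n^'n) \<Rightarrow> (complex^'n^'m \<Rightarrow> complex^'m^'m) \<Rightarrow> complex^'n^'m \<Rightarrow> complex^'m^'m" where
  "act g F z = adj (fst g) ** F (fst g ** z ** snd g) ** fst g"

lemma act_one [simp]: "act (mat 1, mat 1) F z = F z" by (simp add: act_def)

lemma linear_two_sided: "linear (\<lambda>Y. k ** Y ** h)" for k :: "complex^'m^'a" and h :: "complex^'b^'n"
  by (rule linearI) (simp_all add: matrix_add_ldistrib matrix_mul_add_rdistrib scaleR_cscale cscale_mult_l cscale_mult_r)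

lemma bounded_linear_two_sided: "bounded_linear (\<lambda>Y. k ** Y ** h)" for k :: "complex^'m^'a" and h :: "complex^'b^'n"
  using linear_two_sided linear_conv_bounded_linear by blast

context hua_domain
begin

lemma T_norm: "(k, h) \<in> K \<Longrightarrow> norm (k ** z ** h) = norm z"
  using K_unitary[of k h] by (simp add: norm_unitary_l norm_unitary_r)

lemma T_domI: assumes "(k, h) \<in> K" "z \<in> domI" shows "k ** z ** h \<in> domI"
  unfolding domI_iff
proof (intro allI impI)
  fix v :: "complex^'n" assume v: "v \<noteq> 0"
  note u = K_unitary[OF assms(1)]
  have "h *v v \<noteq> 0" using norm_vec_unitary[of h v] u v by (metis norm_eq_zero)
  then have "norm (z *v (h *v v)) < norm (h *v v)" using assms(2) unfolding domI_iff by blast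
  then show "norm ((k ** z ** h) *v v) < norm v"
    using u by (simp add: matrix_vector_mul_assoc[symmetric] norm_vec_unitary)
qed

lemma T_DL: "(k, h) \<in> K \<Longrightarrow> z \<in> DL \<Longrightarrow> k ** z ** h \<in> DL"
  unfolding DL_def using T_domI K_L by blast

lemma T_cont: "continuous_on S (\<lambda>z. k ** z ** h)" for k :: "complex^'m^'m" and h :: "complex^'n^'n"
  by (rule linear_continuous_on[OF bounded_linear_two_sided])

lemma T_closure: assumes "(k, h) \<in> K" "z \<in> closure DL" shows "k ** z ** h \<in> closure DL"
proof -
  have "(\<lambda>z. k ** z ** h) ` closure DL \<subseteq> closure DL"
    by (rule image_closure_subset[OF T_cont closed_closure]) (use T_DL[OF assms(1)] closure_subset in blast)
  then show ?thesis using assms(2) by blast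
qed

lemma T_Vmat: assumes "(k, h) \<in> K" shows "Vmat (k ** z ** h) = k ** Vmat z ** adj k"
proof -
  have "Vmat (k ** z ** h) = mat 1 - k ** z ** (h ** adj h) ** adj z ** adj k"
    by (simp add: Vmat_def adj_mult matrix_mul_assoc)
  also have "\<dots> = k ** adj k - k ** z ** adj z ** adj k"
    using K_unitary[OF assms] by (simp add: unitary_comm)
  also have "\<dots> = k ** Vmat z ** adj k" by (simp add: Vmat_def matrix_ring_simps matrix_mul_assoc)
  finally show ?thesis .
qed

lemma T_Wmat: assumes "(k, h) \<in> K" shows "Wmat (k ** z ** h) = adj h ** Wmat z ** h"
proof -
  have "Wmat (k ** z ** h) = mat 1 - adj h ** adj z ** (adj k ** k) ** z ** h"
    by (simp add: Wmat_def adj_mult matrix_mul_assoc)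
  also have "\<dots> = adj h ** h - adj h ** adj z ** z ** h"
    using K_unitary[OF assms] by simp
  also have "\<dots> = adj h ** Wmat z ** h" by (simp add: Wmat_def matrix_ring_simps matrix_mul_assoc)
  finally show ?thesis .
qed

lemma T_SL: "(k, h) \<in> K \<Longrightarrow> \<xi> \<in> SL \<Longrightarrow> k ** \<xi> ** h \<in> SL"
  unfolding SL_def by (simp add: K_L T_Vmat)

lemma mix_linear: "mix (\<lambda>v w. H (k ** v ** h) (k ** w ** h)) v w = mix H (k ** v ** h) (k ** w ** h)"
  by (simp add: mix_def cscale_mult_l cscale_mult_r)

lemma T_hua:
  assumes "(k, h) \<in> K" "bilinear H"
  shows "hua P (\<lambda>v w. H (k ** v ** h) (k ** w ** h)) p i j = (\<Sum>q\<in>UNIV. \<Sum>r\<in>UNIV. k $ q $ i * cnj (k $ r $ j) * hua P H (k ** p ** h) q r)"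
  by (rule hua_transform[OF assms(2) P_add P_cscale K_P[OF assms(1)] T_Wmat[OF assms(1)] mix_linear])

lemma T_lap:
  assumes "(k, h) \<in> K" "bilinear H"
  shows "lap P (\<lambda>v w. H (k ** v ** h) (k ** w ** h)) p = lap P H (k ** p ** h)"
  by (rule lap_transform[OF T_Vmat[OF assms(1)] T_hua[OF assms]])

lemma harmonic_T: assumes "harmonic f" "(k, h) \<in> K" shows "harmonic (\<lambda>z. f (k ** z ** h))"
proof (rule harmonicI)
  show "continuous_on (closure DL) (\<lambda>z. f (k ** z ** h))"
    by (rule continuous_on_compose2[OF _ T_cont]) (use assms T_closure in \<open>auto simp: harmonic_def\<close>)
  fix p assume "p \<in> DL"
  then have "k ** p ** h \<in> DL" by (rule T_DL[OF assms(2)])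
  then obtain f1 H where H: "has_hess f f1 H (k ** p ** h)" "lap P H (k ** p ** h) = 0" using harmonicD[OF assms(1)] by blast
  show "\<exists>f1 H. has_hess (\<lambda>z. f (k ** z ** h)) f1 H p \<and> lap P H p = 0"
    using has_hess_compose_linear[OF H(1) linear_two_sided] T_lap[OF assms(2) has_hess_bilinear[OF H(1)], of p] H(2) by metis
qed

text \<open>Radial approximation: \<open>r *\<^sub>R \<xi>\<close> with \<open>r < 1\<close> lies in
  the domain. That \<open>\<xi>\<close> is a contraction holds because its adjoint is an
  isometry.\<close>

lemma SL_unit_ball: assumes "\<xi> \<in> SL" shows "\<xi> \<in> closure DL"
proof -
  have c: "\<xi> \<in> contractions"
  proof -
    have "norm (adj \<xi> *v v) = norm v" for v
    proof -
      have "complex_of_real ((norm v)\<^sup>2 - (norm (adj \<xi> *v v))\<^sup>2) = 0"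
        using cin_Vmat[of v \<xi>] assms by (simp add: SL_def cin_right)
      then have "(norm v)\<^sup>2 - (norm (adj \<xi> *v v))\<^sup>2 = 0" by (simp only: of_real_eq_0_iff)
      then show ?thesis by simp
    qed
    then show ?thesis using norm_adj_le[of "adj \<xi>"] unfolding contractions_def by simp
  qed
  define x where "x n = (1 - 1 / real (Suc (Suc n))) *\<^sub>R \<xi>" for n
  have "x n \<in> DL" for n
  proof -
    let ?r = "1 - 1 / real (Suc (Suc n))"
    have r: "0 \<le> ?r" "?r < 1" by auto
    have "norm (x n *v v) < norm v" if "v \<noteq> 0" for v
    proof -
      have "norm (x n *v v) = ?r * norm (\<xi> *v v)" unfolding x_def matrix_vector_mult_scaleR_left using r by simp
      also have "\<dots> \<le> ?r * norm v" using c r unfolding contractions_def by (intro mult_left_mono) auto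
      also have "\<dots> < 1 * norm v" using that r by (intro mult_strict_right_mono) auto
      finally show ?thesis by simp
    qed
    then show ?thesis using assms L_scaleR unfolding DL_def SL_def by (simp add: domI_iff x_def)
  qed
  moreover have "x \<longlonglongrightarrow> (1 - 0) *\<^sub>R \<xi>"
    unfolding x_def by (intro tendsto_intros) (use LIMSEQ_ignore_initial_segment[OF lim_1_over_n, of 2] in \<open>simp only: add_2_eq_Suc' \<close>)
  ultimately show ?thesis unfolding closure_sequential by (intro exI[of _ x]) simp
qed

lemma compact_SL: "compact SL"
proof -
  have "SL = closure DL \<inter> Vmat -` {0}" using SL_unit_ball closure_DL by (auto simp: SL_def)
  moreover have "closed (closure DL \<inter> Vmat -` {0})"
    by (rule continuous_closed_preimage) (intro continuous_intros, auto)
  moreover have "closure DL \<inter> (closure DL \<inter> Vmat -` {0}) = closure DL \<inter> Vmat -` {0}" by blast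
  ultimately show ?thesis using compact_Int_closed[OF compact_closure_DL] by metis
qed

text \<open>Iterated averages are generated inductively, so each of their properties follows from
  its stability under one averaging step, and products of group elements never have to be
  formed.\<close>

inductive_set orbit_averages for u :: "complex^'n^'m \<Rightarrow> complex" and X :: "complex^'m^'m" where
  base: "(\<lambda>z. cscale (u z) X) \<in> orbit_averages u X"
| avg: "F \<in> orbit_averages u X \<Longrightarrow> (\<And>i. i < p \<Longrightarrow> g i \<in> K) \<Longrightarrow> 0 < (p::nat) \<Longrightarrow>
     (\<lambda>z. (1 / real p) *\<^sub>R (\<Sum>i<p. act (g i) F z)) \<in> orbit_averages u X"

lemma norm_act: "g \<in> K \<Longrightarrow> norm (act g F z) = norm (F (fst g ** z ** snd g))"
  using K_unitary[of "fst g" "snd g"] unfolding act_def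
  by (simp add: norm_unitary_l norm_unitary_r unitary_comm)

lemma norm_act_diff: assumes "g \<in> K"
  shows "norm (act g F z - act g G z') = norm (F (fst g ** z ** snd g) - G (fst g ** z' ** snd g))"
proof -
  have "act g F z - act g G z' = adj (fst g) ** (F (fst g ** z ** snd g) - G (fst g ** z' ** snd g)) ** fst g"
    by (simp add: act_def matrix_ring_simps)
  then show ?thesis using K_unitary[of "fst g" "snd g"] assms
    by (simp add: norm_unitary_l norm_unitary_r unitary_comm)
qed

lemma norm_avg_le:
  assumes "\<And>i. i < p \<Longrightarrow> norm (f i) \<le> M" "0 < p"
  shows "norm ((1 / real p) *\<^sub>R (\<Sum>i<p. f i)) \<le> M"
proof -
  have "norm (\<Sum>i<p. f i) \<le> real (card {..<p}) * M" by (rule order_trans[OF norm_sum sum_bounded_above]) (use assms in auto)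
  then show ?thesis using assms(2) by (simp add: field_simps)
qed

lemma norm_cscale: "norm (cscale c X) = cmod c * norm X" for X :: "complex^'k^'l"
proof -
  have "(norm (cscale c X))\<^sup>2 = (cmod c * norm X)\<^sup>2"
    unfolding norm_sq_matrix power_mult_distrib by (simp add: norm_mult power_mult_distrib sum_distrib_left)
  then show ?thesis by (simp add: power2_eq_iff_nonneg)
qed

lemma orbit_average_bound:
  assumes "F \<in> orbit_averages u X" and u: "\<And>z. z \<in> closure DL \<Longrightarrow> cmod (u z) \<le> M" and "z \<in> closure DL"
  shows "norm (F z) \<le> M * norm X"
  using assms(1) assms(3)
proof (induction arbitrary: z)
  case base
  then show ?case by (simp add: norm_cscale u mult_right_mono)
next
  case (avg F p g)
  show ?case
    by (rule norm_avg_le) (use avg T_closure in \<open>auto simp: norm_act\<close>)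
qed

text \<open>The group acts isometrically on points and on values, so all averages share the modulus
  of continuity of \<open>u\<close>. This equicontinuity is the input for Arzela-Ascoli.\<close>

lemma orbit_average_equicont:
  assumes "F \<in> orbit_averages u X"
    and u: "\<And>z z'. z \<in> closure DL \<Longrightarrow> z' \<in> closure DL \<Longrightarrow> norm (z - z') < d \<Longrightarrow> cmod (u z - u z') \<le> e"
    and "z \<in> closure DL" "z' \<in> closure DL" "norm (z - z') < d"
  shows "norm (F z - F z') \<le> e * norm X"
  using assms(1) assms(3-)
proof (induction arbitrary: z z')
  case base
  have "cscale (u z) X - cscale (u z') X = cscale (u z - u z') X" by (simp add: vec_eq_iff left_diff_distrib)
  then show ?case using base by (simp add: norm_cscale u mult_right_mono)
next
  case (avg F p g)
  have eq: "(1 / real p) *\<^sub>R (\<Sum>i<p. act (g i) F z) - (1 / real p) *\<^sub>R (\<Sum>i<p. act (g i) F z')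
     = (1 / real p) *\<^sub>R (\<Sum>i<p. (act (g i) F z - act (g i) F z'))"
    by (simp add: sum_subtractf scaleR_diff_right)
  show ?case unfolding eq
  proof (rule norm_avg_le[OF _ \<open>0 < p\<close>])
    fix i assume i: "i < p"
    have gK: "(fst (g i), snd (g i)) \<in> K" using avg.hyps(2)[OF i] by simp
    have "fst (g i) ** z ** snd (g i) - fst (g i) ** z' ** snd (g i) = fst (g i) ** (z - z') ** snd (g i)"
      by (simp add: matrix_ring_simps)
    then have "norm (fst (g i) ** z ** snd (g i) - fst (g i) ** z' ** snd (g i)) < d"
      using T_norm[OF gK] avg.prems(3) by simp
    then have "norm (F (fst (g i) ** z ** snd (g i)) - F (fst (g i) ** z' ** snd (g i))) \<le> e * norm X"
      by (intro avg.IH T_closure[OF gK] avg.prems)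
    then show "norm (act (g i) F z - act (g i) F z') \<le> e * norm X"
      using norm_act_diff[of "g i" F z F z'] gK by simp
  qed
qed

lemma trace_act: assumes "g \<in> K" shows "(\<Sum>i\<in>UNIV. act g F z $ i $ i) = (\<Sum>i\<in>UNIV. F (fst g ** z ** snd g) $ i $ i)"
proof -
  let ?k = "fst g" and ?Y = "F (fst g ** z ** snd g)"
  have k: "?k ** adj ?k = mat 1" using K_unitary[of "fst g" "snd g"] assms unitary_comm[of "fst g"] by simp
  have tc: "(\<Sum>i\<in>UNIV. (A ** B) $ i $ i) = (\<Sum>i\<in>UNIV. (B ** A) $ i $ i)" for A B :: "complex^'m^'m"
  proof -
    have "(\<Sum>i\<in>UNIV. \<Sum>j\<in>UNIV. A $ i $ j * B $ j $ i) = (\<Sum>j\<in>UNIV. \<Sum>i\<in>UNIV. A $ i $ j * B $ j $ i)" by (rule sum.swap)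
    then show ?thesis by (simp add: matrix_mul_nth mult.commute)
  qed
  have "(\<Sum>i\<in>UNIV. act g F z $ i $ i) = (\<Sum>i\<in>UNIV. (?k ** (adj ?k ** ?Y)) $ i $ i)"
    unfolding act_def by (rule tc)
  then show ?thesis by (simp add: matrix_mul_assoc k)
qed

lemma orbit_average_trace:
  assumes "F \<in> orbit_averages u X" "(\<Sum>i\<in>UNIV. X $ i $ i) = 0"
  shows "(\<Sum>i\<in>UNIV. F z $ i $ i) = 0"
  using assms(1)
proof (induction arbitrary: z)
  case base
  then show ?case using assms(2) by (simp add: sum_distrib_left[symmetric])
next
  case (avg F p g)
  have "(\<Sum>i\<in>UNIV. \<Sum>n<p. act (g n) F z $ i $ i) = (\<Sum>n<p. \<Sum>i\<in>UNIV. act (g n) F z $ i $ i)" by (rule sum.swap)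
  also have "\<dots> = 0" using avg by (simp add: trace_act)
  finally show ?case by (simp add: scaleR_sum_right[symmetric] sum_component)
qed

lemma orbit_average_harmonic:
  assumes "F \<in> orbit_averages u X" "harmonic u"
  shows "harmonic (\<lambda>z. F z $ a $ b)"
  using assms(1)
proof (induction arbitrary: a b)
  case base
  show ?case using harmonic_cmult[OF assms(2), of "X $ a $ b"] by (simp add: mult.commute)
next
  case (avg F p g)
  have e: "act (g i) F z $ a $ b = (\<Sum>d\<in>UNIV. \<Sum>c\<in>UNIV. (cnj (fst (g i) $ c $ a) * fst (g i) $ d $ b) * F (fst (g i) ** z ** snd (g i)) $ c $ d)" for i z
    by (simp add: act_def matrix_mul_nth sum_distrib_left sum_distrib_right algebra_simps)
  have "harmonic (\<lambda>z. \<Sum>i<p. complex_of_real (1 / real p) * (\<Sum>d\<in>UNIV. \<Sum>c\<in>UNIV. (cnj (fst (g i) $ c $ a) * fst (g i) $ d $ b) * F (fst (g i) ** z ** snd (g i)) $ c $ d))"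
  proof (intro harmonic_sum harmonic_cmult)
    fix i c d assume "i \<in> {..<p}"
    then have "(fst (g i), snd (g i)) \<in> K" using avg.hyps by simp
    then show "harmonic (\<lambda>z. F (fst (g i) ** z ** snd (g i)) $ c $ d)" by (rule harmonic_T[OF avg.IH])
  qed
  then show ?case by (simp add: sum_component e scaleR_conv_of_real[where 'a = complex] sum_distrib_left)
qed

text \<open>The entry indices of a matrix-valued Hessian are contracted with the indices of the Hua
  operators. On the Hessian of \<open>u(z) X\<close> this is the pairing of \<open>X\<close> with
  the Hua matrix of \<open>u\<close>.\<close>

definition "hua_pairing HF = (\<Sum>a\<in>UNIV. \<Sum>b\<in>UNIV. hua P (\<lambda>v w. HF v w $ a $ b) 0 a b)" for HF :: "complex^'n^'m \<Rightarrow> complex^'n^'m \<Rightarrow> complex^'m^'m"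

text \<open>By \<open>T_hua\<close> the operator indices pick up entries of \<open>k\<close> and of
  its conjugate, and conjugating the values contributes the opposite factors to the same indices.
  Orthonormality of the rows of \<open>k\<close> contracts each pair to a Kronecker delta.\<close>

lemma hua_pairing_act:
  fixes HF :: "complex^'n^'m \<Rightarrow> complex^'n^'m \<Rightarrow> complex^'m^'m"
  assumes g: "(k, h) \<in> K" and HF: "\<And>a b. bilinear (\<lambda>v w. HF v w $ a $ b)"
  shows "hua_pairing (\<lambda>v w. adj k ** HF (k ** v ** h) (k ** w ** h) ** k) = hua_pairing HF"
proof -
  have k: "k ** adj k = mat 1" using K_unitary[OF g] unitary_comm by blast
  have ks: "(\<Sum>a\<in>UNIV. k $ q $ a * cnj (k $ c $ a)) = (if q = c then 1 else 0)" for q c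
    using arg_cong[OF k, of "\<lambda>M. M $ q $ c"] by (simp add: matrix_mul_nth mat_def)
  define G where "G c d q r = hua P (\<lambda>v w. HF v w $ c $ d) 0 q r" for c d q r
  have hua_sum: "hua P (\<lambda>v w. \<Sum>i\<in>I. f i * HH i v w) p a b = (\<Sum>i\<in>I. f i * hua P (HH i) p a b)" for I :: "('m \<times> 'm) set" and f HH p a b
  proof (induction I rule: infinite_finite_induct)
    case (insert x F)
    then show ?case by (simp add: hua_plus hua_times)
  qed (simp_all add: hua_def mix_def)
  have e: "hua P (\<lambda>v w. (adj k ** HF (k ** v ** h) (k ** w ** h) ** k) $ a $ b) 0 a b
     = (\<Sum>(c, d)\<in>UNIV. \<Sum>(q, r)\<in>UNIV. (k $ q $ a * cnj (k $ c $ a)) * (k $ d $ b * cnj (k $ r $ b)) * G c d q r)" for a b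
  proof -
    have "(\<lambda>v w. (adj k ** HF (k ** v ** h) (k ** w ** h) ** k) $ a $ b)
       = (\<lambda>v w. \<Sum>x\<in>UNIV. (cnj (k $ fst x $ a) * k $ snd x $ b) * HF (k ** v ** h) (k ** w ** h) $ fst x $ snd x)"
    proof (intro ext)
      fix v w
      have "(adj k ** HF (k ** v ** h) (k ** w ** h) ** k) $ a $ b
         = (\<Sum>d\<in>UNIV. \<Sum>c\<in>UNIV. (cnj (k $ c $ a) * k $ d $ b) * HF (k ** v ** h) (k ** w ** h) $ c $ d)"
        by (simp add: matrix_mul_nth sum_distrib_left sum_distrib_right algebra_simps)
      also have "\<dots> = (\<Sum>c\<in>UNIV. \<Sum>d\<in>UNIV. (cnj (k $ c $ a) * k $ d $ b) * HF (k ** v ** h) (k ** w ** h) $ c $ d)" by (rule sum.swap)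
      also have "\<dots> = (\<Sum>x\<in>UNIV. (cnj (k $ fst x $ a) * k $ snd x $ b) * HF (k ** v ** h) (k ** w ** h) $ fst x $ snd x)"
        unfolding UNIV_Times_UNIV[symmetric] sum.cartesian_product case_prod_beta ..
      finally show "(adj k ** HF (k ** v ** h) (k ** w ** h) ** k) $ a $ b
         = (\<Sum>x\<in>UNIV. (cnj (k $ fst x $ a) * k $ snd x $ b) * HF (k ** v ** h) (k ** w ** h) $ fst x $ snd x)" .
    qed
    then have "hua P (\<lambda>v w. (adj k ** HF (k ** v ** h) (k ** w ** h) ** k) $ a $ b) 0 a b
       = (\<Sum>x\<in>UNIV. (cnj (k $ fst x $ a) * k $ snd x $ b) * hua P (\<lambda>v w. HF (k ** v ** h) (k ** w ** h) $ fst x $ snd x) 0 a b)"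
      by (simp only: hua_sum)
    also have "\<dots> = (\<Sum>x\<in>UNIV. (cnj (k $ fst x $ a) * k $ snd x $ b) *
         (\<Sum>q\<in>UNIV. \<Sum>r\<in>UNIV. k $ q $ a * cnj (k $ r $ b) * G (fst x) (snd x) q r))"
      unfolding G_def using T_hua[OF g HF, of _ _ 0] by simp
    also have "\<dots> = (\<Sum>x\<in>UNIV. \<Sum>(q, r)\<in>UNIV. (k $ q $ a * cnj (k $ fst x $ a)) * (k $ snd x $ b * cnj (k $ r $ b)) * G (fst x) (snd x) q r)"
    proof (rule sum.cong[OF refl])
      fix x :: "'m \<times> 'm"
      have "(\<Sum>q\<in>UNIV. \<Sum>r\<in>UNIV. k $ q $ a * cnj (k $ r $ b) * G (fst x) (snd x) q r)
         = (\<Sum>(q, r)\<in>UNIV. k $ q $ a * cnj (k $ r $ b) * G (fst x) (snd x) q r)"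
        unfolding UNIV_Times_UNIV[symmetric] sum.cartesian_product ..
      then show "(cnj (k $ fst x $ a) * k $ snd x $ b) * (\<Sum>q\<in>UNIV. \<Sum>r\<in>UNIV. k $ q $ a * cnj (k $ r $ b) * G (fst x) (snd x) q r)
         = (\<Sum>(q, r)\<in>UNIV. (k $ q $ a * cnj (k $ fst x $ a)) * (k $ snd x $ b * cnj (k $ r $ b)) * G (fst x) (snd x) q r)"
        by (simp only:) (simp add: sum_distrib_left case_prod_beta algebra_simps)
    qed
    finally show ?thesis by (simp add: case_prod_beta)
  qed
  have "hua_pairing (\<lambda>v w. adj k ** HF (k ** v ** h) (k ** w ** h) ** k)
     = (\<Sum>(a, b)\<in>UNIV. \<Sum>(c, d)\<in>UNIV. \<Sum>(q, r)\<in>UNIV. (k $ q $ a * cnj (k $ c $ a)) * (k $ d $ b * cnj (k $ r $ b)) * G c d q r)"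
    unfolding hua_pairing_def e UNIV_Times_UNIV[symmetric] sum.cartesian_product[symmetric] ..
  also have "\<dots> = (\<Sum>(c, d)\<in>UNIV. \<Sum>(q, r)\<in>UNIV. \<Sum>(a, b)\<in>UNIV. (k $ q $ a * cnj (k $ c $ a)) * (k $ d $ b * cnj (k $ r $ b)) * G c d q r)"
    unfolding case_prod_beta by (subst sum.swap, rule sum.cong[OF refl], rule sum.swap)
  also have "\<dots> = (\<Sum>(c, d)\<in>UNIV. \<Sum>(q, r)\<in>UNIV. (if q = c then 1 else 0) * (if d = r then 1 else 0) * G c d q r)"
  proof -
    have "(\<Sum>(a, b)\<in>UNIV. (k $ q $ a * cnj (k $ c $ a)) * (k $ d $ b * cnj (k $ r $ b)) * G c d q r)
       = (\<Sum>a\<in>UNIV. k $ q $ a * cnj (k $ c $ a)) * (\<Sum>b\<in>UNIV. k $ d $ b * cnj (k $ r $ b)) * G c d q r" for c d q r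
      unfolding UNIV_Times_UNIV[symmetric] sum.cartesian_product[symmetric]
      unfolding sum_product unfolding sum_distrib_right ..
    then show ?thesis by (simp only: ks)
  qed
  also have "\<dots> = (\<Sum>c\<in>UNIV. \<Sum>d\<in>UNIV. \<Sum>q\<in>UNIV. \<Sum>r\<in>UNIV. if q = c then if d = r then G c d q r else 0 else 0)"
    unfolding UNIV_Times_UNIV[symmetric] sum.cartesian_product[symmetric] by (intro sum.cong refl) auto
  also have "\<dots> = (\<Sum>c\<in>UNIV. \<Sum>d\<in>UNIV. G c d c d)"
  proof (intro sum.cong refl)
    fix c d
    have "(\<Sum>q\<in>UNIV. \<Sum>r\<in>UNIV. if q = c then if d = r then G c d q r else 0 else 0)
        = (\<Sum>q\<in>UNIV. if q = c then (\<Sum>r\<in>UNIV. if d = r then G c d q r else 0) else 0)"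
      by (intro sum.cong refl) auto
    then show "(\<Sum>q\<in>UNIV. \<Sum>r\<in>UNIV. if q = c then if d = r then G c d q r else 0 else 0) = G c d c d" by simp
  qed
  finally show ?thesis unfolding hua_pairing_def G_def .
qed

lemma hua_pairing_avg: "hua_pairing (\<lambda>v w. c *\<^sub>R (\<Sum>i<p. HH i v w)) = of_real c * (\<Sum>i<(p::nat). hua_pairing (HH i))"
proof -
  have hua_sum: "hua P (\<lambda>v w. \<Sum>i<p. HH i v w) 0 a b = (\<Sum>i<p. hua P (HH i) 0 a b)" for HH :: "nat \<Rightarrow> _" and a b
  proof (induction p)
    case (Suc p)
    then show ?case by (simp add: hua_plus)
  qed (simp add: hua_def mix_def)
  have "hua_pairing (\<lambda>v w. c *\<^sub>R (\<Sum>i<p. HH i v w)) = of_real c * (\<Sum>a\<in>UNIV. \<Sum>b\<in>UNIV. \<Sum>i<p. hua P (\<lambda>v w. HH i v w $ a $ b) 0 a b)"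
    unfolding hua_pairing_def by (simp add: sum_component scaleR_conv_of_real[where 'a = complex] hua_times hua_sum sum_distrib_left)
  also have "(\<Sum>a\<in>UNIV. \<Sum>b\<in>UNIV. \<Sum>i<p. hua P (\<lambda>v w. HH i v w $ a $ b) 0 a b) = (\<Sum>i<p. hua_pairing (HH i))"
  proof -
    have "(\<Sum>b\<in>UNIV. \<Sum>i<p. hua P (\<lambda>v w. HH i v w $ a $ b) 0 a b) = (\<Sum>i<p. \<Sum>b\<in>UNIV. hua P (\<lambda>v w. HH i v w $ a $ b) 0 a b)" for a
      by (rule sum.swap)
    then show ?thesis unfolding hua_pairing_def by (simp only:) (rule sum.swap)
  qed
  finally show ?thesis .
qed

lemma has_hess_component: "has_hess F F1 HF p \<Longrightarrow> has_hess (\<lambda>z. F z $ a $ b) (\<lambda>x w. F1 x w $ a $ b) (\<lambda>v w. HF v w $ a $ b) p"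
  for F :: "_ \<Rightarrow> complex^'m^'m"
  by (rule has_hess_bounded_linear) (auto intro: bounded_linear_compose[OF bounded_linear_vec_nth bounded_linear_vec_nth, simplified])

text \<open>One induction carries three facts: the Hessian exists, its pairing keeps the value it
  has for \<open>u(z) X\<close>, and the Taylor remainder keeps the radius \<open>d\<close> and the
  constant \<open>e * norm X\<close>, since each \<open>T i\<close> and each \<open>B i\<close>
  preserves norms.\<close>

lemma orbit_average_hess:
  assumes "F \<in> orbit_averages u X" and u: "has_hess u u1 H 0"
    and sd: "\<And>a. norm a < d \<Longrightarrow> cmod (u a + u (- a) - 2 * u 0 - H a a) \<le> e * (norm a)\<^sup>2"
  shows "\<exists>F1 HF. has_hess F F1 HF 0 \<and> hua_pairing HF = (\<Sum>a\<in>UNIV. \<Sum>b\<in>UNIV. X $ a $ b * hua P H 0 a b) \<and>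
    (\<forall>a. norm a < d \<longrightarrow> norm (F a + F (- a) - 2 *\<^sub>R F 0 - HF a a) \<le> e * norm X * (norm a)\<^sup>2)"
  using assms(1)
proof induction
  case base
  have bl: "bounded_linear (\<lambda>c. cscale c X)"
    unfolding linear_conv_bounded_linear[symmetric] by (rule linearI) (auto simp: vec_eq_iff distrib_right)
  have "has_hess (\<lambda>z. cscale (u z) X) (\<lambda>x w. cscale (u1 x w) X) (\<lambda>v w. cscale (H v w) X) 0"
    by (rule has_hess_bounded_linear[OF u bl])
  moreover have "hua_pairing (\<lambda>v w. cscale (H v w) X) = (\<Sum>a\<in>UNIV. \<Sum>b\<in>UNIV. X $ a $ b * hua P H 0 a b)"
    unfolding hua_pairing_def by (simp add: mult.commute[of "H _ _"] hua_times)
  moreover have "norm (cscale (u a) X + cscale (u (- a)) X - 2 *\<^sub>R cscale (u 0) X - cscale (H a a) X) \<le> e * norm X * (norm a)\<^sup>2"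
    if "norm a < d" for a
  proof -
    have "cscale (u a) X + cscale (u (- a)) X - 2 *\<^sub>R cscale (u 0) X - cscale (H a a) X = cscale (u a + u (- a) - 2 * u 0 - H a a) X"
      by (simp add: vec_eq_iff algebra_simps scaleR_conv_of_real[where 'a = complex])
    then show ?thesis using mult_right_mono[OF sd[OF that] norm_ge_zero[of X]] by (simp add: norm_cscale algebra_simps)
  qed
  ultimately show ?case by blast
next
  case (avg F p g)
  then obtain F1 HF where F: "has_hess F F1 HF 0" "hua_pairing HF = (\<Sum>a\<in>UNIV. \<Sum>b\<in>UNIV. X $ a $ b * hua P H 0 a b)"
    "\<And>a. norm a < d \<Longrightarrow> norm (F a + F (- a) - 2 *\<^sub>R F 0 - HF a a) \<le> e * norm X * (norm a)\<^sup>2" by blast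
  define T where "T i z = fst (g i) ** z ** snd (g i)" for i and z :: "complex^'n^'m"
  define B where "B i Y = adj (fst (g i)) ** Y ** fst (g i)" for i and Y :: "complex^'m^'m"
  have Tl: "linear (T i)" and Bl: "bounded_linear (B i)" for i
    unfolding T_def B_def by (rule linear_two_sided, rule bounded_linear_two_sided)
  have actB: "act (g i) F z = B i (F (T i z))" for i z by (simp add: act_def T_def B_def)
  have h1: "has_hess (\<lambda>z. B i (F (T i z))) (\<lambda>x w. B i (F1 (T i x) (T i w))) (\<lambda>v w. B i (HF (T i v) (T i w))) 0" for i
  proof -
    have "has_hess F F1 HF (T i 0)" using F(1) linear_0[OF Tl] by simp
    then show ?thesis by (intro has_hess_bounded_linear[OF _ Bl] has_hess_compose_linear[OF _ Tl])
  qed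
  have bil: "bilinear (\<lambda>v w. HF v w $ a $ b)" for a b
    using has_hess_bilinear[OF has_hess_component[OF F(1)]] .
  have LamB: "hua_pairing (\<lambda>v w. B i (HF (T i v) (T i w))) = hua_pairing HF" if "i < p" for i
    unfolding B_def T_def using avg.hyps(2)[OF that] by (intro hua_pairing_act bil) simp
  have blp: "bounded_linear (\<lambda>Y::complex^'m^'m. (1 / real p) *\<^sub>R Y)" by (rule bounded_linear_scaleR_right)
  have h2: "has_hess (\<lambda>z. (1 / real p) *\<^sub>R (\<Sum>i<p. act (g i) F z)) (\<lambda>x w. (1 / real p) *\<^sub>R (\<Sum>i<p. B i (F1 (T i x) (T i w))))
      (\<lambda>v w. (1 / real p) *\<^sub>R (\<Sum>i<p. B i (HF (T i v) (T i w)))) 0"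
    unfolding actB by (intro has_hess_bounded_linear[OF _ blp] has_hess_sum h1)
  have l2: "hua_pairing (\<lambda>v w. (1 / real p) *\<^sub>R (\<Sum>i<p. B i (HF (T i v) (T i w)))) = hua_pairing HF"
    unfolding hua_pairing_avg using \<open>0 < p\<close> by (simp add: LamB)
  have nd: "norm ((1 / real p) *\<^sub>R (\<Sum>i<p. act (g i) F a) + (1 / real p) *\<^sub>R (\<Sum>i<p. act (g i) F (- a)) - 2 *\<^sub>R ((1 / real p) *\<^sub>R (\<Sum>i<p. act (g i) F 0))
      - (1 / real p) *\<^sub>R (\<Sum>i<p. B i (HF (T i a) (T i a)))) \<le> e * norm X * (norm a)\<^sup>2" (is "norm ?l \<le> _")
    if a: "norm a < d" for a
  proof -
    have l: "?l = (1 / real p) *\<^sub>R (\<Sum>i<p. B i (F (T i a) + F (- T i a) - 2 *\<^sub>R F 0 - HF (T i a) (T i a)))"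
    proof -
      have "B i (F (T i a) + F (- T i a) - 2 *\<^sub>R F 0 - HF (T i a) (T i a))
         = act (g i) F a + act (g i) F (- a) - 2 *\<^sub>R act (g i) F 0 - B i (HF (T i a) (T i a))" for i
        unfolding actB by (simp add: linear_simps[OF Bl] linear_neg[OF Tl] linear_0[OF Tl])
      then show ?thesis
        by (simp add: sum.distrib sum_subtractf scaleR_diff_right scaleR_add_right scaleR_sum_right[symmetric])
    qed
    show ?thesis unfolding l
    proof (rule norm_avg_le[OF _ \<open>0 < p\<close>])
      fix i assume i: "i < p"
      have gK: "(fst (g i), snd (g i)) \<in> K" using avg.hyps(2)[OF i] by simp
      have nT: "norm (T i a) = norm a" unfolding T_def by (rule T_norm[OF gK])
      have nB: "norm (B i Y) = norm Y" for Y
        unfolding B_def using K_unitary[OF gK] by (simp add: norm_unitary_l norm_unitary_r unitary_comm)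
      show "norm (B i (F (T i a) + F (- T i a) - 2 *\<^sub>R F 0 - HF (T i a) (T i a))) \<le> e * norm X * (norm a)\<^sup>2"
        unfolding nB using F(3)[of "T i a"] a nT by simp
    qed
  qed
  show ?case
    by (intro exI conjI, rule h2, rule trans[OF l2 F(2)]) (use nd in blast)
qed

end

section \<open>Averages that are small on the Shilov boundary, and vanishing of the Hua
  matrix\<close>

context hua_domain
begin

lemma SL_closure: "SL \<subseteq> closure DL" using SL_unit_ball by blast

text \<open>A replacement for Haar measure: a limit of averages with smallest possible
  supremum on the Shilov boundary cannot be fixed by the stabiliser of a point where it is nonzero, so
  by strict convexity averaging over finitely many group elements lowers the supremum.\<close>

lemma orbit_average_small:
  assumes u: "harmonic u" and X: "(\<Sum>i\<in>UNIV. X $ i $ i) = 0" and \<eta>: "0 < \<eta>"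
  shows "\<exists>F\<in>orbit_averages u X. \<forall>\<xi>\<in>SL. norm (F \<xi>) \<le> \<eta>"
proof (rule ccontr)
  assume no: "\<not> ?thesis"
  have uc: "continuous_on (closure DL) u" using u by (simp add: harmonic_def)
  then have "bounded (u ` closure DL)" by (intro compact_imp_bounded compact_continuous_image compact_closure_DL)
  then obtain M0 where M0: "\<And>z. z \<in> closure DL \<Longrightarrow> cmod (u z) \<le> M0" unfolding bounded_iff by auto
  define M where "M = M0 * norm X"
  have M: "norm (F z) \<le> M" if "F \<in> orbit_averages u X" "z \<in> closure DL" for F z
    unfolding M_def by (rule orbit_average_bound[OF that(1) M0 that(2)])
  \<comment> \<open>The bounds on \<open>SL\<close> that averages can achieve. Their infimum
    \<open>N\<close> is at least \<open>\<eta>\<close> under the assumption to be refuted.\<close>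
  define A where "A = {N. 0 \<le> N \<and> (\<exists>F\<in>orbit_averages u X. \<forall>\<xi>\<in>SL. norm (F \<xi>) \<le> N)}"
  have MA: "\<bar>M\<bar> \<in> A" unfolding A_def
    using orbit_averages.base[of u X] M SL_closure by (auto intro!: bexI[of _ "\<lambda>z. cscale (u z) X"] intro: order_trans[OF _ abs_ge_self])
  have bdd: "bdd_below A" unfolding A_def by (auto intro: bdd_belowI[of _ 0])
  define N where "N = Inf A"
  have NA: "N \<le> a" if "a \<in> A" for a unfolding N_def by (rule cInf_lower[OF that bdd])
  have "\<eta> \<le> N" unfolding N_def
  proof (rule cInf_greatest)
    show "A \<noteq> {}" using MA by blast
    fix a assume "a \<in> A"
    then obtain F where F: "F \<in> orbit_averages u X" "\<And>\<xi>. \<xi> \<in> SL \<Longrightarrow> norm (F \<xi>) \<le> a" unfolding A_def by blast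
    show "\<eta> \<le> a" using no F by (meson le_cases order_trans)
  qed
  then have N0: "N > 0" using \<eta> by linarith
  have "\<exists>F\<in>orbit_averages u X. \<forall>\<xi>\<in>SL. norm (F \<xi>) \<le> N + 1 / real (Suc n)" for n
  proof -
    have "Inf A < N + 1 / real (Suc n)" unfolding N_def by simp
    then obtain a where "a \<in> A" "a < N + 1 / real (Suc n)" using cInf_lessD[of A] MA by blast
    moreover from \<open>a \<in> A\<close> obtain F where "F \<in> orbit_averages u X" "\<And>\<xi>. \<xi> \<in> SL \<Longrightarrow> norm (F \<xi>) \<le> a" unfolding A_def by blast
    ultimately show ?thesis by (intro bexI[of _ F] ballI) force+
  qed
  then obtain Fn where Fn: "\<And>n. Fn n \<in> orbit_averages u X" "\<And>n \<xi>. \<xi> \<in> SL \<Longrightarrow> norm (Fn n \<xi>) \<le> N + 1 / real (Suc n)"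
    by metis
  have eqc: "\<exists>d>0. \<forall>n z'. z' \<in> SL \<and> norm (z - z') < d \<longrightarrow> norm (Fn n z - Fn n z') < e" if "z \<in> SL" "0 < e" for z e
  proof -
    define e' where "e' = e / (norm X + 1)"
    have x: "norm X + 1 > 0" by (simp add: add_nonneg_pos)
    have e': "e' > 0" unfolding e'_def using that x by simp
    have "uniformly_continuous_on (closure DL) u" by (rule compact_uniformly_continuous[OF uc compact_closure_DL])
    then obtain d where d: "d > 0" "\<And>x x'. x \<in> closure DL \<Longrightarrow> x' \<in> closure DL \<Longrightarrow> dist x' x < d \<Longrightarrow> dist (u x') (u x) < e'"
      unfolding uniformly_continuous_on_def using e' by metis
    have d2: "cmod (u z - u z') \<le> e'" if "z \<in> closure DL" "z' \<in> closure DL" "norm (z - z') < d" for z z'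
      using d(2)[OF that(2,1)] that(3) by (simp add: dist_norm)
    have "norm (Fn n z - Fn n z') < e" if z': "z' \<in> SL" "norm (z - z') < d" for n z'
    proof -
      have "norm (Fn n z - Fn n z') \<le> e' * norm X"
        by (rule orbit_average_equicont[OF Fn(1) d2]) (use z' \<open>z \<in> SL\<close> SL_closure in auto)
      also have "\<dots> < e' * (norm X + 1)" using e' by simp
      finally show ?thesis using x by (simp add: e'_def)
    qed
    then show ?thesis using d(1) by blast
  qed
  obtain g r where gc: "continuous_on SL g" and r: "strict_mono (r :: nat \<Rightarrow> nat)"
    and lim: "\<And>e. 0 < e \<Longrightarrow> \<exists>N. \<forall>n x. n \<ge> N \<and> x \<in> SL \<longrightarrow> norm (Fn (r n) x - g x) < e"
  proof (rule Arzela_Ascoli[OF compact_SL, of Fn M])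
    show "norm (Fn n x) \<le> M" if "x \<in> SL" for n x using M[OF Fn(1)] that SL_closure by blast
  qed (use eqc in blast)+
  have ptlim: "(\<lambda>n. Fn (r n) \<xi>) \<longlonglongrightarrow> g \<xi>" if "\<xi> \<in> SL" for \<xi>
    unfolding LIMSEQ_iff using lim that by meson
  have gN: "norm (g \<xi>) \<le> N" if "\<xi> \<in> SL" for \<xi>
  proof (rule LIMSEQ_le[OF tendsto_norm[OF ptlim[OF that]]])
    have "(\<lambda>n. N + 1 / real (Suc n)) \<longlonglongrightarrow> N + 0" by (intro tendsto_intros LIMSEQ_Suc[OF lim_1_over_n])
    then show "(\<lambda>n. N + 1 / real (Suc (r n))) \<longlonglongrightarrow> N" using LIMSEQ_subseq_LIMSEQ[OF _ r] by (simp add: o_def)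
    show "\<exists>N'. \<forall>n\<ge>N'. norm (Fn (r n) \<xi>) \<le> N + 1 / real (Suc (r n))" using Fn(2)[OF that] by blast
  qed
  have gtr: "(\<Sum>i\<in>UNIV. g \<xi> $ i $ i) = 0" if "\<xi> \<in> SL" for \<xi>
  proof (rule LIMSEQ_unique)
    show "(\<lambda>n. \<Sum>i\<in>UNIV. Fn (r n) \<xi> $ i $ i) \<longlonglongrightarrow> (\<Sum>i\<in>UNIV. g \<xi> $ i $ i)"
      by (intro tendsto_intros ptlim that)
    show "(\<lambda>n. \<Sum>i\<in>UNIV. Fn (r n) \<xi> $ i $ i) \<longlonglongrightarrow> 0" using orbit_average_trace[OF Fn(1) X] by simp
  qed
  have acont: "continuous_on SL (act \<kappa> g)" if "\<kappa> \<in> K" for \<kappa>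
  proof -
    have T: "(fst \<kappa>, snd \<kappa>) \<in> K" using that by simp
    have "continuous_on SL (\<lambda>\<xi>. g (fst \<kappa> ** \<xi> ** snd \<kappa>))"
      by (rule continuous_on_compose2[OF gc T_cont]) (use T_SL[OF T] in auto)
    then show ?thesis unfolding act_def[abs_def] by (intro continuous_intros)
  qed
  have aN: "norm (act \<kappa> g \<xi>) \<le> N" if "\<kappa> \<in> K" "\<xi> \<in> SL" for \<kappa> \<xi>
    using norm_act[OF that(1), of g \<xi>] gN[OF T_SL[of "fst \<kappa>" "snd \<kappa>" \<xi>]] that by simp
  \<comment> \<open>The points where averaging the limit \<open>g\<close> with its transform by
    \<open>\<kappa>\<close> brings the norm below \<open>N\<close>. The identity serves where
    \<open>g\<close> vanishes and a stabiliser element elsewhere, so these open sets cover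
    \<open>SL\<close>.\<close>
  define O' where "O' \<kappa> = SL \<inter> (\<lambda>\<xi>. norm (g \<xi> + act \<kappa> g \<xi>)) -` {..<2 * N}" for \<kappa>
  have op: "openin (top_of_set SL) (O' \<kappa>)" if "\<kappa> \<in> K" for \<kappa>
    unfolding O'_def by (rule continuous_openin_preimage_gen) (use acont[OF that] gc in \<open>auto intro!: continuous_intros\<close>)
  have cov: "SL \<subseteq> \<Union> (O' ` K)"
  proof
    fix \<xi> assume xi: "\<xi> \<in> SL"
    show "\<xi> \<in> \<Union> (O' ` K)"
    proof (cases "g \<xi> = 0")
      case True
      then have "\<xi> \<in> O' (mat 1, mat 1)" unfolding O'_def using xi N0 by simp
      then show ?thesis using K_one by blast
    next
      case False
      obtain k h where kh: "(k, h) \<in> K" "k ** \<xi> ** h = \<xi>" "adj k ** g \<xi> ** k \<noteq> g \<xi>"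
        using K_stab[of \<xi> "g \<xi>"] gtr[OF xi] False xi unfolding SL_def by blast
      then have "act (k, h) g \<xi> \<noteq> g \<xi>" by (simp add: act_def)
      then have "norm (g \<xi> + act (k, h) g \<xi>) < 2 * N"
        by (intro strict_convex_sum gN aN kh xi) auto
      then have "\<xi> \<in> O' (k, h)" unfolding O'_def using xi by simp
      then show ?thesis using kh(1) by blast
    qed
  qed
  have "\<exists>\<D>\<subseteq>O' ` K. finite \<D> \<and> SL \<subseteq> \<Union> \<D>"
    using compact_SL[unfolded compact_eq_openin_cover] cov op by (metis (no_types, lifting) imageE)
  then obtain K0 where K0: "K0 \<subseteq> K" "finite K0" "SL \<subseteq> \<Union> (O' ` K0)" by (metis finite_subset_image)
  obtain gs where gs: "set gs = K0" using finite_list[OF K0(2)] by blast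
  define p where "p = length gs + 1"
  \<comment> \<open>The identity is put in front of the list, so that for every \<open>\<xi>\<close>
    the \<open>p\<close> terms contain \<open>g \<xi>\<close> together with a term whose sum with it
    is shorter than \<open>2 * N\<close>. The other \<open>p - 2\<close> terms have norm at most
    \<open>N\<close>.\<close>
  define gg where "gg i = (case i of 0 \<Rightarrow> (mat 1, mat 1) | Suc j \<Rightarrow> gs ! j)" for i
  have ggK: "gg i \<in> K" if "i < p" for i
    using that K_one K0(1) gs unfolding gg_def p_def by (auto split: nat.split dest: nth_mem)
  define Av where "Av F z = (1 / real p) *\<^sub>R (\<Sum>i<p. act (gg i) F z)" for F :: "complex^'n^'m \<Rightarrow> complex^'m^'m" and z
  have p0: "p > 0" by (simp add: p_def)
  have lt: "norm (Av g \<xi>) < N" if xi: "\<xi> \<in> SL" for \<xi>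
  proof -
    obtain \<kappa> where "\<kappa> \<in> K0" "\<xi> \<in> O' \<kappa>" using K0(3) xi by blast
    then obtain j where j: "j < length gs" "\<xi> \<in> O' (gs ! j)" using gs by (metis in_set_conv_nth)
    have jp: "Suc j < p" using j(1) by (simp add: p_def)
    define a where "a i = act (gg i) g \<xi>" for i
    have two: "norm (a 0 + a (Suc j)) < 2 * N" using j(2) unfolding a_def gg_def O'_def by simp
    have "(\<Sum>i<p. a i) = a 0 + (a (Suc j) + (\<Sum>i\<in>{..<p} - {0} - {Suc j}. a i))"
      using jp p0 by (simp add: sum.remove[of "{..<p}" 0] sum.remove[of "{..<p} - {0}" "Suc j"])
    then have "norm (\<Sum>i<p. a i) \<le> norm (a 0 + a (Suc j)) + norm (\<Sum>i\<in>{..<p} - {0} - {Suc j}. a i)"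
      using norm_triangle_ineq[of "a 0 + a (Suc j)" "\<Sum>i\<in>{..<p} - {0} - {Suc j}. a i"] by (simp add: add.assoc)
    also have "norm (\<Sum>i\<in>{..<p} - {0} - {Suc j}. a i) \<le> real (card ({..<p} - {0} - {Suc j})) * N"
      by (rule order_trans[OF norm_sum sum_bounded_above]) (use aN ggK xi in \<open>auto simp: a_def\<close>)
    also have "real (card ({..<p} - {0} - {Suc j})) = real p - 2" using jp p0 by (simp add: card_Diff_singleton_if of_nat_diff)
    finally have "norm (\<Sum>i<p. a i) < 2 * N + (real p - 2) * N" using two by linarith
    then have "norm (\<Sum>i<p. a i) < real p * N" by (simp add: algebra_simps)
    then show ?thesis unfolding Av_def a_def[symmetric] using p0 by (simp add: field_simps)
  qed
  \<comment> \<open>An empty \<open>SL\<close> would make 0 an admissible bound, against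
    \<open>N > 0\<close>. Nonemptiness is needed for the supremum to be attained.\<close>
  have "SL \<noteq> {}"
  proof
    assume "SL = {}"
    then have "0 \<in> A" unfolding A_def using orbit_averages.base[of u X] by blast
    then show False using NA[of 0] N0 by simp
  qed
  moreover have "continuous_on SL (\<lambda>\<xi>. norm (Av g \<xi>))"
    unfolding Av_def using acont ggK by (intro continuous_intros) auto
  ultimately obtain \<xi>0 where x0: "\<xi>0 \<in> SL" "\<And>\<xi>. \<xi> \<in> SL \<Longrightarrow> norm (Av g \<xi>) \<le> norm (Av g \<xi>0)"
    using continuous_attains_sup[OF compact_SL] by blast
  define N' where "N' = norm (Av g \<xi>0)"
  have N': "N' < N" "0 \<le> N'" unfolding N'_def using lt[OF x0(1)] by auto
  \<comment> \<open>Half of the gap: the average of a late \<open>Fn\<close> still stays below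
    \<open>N\<close> on \<open>SL\<close>, which contradicts the choice of \<open>N\<close> as an
    infimum.\<close>
  define e where "e = (N - N') / 2"
  have e: "e > 0" using N' by (simp add: e_def)
  obtain n where n: "\<And>x. x \<in> SL \<Longrightarrow> norm (Fn (r n) x - g x) < e" using lim[OF e] by blast
  have "norm (Av (Fn (r n)) \<xi>) \<le> N' + e" if xi: "\<xi> \<in> SL" for \<xi>
  proof -
    have "Av (Fn (r n)) \<xi> - Av g \<xi> = (1 / real p) *\<^sub>R (\<Sum>i<p. act (gg i) (Fn (r n)) \<xi> - act (gg i) g \<xi>)"
      unfolding Av_def by (simp add: sum_subtractf scaleR_diff_right)
    also have "norm \<dots> \<le> e"
    proof (rule norm_avg_le[OF _ p0])
      fix i assume i: "i < p"
      have T: "(fst (gg i), snd (gg i)) \<in> K" using ggK[OF i] by simp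
      show "norm (act (gg i) (Fn (r n)) \<xi> - act (gg i) g \<xi>) \<le> e"
        unfolding norm_act_diff[OF ggK[OF i]] using n[OF T_SL[OF T xi]] by simp
    qed
    finally have "norm (Av (Fn (r n)) \<xi> - Av g \<xi>) \<le> e" .
    moreover have "norm (Av g \<xi>) \<le> N'" unfolding N'_def by (rule x0(2)[OF xi])
    ultimately show ?thesis using norm_triangle_ineq2[of "Av (Fn (r n)) \<xi>" "Av g \<xi>"] by linarith
  qed
  moreover have "Av (Fn (r n)) \<in> orbit_averages u X"
    unfolding Av_def[abs_def] by (rule orbit_averages.avg[OF Fn(1) ggK p0])
  ultimately have "N' + e \<in> A" unfolding A_def using N' e by auto
  then have "N \<le> N' + e" by (rule NA)
  then show False using N' unfolding e_def by (simp add: field_simps)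
qed

text \<open>The order of choices matters: \<open>e\<close> comes first, the radius \<open>d\<close>
  depends on \<open>u\<close> and \<open>e\<close> alone, then comes the step \<open>t\<close>, and
  only then an average that is small compared with \<open>t\<^sup>2 * e\<close>. Its Hessian is of
  order \<open>e\<close>, although its pairing is the fixed number \<open>?L\<close>.\<close>

lemma hua_weighted_zero:
  assumes u: "harmonic u" and X: "(\<Sum>i\<in>UNIV. X $ i $ i) = 0" and H: "has_hess u u1 H 0"
  shows "(\<Sum>a\<in>UNIV. \<Sum>b\<in>UNIV. X $ a $ b * hua P H 0 a b) = 0" (is "?L = 0")
proof -
  define R0 where "R0 = (\<Sum>a\<in>UNIV. \<Sum>j\<in>UNIV. norm (P (emat 1 j a)) + norm (cscale \<i> (P (emat 1 j a))))"
  define R where "R = 2 * R0 + 1"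
  have R0: "norm (P (emat 1 j a)) \<le> R0" "norm (cscale \<i> (P (emat 1 j a))) \<le> R0" for j a
  proof -
    have "norm (P (emat 1 j a)) + norm (cscale \<i> (P (emat 1 j a))) \<le> (\<Sum>j\<in>UNIV. norm (P (emat 1 j a)) + norm (cscale \<i> (P (emat 1 j a))))"
      by (rule member_le_sum[of j UNIV "\<lambda>j. norm (P (emat 1 j a)) + norm (cscale \<i> (P (emat 1 j a)))"]) auto
    also have "\<dots> \<le> R0" unfolding R0_def
      by (rule member_le_sum[of a UNIV "\<lambda>a. \<Sum>j\<in>UNIV. norm (P (emat 1 j a)) + norm (cscale \<i> (P (emat 1 j a)))"]) (auto intro: sum_nonneg)
    finally show "norm (P (emat 1 j a)) \<le> R0" "norm (cscale \<i> (P (emat 1 j a))) \<le> R0"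
      using norm_ge_zero[of "P (emat 1 j a)"] norm_ge_zero[of "cscale \<i> (P (emat 1 j a))"] by linarith+
  qed
  have "0 \<le> norm (P (emat 1 undefined undefined))" by simp
  then have "0 \<le> R0" using R0(1) order_trans by blast
  then have R: "R > 0" "0 \<le> R0" unfolding R_def by auto
  define Cm where "Cm = real CARD('m) * real CARD('m) * real CARD('n)"
  have main: "cmod ?L \<le> Cm * ((norm X * R\<^sup>2 + 1) * e)" if e: "0 < e" for e
  proof -
    obtain d where d: "d > 0" "\<And>a. norm a < d \<Longrightarrow> cmod (u (0 + a) + u (0 - a) - 2 *\<^sub>R u 0 - H a a) \<le> e * (norm a)\<^sup>2"
      using has_hess_second_difference[OF H e] by blast
    have d2: "cmod (u a + u (- a) - 2 * u 0 - H a a) \<le> e * (norm a)\<^sup>2" if "norm a < d" for a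
      using d(2)[OF that] by (simp add: scaleR_2)
    \<comment> \<open>For \<open>a\<close> in \<open>L\<close> with \<open>norm a \<le> R\<close>
      this puts \<open>t *\<^sub>R a\<close> both into the range of the Taylor bound and into the
      unit ball, hence into \<open>DL\<close>.\<close>
    define t where "t = min d 1 / (2 * R)"
    have t: "t > 0" "t * R < d" "t * R < 1" unfolding t_def using d R by auto
    \<comment> \<open>The second difference involves four values, that at 0 being counted twice,
      each of norm at most \<open>CARD('m) * CARD('m) * \<eta>\<close>; together they make
      \<open>t\<^sup>2 * e\<close>.\<close>
    define \<eta> where "\<eta> = t\<^sup>2 * e / (4 * (real CARD('m) * real CARD('m)))"
    have eta: "\<eta> > 0" unfolding \<eta>_def using t e by simp
    obtain F where F: "F \<in> orbit_averages u X" "\<And>\<xi>. \<xi> \<in> SL \<Longrightarrow> norm (F \<xi>) \<le> \<eta>"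
      using orbit_average_small[OF u X eta] by blast
    obtain F1 HF where HF: "has_hess F F1 HF 0" "hua_pairing HF = ?L"
      "\<And>a. norm a < d \<Longrightarrow> norm (F a + F (- a) - 2 *\<^sub>R F 0 - HF a a) \<le> e * norm X * (norm a)\<^sup>2"
      using orbit_average_hess[OF F(1) H d2] by blast
    have Fs: "norm (F z) \<le> real CARD('m) * real CARD('m) * \<eta>" if "z \<in> DL" for z
    proof (rule norm_le_entries)
      fix a b
      show "cmod (F z $ a $ b) \<le> \<eta>"
        by (rule max_modulus[OF orbit_average_harmonic[OF F(1) u] _ that]) (use F(2) entry_norm_le order_trans in blast)
    qed
    define bd where "bd = e * norm X * R\<^sup>2 + e"
    note bil = has_hess_bilinear[OF HF(1)]
    have diag: "norm (HF a a) \<le> bd" if a: "a \<in> L" "norm a \<le> R" for a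
    proof -
      let ?b = "t *\<^sub>R a"
      have nb: "norm ?b \<le> t * R" using a t by (simp add: mult_left_mono)
      have bD: "?b \<in> DL" "- ?b \<in> DL" "0 \<in> DL"
        using le_less_trans[OF nb t(3)] ball_subset_domI[of ?b] ball_subset_domI[of "- ?b"] L_scaleR[OF a(1), of t] L_scaleR[OF a(1), of "-t"] zero_DL
        unfolding DL_def by auto
      have "HF ?b ?b = (F ?b + F (- ?b) - 2 *\<^sub>R F 0) - (F ?b + F (- ?b) - 2 *\<^sub>R F 0 - HF ?b ?b)" by simp
      then have "norm (HF ?b ?b) \<le> norm (F ?b + F (- ?b) - 2 *\<^sub>R F 0) + norm (F ?b + F (- ?b) - 2 *\<^sub>R F 0 - HF ?b ?b)"
        by (metis norm_triangle_ineq4)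
      also have "norm (F ?b + F (- ?b) - 2 *\<^sub>R F 0) \<le> norm (F ?b) + norm (F (- ?b)) + 2 * norm (F 0)"
        using norm_triangle_ineq4[of "F ?b + F (- ?b)" "2 *\<^sub>R F 0"] norm_triangle_ineq[of "F ?b" "F (- ?b)"] by simp
      also have "\<dots> \<le> 4 * (real CARD('m) * real CARD('m) * \<eta>)"
        using Fs[OF bD(1)] Fs[OF bD(2)] Fs[OF bD(3)] by linarith
      also have "\<dots> = t\<^sup>2 * e" unfolding \<eta>_def by simp
      also have "norm (F ?b + F (- ?b) - 2 *\<^sub>R F 0 - HF ?b ?b) \<le> e * norm X * (norm ?b)\<^sup>2"
        by (rule HF(3)[OF le_less_trans[OF nb t(2)]])
      also have "\<dots> \<le> e * norm X * (t * R)\<^sup>2" using nb e by (intro mult_left_mono power_mono) auto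
      also have "HF ?b ?b = (t * t) *\<^sub>R HF a a" by (simp add: bilinear_lmul[OF bil] bilinear_rmul[OF bil])
      finally have "t\<^sup>2 * norm (HF a a) \<le> t\<^sup>2 * bd"
        unfolding bd_def by (simp add: power2_eq_square algebra_simps)
      then show ?thesis using t by simp
    qed
    have off: "norm (HF v w) \<le> bd" if "v \<in> L" "w \<in> L" "norm v \<le> R0" "norm w \<le> R0" for v w
    proof -
      \<comment> \<open>Symmetry permits polarisation, which extends the diagonal estimate to pairs.
        The radius \<open>R = 2 * R0 + 1\<close> leaves room for \<open>v + w\<close> and
        \<open>v - w\<close>.\<close>
      have sym: "HF v w = HF w v" by (rule has_hess_symmetric[OF HF(1)])
      have "4 *\<^sub>R HF v w = HF (v + w) (v + w) - HF (v - w) (v - w)"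
        by (simp add: bilinear_ladd[OF bil] bilinear_radd[OF bil] bilinear_lsub[OF bil] bilinear_rsub[OF bil] sym)
           (simp add: vec_eq_iff scaleR_conv_of_real[where 'a = complex])
      then have "4 * norm (HF v w) \<le> norm (HF (v + w) (v + w)) + norm (HF (v - w) (v - w))"
        by (metis norm_scaleR norm_triangle_ineq4 abs_numeral)
      also have "\<dots> \<le> bd + bd"
      proof (intro add_mono diag)
        show "v + w \<in> L" using that L_add by blast
        show "v - w \<in> L" using that L_add[of v "-1 *\<^sub>R w"] L_scaleR[of w "-1"] by simp
        show "norm (v + w) \<le> R" using norm_triangle_ineq[of v w] that unfolding R_def by linarith
        show "norm (v - w) \<le> R" using norm_triangle_ineq4[of v w] that unfolding R_def by linarith
      qed
      finally show ?thesis using norm_ge_zero[of "HF v w"] by linarith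
    qed
    have mb: "cmod (mix (\<lambda>v w. HF v w $ a $ b) v w) \<le> bd"
      if "v \<in> L" "w \<in> L" "norm v \<le> R0" "norm w \<le> R0" "norm (cscale \<i> v) \<le> R0" "norm (cscale \<i> w) \<le> R0" for a b v w
    proof -
      have o: "cmod (HF x y $ a $ b) \<le> bd" if "x \<in> L" "y \<in> L" "norm x \<le> R0" "norm y \<le> R0" for x y
        using off[OF that] entry_norm_le[of "HF x y" a b] by linarith
      let ?p = "HF v w $ a $ b" and ?q = "HF (cscale \<i> v) (cscale \<i> w) $ a $ b" and ?r = "HF v (cscale \<i> w) $ a $ b" and ?s = "HF (cscale \<i> v) w $ a $ b"
      have "cmod (?p + ?q + \<i> * (?r - ?s)) \<le> (cmod ?p + cmod ?q) + (cmod ?r + cmod ?s)"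
        using norm_triangle_ineq[of "?p + ?q" "\<i> * (?r - ?s)"] norm_triangle_ineq[of ?p ?q] norm_triangle_ineq4[of ?r ?s]
        by (simp add: norm_mult)
      also have "\<dots> \<le> (bd + bd) + (bd + bd)" using that by (intro add_mono o L_cscale)
      finally show ?thesis unfolding mix_def by (simp add: norm_divide)
    qed
    have "cmod (hua_pairing HF) \<le> (\<Sum>a\<in>(UNIV::'m set). \<Sum>b\<in>(UNIV::'m set). \<Sum>c\<in>(UNIV::'n set). bd)"
      unfolding hua_pairing_def hua_0
      by (intro order_trans[OF norm_sum] sum_mono mb P_L R0)
    also have "\<dots> = Cm * bd" by (simp add: Cm_def)
    also have "bd = (norm X * R\<^sup>2 + 1) * e" by (simp add: bd_def algebra_simps)
    finally show ?thesis using HF(2) by simp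
  qed
  have C0: "0 \<le> Cm * (norm X * R\<^sup>2 + 1)" unfolding Cm_def by simp
  have "cmod ?L \<le> 0"
  proof (rule field_le_epsilon)
    fix e :: real assume e: "0 < e"
    define c where "c = Cm * (norm X * R\<^sup>2 + 1) + 1"
    have c: "c > 0" using C0 by (simp add: c_def)
    have "cmod ?L \<le> Cm * ((norm X * R\<^sup>2 + 1) * (e / c))" using e c by (intro main) simp
    also have "\<dots> = (Cm * (norm X * R\<^sup>2 + 1)) * (e / c)" by simp
    also have "\<dots> \<le> c * (e / c)" using e c by (intro mult_right_mono) (auto simp: c_def)
    finally show "cmod ?L \<le> 0 + e" using c by simp
  qed
  then show ?thesis by simp
qed

lemma hua_zero_at_0:
  assumes u: "harmonic u" and H: "has_hess u u1 H 0"
  shows "hua P H 0 j k = 0"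
proof -
  have sE: "(\<Sum>a\<in>UNIV. \<Sum>b\<in>UNIV. emat c j k $ a $ b * f a b) = c * f j k" for c j k and f :: "'m \<Rightarrow> 'm \<Rightarrow> complex"
  proof -
    have "(\<Sum>a\<in>UNIV. \<Sum>b\<in>UNIV. emat c j k $ a $ b * f a b) = (\<Sum>a\<in>UNIV. if a = j then (\<Sum>b\<in>UNIV. if b = k then c * f a b else 0) else 0)"
      by (rule sum.cong[OF refl]) (simp add: if_distrib[of "\<lambda>x. x * _"] cong: if_cong)
    then show ?thesis by simp
  qed
  have off: "hua P H 0 j k = 0" if "j \<noteq> k" for j k
  proof -
    have "(\<Sum>i\<in>UNIV. emat 1 j k $ i $ i) = (0::complex)" using that by (simp add: sum.neutral)
    from hua_weighted_zero[OF u this H] show ?thesis unfolding sE by simp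
  qed
  have di: "hua P H 0 j j = hua P H 0 k k" for j k
  proof -
    have t: "(\<Sum>i\<in>UNIV. emat 1 j j $ i $ i) = (1::complex)" for j :: 'm by simp
    have "(\<Sum>i\<in>UNIV. (emat 1 j j - emat 1 k k) $ i $ i) = (0::complex)"
      unfolding vector_minus_component sum_subtractf t by simp
    from hua_weighted_zero[OF u this H] show ?thesis
      unfolding vector_minus_component left_diff_distrib sum_subtractf sE by simp
  qed
  have "lap P H 0 = 0" using u zero_DL has_hess_hessian[OF H] unfolding harmonic_def by auto
  moreover have "lap P H 0 = (\<Sum>i\<in>UNIV. hua P H 0 i i)" unfolding lap_0 hua_0 ..
  moreover have "\<dots> = (\<Sum>i\<in>(UNIV::'m set). hua P H 0 j j)" by (rule sum.cong[OF refl], rule di)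
  ultimately have "hua P H 0 j j = 0" by simp
  then show ?thesis using off by (cases "j = k") auto
qed

theorem hua_equations:
  assumes u: "harmonic u" and p: "p \<in> DL"
  shows "hua P (hessian u p) p j k = 0"
proof -
  obtain \<psi> Q where psi0: "\<psi> 0 = p" and psiD: "\<And>z. z \<in> DL \<Longrightarrow> \<psi> z \<in> DL" and psic: "continuous_on contractions \<psi>"
    and tr: "\<And>p. p \<in> DL \<Longrightarrow> pulls_back \<psi> (Q p) p" and inv: "invertible (Q 0)"
    using chart_exists[OF p] by blast
  have hu: "harmonic (\<lambda>z. u (\<psi> z))"
  proof (rule harmonicI)
    have c: "continuous_on (closure DL) \<psi>" by (rule continuous_on_subset[OF psic]) (use closure_DL in blast)
    have im: "\<psi> ` closure DL \<subseteq> closure DL"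
      by (rule image_closure_subset[OF c closed_closure]) (use psiD closure_subset in blast)
    show "continuous_on (closure DL) (\<lambda>z. u (\<psi> z))"
      by (rule continuous_on_compose2[OF _ c im]) (use u in \<open>simp add: harmonic_def\<close>)
    fix q assume q: "q \<in> DL"
    obtain f1 H where "has_hess u f1 H (\<psi> q)" "lap P H (\<psi> q) = 0" using harmonicD[OF u psiD[OF q]] by blast
    then show "\<exists>f1 H. has_hess (\<lambda>z. u (\<psi> z)) f1 H q \<and> lap P H q = 0" using pulls_backD[OF tr[OF q]] by metis
  qed
  obtain f1 H where H: "has_hess u f1 H p" using harmonicD[OF u p] by blast
  obtain g1 H' where H': "has_hess (\<lambda>z. u (\<psi> z)) g1 H' 0"
    "\<And>j k. hua P H' 0 j k = (\<Sum>q\<in>UNIV. \<Sum>r\<in>UNIV. Q 0 $ q $ j * cnj (Q 0 $ r $ k) * hua P H p q r)"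
    using pulls_backD[OF tr[OF zero_DL], of u f1 H] H psi0 by auto
  define Z where "Z = (\<chi> q r. hua P H p q r)"
  define S where "S = matrix_inv (Q 0)"
  have S: "Q 0 ** S = mat 1" unfolding S_def by (rule matrix_inv_works[OF inv])
  \<comment> \<open>\<open>adj (transpose (Q 0))\<close> is the entrywise conjugate of
    \<open>Q 0\<close>, so this is the congruence of \<open>pulls_back\<close> in matrix form; it
    can be undone because \<open>Q 0\<close> is invertible.\<close>
  have z: "transpose (Q 0) ** Z ** adj (transpose (Q 0)) = 0"
  proof -
    have "(transpose (Q 0) ** Z ** adj (transpose (Q 0))) $ j $ k = hua P H' 0 j k" for j k
    proof -
      have "(transpose (Q 0) ** Z ** adj (transpose (Q 0))) $ j $ k = (\<Sum>r\<in>UNIV. \<Sum>q\<in>UNIV. Q 0 $ q $ j * cnj (Q 0 $ r $ k) * hua P H p q r)"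
        by (simp add: matrix_mul_nth transpose_def Z_def sum_distrib_left sum_distrib_right algebra_simps)
      then show ?thesis unfolding H'(2) by (subst sum.swap)
    qed
    then show ?thesis using hua_zero_at_0[OF hu H'(1)] by (simp add: vec_eq_iff)
  qed
  have St: "transpose S ** transpose (Q 0) = mat 1" using S by (simp add: matrix_transpose_mul[symmetric])
  have "adj (transpose (Q 0)) ** adj (transpose S) = mat 1" using St by (simp add: adj_mult[symmetric])
  then have "Z = transpose S ** (transpose (Q 0) ** Z ** adj (transpose (Q 0))) ** adj (transpose S)"
    by (simp add: matrix_mul_assoc St) (simp add: matrix_mul_assoc[symmetric])
  then have "Z = 0" unfolding z by simp
  then have "hua P H p j k = 0" unfolding Z_def by (simp add: vec_eq_iff)
  then show ?thesis using has_hess_hessian[OF H] by simp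
qed

end

section \<open>Matrices commuting with the stabiliser of a point of the Shilov boundary\<close>

definition outer :: "complex^'m \<Rightarrow> complex^'n \<Rightarrow> complex^'n^'m" where
  "outer v w = (\<chi> i j. v $ i * cnj (w $ j))"

lemma outer_nth [simp]: "outer v w $ i $ j = v $ i * cnj (w $ j)" by (simp add: outer_def)

lemma outer_mv: "outer v w *v x = cin w x *s v"
  by (simp add: vec_eq_iff matrix_vector_mult_def cin_def sum_distrib_left sum_distrib_right mult.commute mult.left_commute)

lemma outer_mult_outer: "outer v w ** outer a b = cscale (cin w a) (outer v b)"
  by (simp add: vec_eq_iff matrix_mul_nth cin_def sum_distrib_left sum_distrib_right algebra_simps)

lemma mult_outer: "M ** outer v w = outer (M *v v) w"
  by (simp add: vec_eq_iff matrix_mul_nth matrix_vector_mult_def sum_distrib_right mult.assoc)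

lemma outer_mult: "outer v w ** M = outer v (adj M *v w)"
  by (simp add: vec_eq_iff matrix_mul_nth matrix_vector_mult_def sum_distrib_left sum_distrib_right algebra_simps)

lemma adj_outer [simp]: "adj (outer v w) = outer w v" by (simp add: vec_eq_iff mult.commute)
lemma adj_cscale: "adj (cscale c A) = cscale (cnj c) (adj A)" by (simp add: vec_eq_iff)

lemma cin_unit: "norm v = 1 \<Longrightarrow> cin v v = 1" by (simp add: cin_self)

lemma cscale_mv: "cscale c A *v x = c *s (A *v x)"
  by (simp add: vec_eq_iff matrix_vector_mult_def sum_distrib_left mult.assoc)

lemma mv_smult: "A *v (c *s x) = c *s (A *v x)" for A :: "complex^'n^'m"
  by (simp add: vec_eq_iff matrix_vector_mult_def sum_distrib_left algebra_simps)

lemma unitary_commute: "adj k ** k = mat 1 \<Longrightarrow> adj k ** Y ** k = Y \<Longrightarrow> Y ** k = k ** Y" for k :: "complex^'m^'m"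
  by (metis matrix_mul_assoc matrix_mul_lid unitary_comm)

text \<open>Commuting with the reflection amounts to commuting with the projection onto the line of
  \<open>v\<close>.\<close>

lemma commutes_reflection_eigenvector:
  fixes Y :: "complex^'m^'m"
  assumes v: "norm v = 1" and c: "Y ** (mat 1 - cscale 2 (outer v v)) = (mat 1 - cscale 2 (outer v v)) ** Y"
  shows "Y *v v = cin v (Y *v v) *s v"
proof -
  have "cscale 2 (Y ** outer v v) = cscale 2 (outer v v ** Y)"
    using c by (simp add: matrix_ring_simps cscale_mult_l cscale_mult_r)
  then have "cscale 2 (Y ** outer v v) *v v = cscale 2 (outer v v ** Y) *v v" by simp
  then have "2 *s (Y *v v) = 2 *s (cin v (Y *v v) *s v)"
    by (simp add: cscale_mv matrix_vector_mul_assoc[symmetric] outer_mv mv_smult cin_unit[OF v])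
  then show ?thesis by (simp add: vec_eq_iff)
qed

text \<open>\<open>k\<close> has eigenvalue \<i> on \<open>v\<close>, minus \<i> on
  \<open>w\<close>, and 1 on their complement. Thus \<i> is a simple eigenvalue, and
  \<open>Y\<close> preserves its eigenspace, the line of \<open>v\<close>.\<close>

lemma commutes_rotation_eigenvector:
  fixes Y :: "complex^'m^'m"
  assumes v: "norm v = 1" and w: "norm w = 1" and vw: "cin v w = 0"
    and k: "k = mat 1 + cscale (\<i> - 1) (outer v v) + cscale (- \<i> - 1) (outer w w)" and c: "Y ** k = k ** Y"
  shows "Y *v v = cin v (Y *v v) *s v"
proof -
  have wv: "cin w v = 0" using vw cin_cnj[of v w] by simp
  let ?y = "Y *v v"
  have kx: "k *v x = x + ((\<i> - 1) * cin v x) *s v + ((- \<i> - 1) * cin w x) *s w" for x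
    unfolding k by (simp add: matrix_vector_mult_add_rdistrib cscale_mv outer_mv)
  have "k *v v = \<i> *s v" unfolding kx by (simp add: cin_unit[OF v] wv vec_eq_iff algebra_simps)
  then have "k *v ?y = \<i> *s ?y" using c by (metis matrix_vector_mul_assoc mv_smult)
  then have e: "?y + ((\<i> - 1) * cin v ?y) *s v + ((- \<i> - 1) * cin w ?y) *s w = \<i> *s ?y" unfolding kx .
  from arg_cong[OF e, of "cin w"] have "cin w ?y + (- \<i> - 1) * cin w ?y = \<i> * cin w ?y"
    by (simp add: cin_right wv cin_unit[OF w])
  then have "cin w ?y = 0" by (simp add: algebra_simps)
  with e have "?y + ((\<i> - 1) * cin v ?y) *s v = \<i> *s ?y" by simp
  then have "(1 - \<i>) * ?y $ i = (1 - \<i>) * (cin v ?y * v $ i)" for i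
    by (simp add: vec_eq_iff algebra_simps)
  moreover have "1 - \<i> \<noteq> 0" by (simp add: complex_eq_iff)
  ultimately show ?thesis by (simp add: vec_eq_iff)
qed

text \<open>If two independent vectors and their sum are eigenvectors, the eigenvalues agree; so
  \<open>Y\<close> is scalar, and its trace decides. \<open>S\<close> will be the whole space or a
  real form of it, whence the shape of the spanning condition.\<close>

lemma eigenvectors_scalar:
  fixes Y :: "complex^'m^'m"
  assumes add: "\<And>v w. v \<in> S \<Longrightarrow> w \<in> S \<Longrightarrow> v + w \<in> S"
    and span: "\<And>x. \<exists>v\<in>S. \<exists>w\<in>S. x = v + \<i> *s w"
    and eig: "\<And>v. v \<in> S \<Longrightarrow> \<exists>c. Y *v v = c *s v"
    and tr: "(\<Sum>i\<in>UNIV. Y $ i $ i) = 0"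
  shows "Y = 0"
proof -
  have "\<exists>v\<in>S. v \<noteq> 0"
  proof (rule ccontr)
    assume "\<not> (\<exists>v\<in>S. v \<noteq> 0)"
    then have "x = 0" for x :: "complex^'m" using span[of x] by (auto simp: vec_eq_iff)
    from this[of "axis undefined 1"] show False by (simp add: axis_eq_0_iff)
  qed
  then obtain v where v: "v \<in> S" "v \<noteq> 0" by blast
  obtain a where a: "Y *v v = a *s v" using eig[OF v(1)] by blast
  have all: "Y *v w = a *s w" if w: "w \<in> S" for w
  proof -
    obtain b where b: "Y *v w = b *s w" using eig[OF w] by blast
    obtain c where c: "Y *v (v + w) = c *s (v + w)" using eig[OF add[OF v(1) w]] by blast
    have e: "(c - a) * v $ i + (c - b) * w $ i = 0" for i
      using c unfolding matrix_vector_right_distrib a b by (simp add: vec_eq_iff algebra_simps)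
    show ?thesis
    proof (cases "c = b")
      case True
      obtain i where "v $ i \<noteq> 0" using v(2) by (metis vec_eq_iff zero_index)
      then have "c = a" using e[of i] True by simp
      then show ?thesis using b True by simp
    next
      case False
      then have "w $ i = - ((c - a) / (c - b)) * v $ i" for i
        using e[of i] by (simp add: field_simps add_eq_0_iff)
      then have "w = (- ((c - a) / (c - b))) *s v" by (simp add: vec_eq_iff)
      then show ?thesis by (simp only: mv_smult a) (simp add: vec_eq_iff)
    qed
  qed
  have "Y *v x = a *s x" for x
  proof -
    obtain v w where x: "v \<in> S" "w \<in> S" "x = v + \<i> *s w" using span[of x] by blast
    show ?thesis unfolding x(3) matrix_vector_right_distrib mv_smult all[OF x(1)] all[OF x(2)]
      by (simp add: vec_eq_iff algebra_simps)
  qed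
  then have "Y *v x = cscale a (mat 1) *v x" for x by (simp add: cscale_mv)
  then have Y: "Y = cscale a (mat 1)" by (simp add: matrix_eq)
  have "(\<Sum>i\<in>UNIV. Y $ i $ i) = of_nat CARD('m) * a" unfolding Y by (simp add: mat_def)
  then have "a = 0" using tr by simp
  then show ?thesis using Y by (simp add: cscale_zero)
qed

lemma reflection_unitary: "norm v = 1 \<Longrightarrow> adj (mat 1 - cscale 2 (outer v v)) ** (mat 1 - cscale 2 (outer v v)) = mat 1"
  by (simp add: adj_diff adj_cscale matrix_ring_simps cscale_mult_l cscale_mult_r outer_mult_outer cin_unit cscale_cscale)
     (simp add: vec_eq_iff)

lemma unit_eigen_extend:
  fixes Y :: "complex^'m^'m"
  assumes sc: "\<And>r v. v \<in> S \<Longrightarrow> r *\<^sub>R v \<in> S" and eig: "\<And>v. v \<in> S \<Longrightarrow> norm v = 1 \<Longrightarrow> Y *v v = cin v (Y *v v) *s v"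
    and v: "v \<in> S"
  shows "\<exists>c. Y *v v = c *s v"
proof (cases "v = 0")
  case True then show ?thesis by simp
next
  case False
  let ?u = "(1 / norm v) *\<^sub>R v"
  have vu: "v = complex_of_real (norm v) *s ?u"
    using False by (simp add: vec_eq_iff scaleR_conv_of_real[where 'a = complex])
  have "Y *v ?u = cin ?u (Y *v ?u) *s ?u" by (rule eig[OF sc[OF v]]) (use False in simp)
  then have "Y *v v = cin ?u (Y *v ?u) *s v"
    by (subst (1 6) vu) (simp only: mv_smult, simp add: vec_eq_iff mult.left_commute)
  then show ?thesis by blast
qed

lemma span_UNIV: "\<exists>v\<in>UNIV. \<exists>w\<in>UNIV. x = v + \<i> *s (w::complex^'m)"
  by (rule bexI[of _ x], rule bexI[of _ 0]) auto

lemma trace_Vmat: "(\<Sum>j\<in>UNIV. Vmat z $ j $ j) = of_real (real CARD('m) - (norm z)\<^sup>2)" for z :: "complex^'n^'m"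
proof -
  have "(\<Sum>j\<in>UNIV. Vmat z $ j $ j) = of_nat CARD('m) - (\<Sum>j\<in>UNIV. (adj (adj z) ** adj z) $ j $ j)"
    by (simp add: Vmat_def sum_subtractf mat_def)
  then show ?thesis unfolding norm_sq_trace[of "adj z", symmetric] norm_adj by simp
qed

lemma trace_Wmat: "(\<Sum>j\<in>UNIV. Wmat z $ j $ j) = of_real (real CARD('n) - (norm z)\<^sup>2)" for z :: "complex^'n^'m"
  using trace_Vmat[of "adj z"] by (simp add: Vmat_adj norm_adj)

lemma norm_sq_le_rows: "z \<in> contractions \<Longrightarrow> (norm z)\<^sup>2 \<le> real CARD('m)" for z :: "complex^'n^'m"
  using contractions_column_bound[of "adj z"] norm_adj_le[of z] norm_adj[of z] by (simp add: contractions_def)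

lemma mat_ip_emat: "mat_ip (emat 1 j a) (emat 1 k b) = (if j = k \<and> a = b then 1 else 0)"
proof -
  have "(\<Sum>q\<in>UNIV. emat 1 j a $ p $ q * cnj (emat 1 k b $ p $ q)) = (\<Sum>q\<in>UNIV. if q = a then (if p = j \<and> p = k \<and> a = b then 1 else 0) else 0)" for p
    by (intro sum.cong refl) auto
  then have row: "(\<Sum>q\<in>UNIV. emat 1 j a $ p $ q * cnj (emat 1 k b $ p $ q)) = (if p = j then (if j = k \<and> a = b then 1 else 0) else 0)" for p
    by simp
  show ?thesis unfolding mat_ip_def row by simp
qed

lemma Vmat_factor:
  fixes z :: "complex^'n^'m"
  assumes "z \<in> domI" shows "\<exists>A::complex^'m^'m. adj A ** Vmat z ** A = mat 1"
  by (rule hermitian_gram_schmidt[OF adj_Vmat]) (rule Vmat_posdef[OF assms])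

lemma Wmat_factor:
  fixes z :: "complex^'n^'m"
  assumes "z \<in> domI" shows "\<exists>D::complex^'n^'n. adj D ** Wmat z ** D = mat 1"
  by (rule hermitian_gram_schmidt[OF adj_Wmat]) (rule Wmat_posdef[OF assms])

section \<open>The three domains\<close>

lemma hua_domain_I:
  assumes "CARD('m) \<le> CARD('n)"
  shows "hua_domain (\<lambda>x :: complex^'n^'m. x) UNIV {(k, h). adj k ** k = mat 1 \<and> adj h ** h = mat 1}"
proof
  fix z0 :: "complex^'n^'m" assume z0: "z0 \<in> domI"
  obtain A :: "complex^'m^'m" where A: "adj A ** Vmat z0 ** A = mat 1" using Vmat_factor[OF z0] by blast
  obtain D :: "complex^'n^'n" where D: "adj D ** Wmat z0 ** D = mat 1" using Wmat_factor[OF z0] by blast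
  have "mobius z0 A D" by unfold_locales (rule z0 A D)+
  then show "\<exists>A D. mobius z0 A D \<and> (\<forall>z\<in>contractions \<inter> UNIV. mobius.\<phi> z0 A D z \<in> UNIV \<and>
           (\<forall>x. mobius.Q z0 A D z ** x ** mobius.R z0 A D z = mobius.Q z0 A D z ** x ** mobius.R z0 A D z))"
    by blast
next
  fix \<xi> :: "complex^'n^'m" and Y :: "complex^'m^'m"
  assume xi: "Vmat \<xi> = 0" and tr: "(\<Sum>i\<in>UNIV. Y $ i $ i) = 0"
    and st: "\<And>k h. (k, h) \<in> {(k, h). adj k ** k = mat 1 \<and> adj h ** h = mat 1} \<Longrightarrow> k ** \<xi> ** h = \<xi> \<Longrightarrow> adj k ** Y ** k = Y"
  have x1: "\<xi> ** adj \<xi> = mat 1" using xi by (simp add: Vmat_def)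
  have inv: "adj k ** Y ** k = Y" if k: "adj k ** k = mat 1" for k
  proof -
    have k': "k ** adj k = mat 1" by (rule unitary_comm[OF k])
    \<comment> \<open>\<open>h\<close> acts on the range of \<open>adj \<xi>\<close> as
      \<open>adj k\<close> transported by \<open>\<xi>\<close>, and as the identity on the
      complement. It is unitary and undoes \<open>k\<close> on \<open>\<xi>\<close>, so every
      unitary \<open>k\<close> occurs in the stabiliser.\<close>
    define h where "h = adj \<xi> ** adj k ** \<xi> + (mat 1 - adj \<xi> ** \<xi>)"
    have xp: "\<xi> ** (mat 1 - adj \<xi> ** \<xi>) = 0" by (simp add: matrix_ring_simps matrix_mul_assoc x1)
    have px: "(mat 1 - adj \<xi> ** \<xi>) ** adj \<xi> = 0" by (simp add: matrix_ring_simps matrix_mul_assoc[symmetric] x1)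
    have "k ** \<xi> ** h = k ** (\<xi> ** adj \<xi>) ** adj k ** \<xi> + k ** (\<xi> ** (mat 1 - adj \<xi> ** \<xi>))"
      unfolding h_def by (simp only: matrix_add_ldistrib matrix_mul_assoc)
    then have 1: "k ** \<xi> ** h = \<xi>" unfolding x1 xp by (simp add: k')
    have ah: "adj h = adj \<xi> ** k ** \<xi> + (mat 1 - adj \<xi> ** \<xi>)"
      unfolding h_def by (simp add: adj_add adj_diff adj_mult matrix_mul_assoc)
    have "adj h ** h = adj \<xi> ** k ** (\<xi> ** adj \<xi>) ** adj k ** \<xi> + adj \<xi> ** k ** (\<xi> ** (mat 1 - adj \<xi> ** \<xi>))
       + ((mat 1 - adj \<xi> ** \<xi>) ** adj \<xi>) ** adj k ** \<xi> + ((mat 1 - adj \<xi> ** \<xi>) - (mat 1 - adj \<xi> ** \<xi>) ** adj \<xi> ** \<xi>)"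
      unfolding ah unfolding h_def by (simp add: matrix_add_ldistrib matrix_mul_add_rdistrib matrix_mul_sub_ldistrib matrix_mul_assoc)
    also have "\<dots> = adj \<xi> ** (k ** adj k) ** \<xi> + (mat 1 - adj \<xi> ** \<xi>)"
      unfolding x1 xp px by (simp add: matrix_mul_assoc)
    also have "\<dots> = mat 1" by (simp add: k')
    finally show ?thesis using st[of k h] k 1 by simp
  qed
  have "\<exists>c. Y *v v = c *s v" for v
  proof (rule unit_eigen_extend[of UNIV])
    fix v :: "complex^'m" assume v: "norm v = 1"
    note r = reflection_unitary[OF v]
    show "Y *v v = cin v (Y *v v) *s v"
      by (rule commutes_reflection_eigenvector[OF v unitary_commute[OF r inv[OF r]]])
  qed auto
  then show "Y = 0" by (intro eigenvectors_scalar[of UNIV Y] span_UNIV tr) auto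
next
  show "\<exists>c>0. \<forall>z\<in>domI \<inter> UNIV. c * (Re (\<Sum>j\<in>UNIV. Vmat (z::complex^'n^'m) $ j $ j))\<^sup>2 \<le> Re (lap (\<lambda>x. x) normsq_hess z)"
  proof (intro exI[of _ 1] conjI ballI)
    fix z :: "complex^'n^'m" assume "z \<in> domI \<inter> UNIV"
    then have z: "z \<in> contractions" using domI_subset_contractions by blast
    have hu: "hua (\<lambda>x. x) normsq_hess z j k = (if j = k then (\<Sum>a\<in>UNIV. Wmat z $ a $ a) else 0)" for j k
    proof -
      have "hua (\<lambda>x. x) normsq_hess z j k = (\<Sum>a\<in>UNIV. \<Sum>b\<in>UNIV. if b = a then (if j = k then Wmat z $ a $ a else 0) else 0)"
        unfolding hua_def mix_normsq_hess mat_ip_emat Wm_eq by (intro sum.cong refl) auto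
      then show ?thesis by simp
    qed
    \<comment> \<open>The Laplacian of \<open>|z|^2\<close> is the product of the traces of
      \<open>Vmat z\<close> and \<open>Wmat z\<close>. The second is at least the first when
      \<open>CARD('m) \<le> CARD('n)\<close>, so the constant 1 works.\<close>
    have "lap (\<lambda>x. x) normsq_hess z = (\<Sum>j\<in>UNIV. Vmat z $ j $ j) * (\<Sum>a\<in>UNIV. Wmat z $ a $ a)"
      unfolding lap_def hu Vm_eq sum_distrib_right
      by (simp add: if_distrib[of "\<lambda>x. _ * x"] cong: if_cong)
    also have "\<dots> = of_real ((real CARD('m) - (norm z)\<^sup>2) * (real CARD('n) - (norm z)\<^sup>2))"
      unfolding trace_Vmat trace_Wmat of_real_mult ..
    finally have l: "Re (lap (\<lambda>x. x) normsq_hess z) = (real CARD('m) - (norm z)\<^sup>2) * (real CARD('n) - (norm z)\<^sup>2)" by (simp only: Re_complex_of_real)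
    have "0 \<le> real CARD('m) - (norm z)\<^sup>2" using norm_sq_le_rows[OF z] by simp
    then show "1 * (Re (\<Sum>j\<in>UNIV. Vmat z $ j $ j))\<^sup>2 \<le> Re (lap (\<lambda>x. x) normsq_hess z)"
      unfolding l trace_Vmat Re_complex_of_real power2_eq_square mult_1
      using assms by (intro mult_left_mono) auto
  qed simp
qed (auto simp: ball_subset_domI)

section \<open>Symmetric and antisymmetric matrices\<close>

lemma transpose_nth [simp]: "transpose A $ i $ j = A $ j $ i" by (simp add: transpose_def)

lemma transpose_add: "transpose (A + B) = transpose A + transpose B" by (simp add: vec_eq_iff)
lemma transpose_diff: "transpose (A - B) = transpose A - transpose B"
  for A :: "complex^'n^'m" by (simp add: vec_eq_iff)
lemma transpose_cscale: "transpose (cscale c A) = cscale c (transpose A)" by (simp add: vec_eq_iff)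
lemma transpose_adj: "transpose (adj A) = adj (transpose A)" by (simp add: vec_eq_iff)

definition cnj_vec :: "complex^'n \<Rightarrow> complex^'n" where "cnj_vec v = (\<chi> i. cnj (v $ i))"
lemma cnj_vec_nth [simp]: "cnj_vec v $ i = cnj (v $ i)" by (simp add: cnj_vec_def)
lemma cnj_vec_cnj_vec [simp]: "cnj_vec (cnj_vec v) = v" by (simp add: vec_eq_iff)
lemma norm_cnj_vec [simp]: "norm (cnj_vec v) = norm v" by (simp add: norm_vec_def)
lemma cnj_vec_add: "cnj_vec (v + w) = cnj_vec v + cnj_vec w" by (simp add: vec_eq_iff)
lemma cnj_vec_smult: "cnj_vec (c *s v) = cnj c *s cnj_vec v" by (simp add: vec_eq_iff)

definition symL :: "complex \<Rightarrow> (complex^'n^'n) set" where "symL s = {z. transpose z = cscale s z}"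
text \<open>Without the factor 1/2 of a projection it produces exactly the diagonal and off-diagonal
  weights of the operators; see \<open>symP_emat_sym\<close> and
  \<open>symP_emat_antisym\<close>.\<close>

definition symP :: "complex \<Rightarrow> complex^'n^'n \<Rightarrow> complex^'n^'n" where "symP s x = x + cscale s (transpose x)"
definition symK :: "((complex^'n^'n) \<times> (complex^'n^'n)) set" where
  "symK = {(k, h). adj k ** k = mat 1 \<and> h = transpose k}"

lemma symL_transpose: "z \<in> symL s \<Longrightarrow> transpose z = cscale s z" by (simp add: symL_def)

lemma cnj_vec_mv: assumes "z \<in> symL s" "s = 1 \<or> s = -1" shows "cnj_vec (z *v x) = s *s (adj z *v cnj_vec x)"
proof -
  have zz: "z $ j $ i = s * z $ i $ j" for i j
    using arg_cong[OF symL_transpose[OF assms(1)], of "\<lambda>M. M $ i $ j"] by simp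
  have cs: "cnj s = s" using assms(2) by auto
  have cz: "cnj (z $ i $ j) = s * cnj (z $ j $ i)" for i j
    using arg_cong[OF zz[of i j], of cnj] by (simp only: complex_cnj_mult cs)
  have "cnj (\<Sum>j\<in>UNIV. z $ i $ j * x $ j) = (\<Sum>j\<in>UNIV. s * (cnj (z $ j $ i) * cnj (x $ j)))" for i
    unfolding cnj_sum complex_cnj_mult
  proof (rule sum.cong[OF refl])
    fix j
    show "cnj (z $ i $ j) * cnj (x $ j) = s * (cnj (z $ j $ i) * cnj (x $ j))"
      by (simp only: cz[of i j] mult.assoc)
  qed
  then show ?thesis unfolding vec_eq_iff by (simp add: matrix_vector_mult_def sum_distrib_left)
qed

lemma symL_adj: "z \<in> symL s \<Longrightarrow> s = 1 \<or> s = -1 \<Longrightarrow> transpose (adj z) = cscale s (adj z)"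
  by (auto simp: transpose_adj symL_transpose adj_cscale)

lemma cscale_one: "cscale 1 x = x" by (simp add: vec_eq_iff)

lemma symL_Wmat: assumes "z \<in> symL s" "s = 1 \<or> s = -1" shows "transpose (Wmat z) = Vmat z"
  using assms(2) by (auto simp: Wmat_def Vmat_def transpose_diff matrix_transpose_mul symL_transpose[OF assms(1)] symL_adj[OF assms]
    cscale_mult_l cscale_mult_r cscale_cscale cscale_one)

text \<open>With \<open>A\<close> the entrywise conjugate of \<open>D\<close>, transposition
  exchanges the two sides of the automorphism: \<open>transpose (Q z) = R z\<close>. Hence
  \<open>\<phi>\<close> and its derivative respect the symmetry type.\<close>

lemma sym_mobius:
  fixes z0 D :: "complex^'n^'n"
  assumes s: "s = 1 \<or> s = -1" and z0: "z0 \<in> domI" "z0 \<in> symL s" and D: "adj D ** Wmat z0 ** D = mat 1"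
  defines "A \<equiv> transpose (adj D)"
  shows "mobius z0 A D"
    and "\<And>z. z \<in> contractions \<inter> symL s \<Longrightarrow> mobius.\<phi> z0 A D z \<in> symL s"
    and "\<And>z x. z \<in> contractions \<inter> symL s \<Longrightarrow> mobius.Q z0 A D z ** symP s x ** mobius.R z0 A D z = symP s (mobius.Q z0 A D z ** x ** mobius.R z0 A D z)"
proof -
  have ss: "s * s = 1" using s by auto
  have At: "transpose A = adj D" by (simp add: A_def)
  have adjA: "adj A = transpose D" by (simp add: A_def vec_eq_iff)
  have "adj A ** Vmat z0 ** A = transpose (adj D ** Wmat z0 ** D)"
    unfolding adjA unfolding A_def by (simp add: matrix_transpose_mul symL_Wmat[OF z0(2) s] matrix_mul_assoc)
  then have A: "adj A ** Vmat z0 ** A = mat 1" by (simp add: D)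
  show m: "mobius z0 A D" by unfold_locales (rule z0(1) A D)+
  note z0L = z0(2)
  interpret mobius z0 A D by (rule m)
  fix z :: "complex^'n^'n" assume "z \<in> contractions \<inter> symL s"
  then have z: "z \<in> contractions" "z \<in> symL s" by auto
  have Nt: "transpose (Nm z) = cscale s (z ** adj D + transpose D ** z0)"
    by (simp add: Nm_def transpose_add matrix_transpose_mul At symL_transpose[OF z(2)] symL_transpose[OF z0L] cscale_mult_l cscale_mult_r cscale_add)
  have Mt: "transpose (Mm z) = z ** adj D ** adj z0 + transpose D"
    by (simp add: Mm_def transpose_add matrix_transpose_mul At symL_transpose[OF z(2)] symL_adj[OF z0L s] cscale_mult_l cscale_mult_r cscale_cscale ss cscale_one matrix_mul_assoc)
  \<comment> \<open>Both products in parentheses on the right are \<open>mat 1\<close>, so the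
    difference is \<open>z - z = 0\<close>. It follows that the quotient may be formed from the left
    with transposed factors, which gives the symmetry of \<open>\<phi> z\<close>.\<close>
  have "(z ** adj D + transpose D ** z0) ** Mm z - transpose (Mm z) ** Nm z = z ** (adj D ** Wmat z0 ** D) - (adj A ** Vmat z0 ** A) ** z"
    unfolding Mt unfolding Mm_def Nm_def Wmat_def Vmat_def adjA by (simp add: matrix_ring_simps matrix_mul_assoc)
  then have c: "(z ** adj D + transpose D ** z0) ** Mm z = transpose (Mm z) ** Nm z" by (simp add: A D)
  have "transpose (\<phi> z) = transpose (R z) ** transpose (Nm z)" by (simp add: \<phi>_def R_def matrix_transpose_mul)
  also have "\<dots> = cscale s (transpose (R z) ** ((z ** adj D + transpose D ** z0) ** (Mm z ** R z)))"
    unfolding Nt cscale_mult_r by (simp add: Mm_R z)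
  also have "\<dots> = cscale s (transpose (R z) ** ((z ** adj D + transpose D ** z0) ** Mm z) ** R z)"
    by (simp only: matrix_mul_assoc)
  also have "\<dots> = cscale s (transpose (Mm z ** R z) ** Nm z ** R z)"
    unfolding c by (simp only: matrix_transpose_mul matrix_mul_assoc)
  also have "\<dots> = cscale s (\<phi> z)" by (simp add: Mm_R z) (simp add: \<phi>_def R_def)
  finally have ph: "transpose (\<phi> z) = cscale s (\<phi> z)" .
  then show "\<phi> z \<in> symL s" by (simp add: symL_def)
  have Qt: "transpose (Q z) = R z"
    unfolding Q_def R_eq[OF z(1)]
    by (simp add: transpose_diff matrix_transpose_mul At symL_adj[OF z0L s] ph cscale_mult_l cscale_mult_r cscale_cscale ss cscale_one matrix_mul_assoc)
  then have Rt: "transpose (R z) = Q z" by (metis transpose_transpose)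
  show "Q z ** symP s x ** R z = symP s (Q z ** x ** R z)" for x
    unfolding symP_def by (simp add: matrix_transpose_mul Qt Rt matrix_add_ldistrib matrix_mul_add_rdistrib cscale_mult_l cscale_mult_r matrix_mul_assoc)
qed

text \<open>The map \<open>\<sigma>\<close> below is antilinear with square \<open>s\<close>: a real
  structure for \<open>s = 1\<close>, a quaternionic one for \<open>s = -1\<close>. The stabiliser
  of \<open>\<xi>\<close> consists of the unitaries commuting with it. For \<open>s = 1\<close>
  these include the reflections along vectors fixed by \<open>\<sigma>\<close>; for
  \<open>s = -1\<close> a line has to be treated together with its image under
  \<open>\<sigma>\<close>.\<close>

lemma symK_stab_aux:
  fixes \<xi> Y :: "complex^'n^'n"
  assumes s: "s = 1 \<or> s = -1" and xi: "\<xi> \<in> symL s" "Vmat \<xi> = 0" and tr: "(\<Sum>i\<in>UNIV. Y $ i $ i) = 0"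
    and st: "\<And>k. adj k ** k = mat 1 \<Longrightarrow> k ** \<xi> ** transpose k = \<xi> \<Longrightarrow> adj k ** Y ** k = Y"
  shows "Y = 0"
proof -
  have x1: "\<xi> ** adj \<xi> = mat 1" using xi(2) by (simp add: Vmat_def)
  have x2: "adj \<xi> ** \<xi> = mat 1" using unitary_comm[of "adj \<xi>"] x1 by simp
  define \<sigma> where "\<sigma> v = \<xi> *v cnj_vec v" for v
  have ss: "\<sigma> (\<sigma> v) = s *s v" for v
    unfolding \<sigma>_def cnj_vec_mv[OF xi(1) s] by (simp add: mv_smult matrix_vector_mul_assoc x1)
  have nsig: "norm (\<sigma> v) = norm v" for v
    unfolding \<sigma>_def by (simp add: norm_vec_unitary[OF x2])
  have oxi: "outer v v ** \<xi> = cscale s (outer v (cnj_vec (\<sigma> v)))" for v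
    unfolding outer_mult \<sigma>_def cnj_vec_mv[OF xi(1) s] using s by (auto simp: vec_eq_iff)
  have xio: "\<xi> ** outer (cnj_vec v) (cnj_vec v) = outer (\<sigma> v) (cnj_vec v)" for v
    by (simp add: mult_outer \<sigma>_def)
  have comm: "Y ** k = k ** Y" if k: "adj k ** k = mat 1" and kx: "k ** \<xi> = \<xi> ** adj (transpose k)" for k
  proof (rule unitary_commute[OF k st[OF k]])
    have "k ** \<xi> ** transpose k = \<xi> ** (adj (transpose k) ** transpose k)" unfolding kx by (simp add: matrix_mul_assoc)
    also have "adj (transpose k) ** transpose k = transpose (k ** adj k)" by (simp add: matrix_transpose_mul transpose_adj)
    finally show "k ** \<xi> ** transpose k = \<xi>" by (simp add: unitary_comm[OF k])
  qed
  have ato: "adj (transpose (outer v v)) = outer (cnj_vec v) (cnj_vec v)" for v :: "complex^'n"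
    by (simp add: vec_eq_iff mult.commute)
  have cn: "cnj s = s" using s by auto
  show ?thesis
  proof (cases "s = 1")
    case True
    let ?S = "{v. \<sigma> v = v}"
    have eig: "Y *v v = cin v (Y *v v) *s v" if v: "v \<in> ?S" "norm v = 1" for v
    proof (rule commutes_reflection_eigenvector[OF v(2) comm[OF reflection_unitary[OF v(2)]]])
      have "(mat 1 - cscale 2 (outer v v)) ** \<xi> = \<xi> - cscale 2 (outer v (cnj_vec v))"
        using v True by (simp add: matrix_mul_sub_rdistrib cscale_mult_l oxi cscale_one)
      moreover have "\<xi> ** adj (transpose (mat 1 - cscale 2 (outer v v))) = \<xi> - cscale 2 (outer v (cnj_vec v))"
        using v by (simp add: transpose_diff transpose_cscale adj_diff adj_cscale ato matrix_mul_sub_ldistrib cscale_mult_r xio)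
      ultimately show "(mat 1 - cscale 2 (outer v v)) ** \<xi> = \<xi> ** adj (transpose (mat 1 - cscale 2 (outer v v)))" by simp
    qed
    have sadd: "\<sigma> (v + w) = \<sigma> v + \<sigma> w" and ssm: "\<sigma> (c *s v) = cnj c *s \<sigma> v" for v w c
      unfolding \<sigma>_def by (simp_all add: cnj_vec_add cnj_vec_smult matrix_vector_right_distrib mv_smult)
    have scr: "r *\<^sub>R v = complex_of_real r *s v" for r and v :: "complex^'n"
      by (simp add: vec_eq_iff scaleR_conv_of_real[where 'a = complex])
    show ?thesis
    proof (rule eigenvectors_scalar[of ?S Y, OF _ _ _ tr])
      show "v + w \<in> ?S" if "v \<in> ?S" "w \<in> ?S" for v w using that sadd by simp
      show "\<exists>c. Y *v v = c *s v" if "v \<in> ?S" for v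
        by (rule unit_eigen_extend[of ?S, OF _ eig that]) (auto simp: scr ssm)
      fix x
      \<comment> \<open>Real and imaginary part of \<open>x\<close> with respect to the real
        structure \<open>\<sigma>\<close>, which anticommutes with multiplication by \<i>.\<close>
      let ?v = "(1/2) *s (x + \<sigma> x)" and ?w = "(- \<i> / 2) *s (x + (-1) *s \<sigma> x)"
      have "?v \<in> ?S" using ss[of x] True by (simp only: mem_Collect_eq ssm sadd) (simp add: vec_eq_iff)
      moreover have "?w \<in> ?S" using ss[of x] True
        by (simp only: mem_Collect_eq ssm sadd) (simp add: vec_eq_iff algebra_simps)
      moreover have "x = ?v + \<i> *s ?w" by (simp add: vec_eq_iff algebra_simps)
      ultimately show "\<exists>v\<in>?S. \<exists>w\<in>?S. x = v + \<i> *s w" by blast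
    qed
  next
    case False
    then have sm: "s = -1" using s by blast
    have eig: "Y *v v = cin v (Y *v v) *s v" if v: "norm v = 1" for v
    proof -
      define w where "w = \<sigma> v"
      have w: "norm w = 1" using v nsig by (simp add: w_def)
      have sw: "\<sigma> w = (-1) *s v" unfolding w_def ss sm ..
      have vw: "cin v w = 0"
      proof -
        have "cin v w = (\<Sum>i\<in>UNIV. \<Sum>j\<in>UNIV. cnj (v $ i) * (\<xi> $ i $ j * cnj (v $ j)))"
          by (simp add: w_def \<sigma>_def cin_def matrix_vector_mult_def sum_distrib_left)
        also have "\<dots> = (\<Sum>j\<in>UNIV. \<Sum>i\<in>UNIV. cnj (v $ i) * (\<xi> $ i $ j * cnj (v $ j)))" by (rule sum.swap)
        also have "\<dots> = (\<Sum>j\<in>UNIV. \<Sum>i\<in>UNIV. - (cnj (v $ j) * (\<xi> $ j $ i * cnj (v $ i))))"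
        proof (intro sum.cong refl)
          fix i j
          have "\<xi> $ i $ j = - \<xi> $ j $ i" using arg_cong[OF symL_transpose[OF xi(1)], of "\<lambda>M. M $ j $ i"] sm by simp
          then show "cnj (v $ i) * (\<xi> $ i $ j * cnj (v $ j)) = - (cnj (v $ j) * (\<xi> $ j $ i * cnj (v $ i)))" by simp
        qed
        also have "\<dots> = - cin v w"
          by (simp add: w_def \<sigma>_def cin_def matrix_vector_mult_def sum_distrib_left sum_negf)
        finally show ?thesis by simp
      qed
      have wv: "cin w v = 0" using vw cin_cnj[of v w] by simp
      \<comment> \<open>Antilinearity turns the eigenvalue \<i> on \<open>v\<close> into minus \<i>
        on \<open>w = \<sigma> v\<close>; with these eigenvalues \<open>k\<close> commutes with
        \<open>\<sigma>\<close>.\<close>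
      define k where "k = mat 1 + cscale (\<i> - 1) (outer v v) + cscale (- \<i> - 1) (outer w w)"
      have ku: "adj k ** k = mat 1"
        unfolding k_def
        by (simp add: adj_add adj_cscale matrix_add_ldistrib matrix_mul_add_rdistrib cscale_mult_l cscale_mult_r outer_mult_outer
             cin_unit[OF v] cin_unit[OF w] vw wv cscale_cscale cscale_zero)
           (simp add: vec_eq_iff algebra_simps)
      have "k ** \<xi> = \<xi> + cscale (1 - \<i>) (outer v (cnj_vec w)) + cscale (1 + \<i>) (outer w (cnj_vec (\<sigma> w)))"
        unfolding k_def by (simp add: matrix_mul_add_rdistrib cscale_mult_l oxi cscale_cscale sm w_def[symmetric])
      then have k1: "k ** \<xi> = \<xi> + cscale (1 - \<i>) (outer v (cnj_vec w)) - cscale (1 + \<i>) (outer w (cnj_vec v))"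
        unfolding sw by (simp add: vec_eq_iff)
      have "\<xi> ** adj (transpose k) = \<xi> + cscale (- \<i> - 1) (outer w (cnj_vec v)) + cscale (\<i> - 1) (outer (\<sigma> w) (cnj_vec w))"
        unfolding k_def
        by (simp add: transpose_add transpose_cscale adj_add adj_cscale ato matrix_add_ldistrib cscale_mult_r xio w_def[symmetric])
      then have k2: "\<xi> ** adj (transpose k) = \<xi> + cscale (1 - \<i>) (outer v (cnj_vec w)) - cscale (1 + \<i>) (outer w (cnj_vec v))"
        unfolding sw by (simp add: vec_eq_iff algebra_simps)
      show ?thesis
        by (rule commutes_rotation_eigenvector[OF v w vw k_def comm[OF ku]]) (simp only: k1 k2)
    qed
    have "\<exists>c. Y *v v = c *s v" for v
      by (rule unit_eigen_extend[of UNIV]) (use eig in auto)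
    then show ?thesis by (intro eigenvectors_scalar[of UNIV Y] span_UNIV tr) auto
  qed
qed

lemma mat_ip_add: "mat_ip (x + y) w = mat_ip x w + mat_ip y w" "mat_ip w (x + y) = mat_ip w x + mat_ip w y"
  by (simp_all add: mat_ip_def algebra_simps sum.distrib)

lemma transpose_emat: "transpose (emat c j a) = emat c a j" by (auto simp: vec_eq_iff)

text \<open>The swapped Kronecker deltas from symmetrisation contribute the term with
  \<open>s\<close>. For \<open>s = -1\<close> it is negative, and positivity of
  \<open>Vmat z\<close> alone would only show the total to be nonnegative; the missing gain is
  \<open>antisym_norm_Vmat\<close>.\<close>

lemma sym_lap_normsq_hess:
  assumes s: "s = 1 \<or> s = -1" and z: "z \<in> symL s"
  shows "Re (lap (symP s) normsq_hess z) = 2 * ((Re (\<Sum>j\<in>UNIV. Vmat z $ j $ j))\<^sup>2 + Re s * (norm (Vmat z))\<^sup>2)"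
proof -
  have ss: "s * s = 1" and cs: "cnj s = s" using s by auto
  have wv: "Wm z a b = Vmat z $ a $ b" for a b
    unfolding Wm_eq symL_Wmat[OF z s, symmetric] by simp
  have i: "mat_ip (symP s (emat 1 j a)) (symP s (emat 1 k b)) = 2 * ((if j = k \<and> a = b then 1 else 0) + s * (if j = b \<and> a = k then 1 else 0))" for j a k b
  proof -
    have "mat_ip (symP s (emat 1 j a)) (symP s (emat 1 k b)) = mat_ip (emat 1 j a) (emat 1 k b) + s * mat_ip (emat 1 j a) (emat 1 b k)
        + s * mat_ip (emat 1 a j) (emat 1 k b) + s * s * mat_ip (emat 1 a j) (emat 1 b k)"
      unfolding symP_def transpose_emat mat_ip_add mat_ip_cscale cs by (simp add: distrib_left mult.assoc)
    moreover have "(a = k \<and> j = b) = (j = b \<and> a = k)" "(a = b \<and> j = k) = (j = k \<and> a = b)" by auto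
    moreover have "x + s * y + s * y + s * s * x = 2 * (x + s * y)" for x y by (simp add: ss algebra_simps)
    ultimately show ?thesis by (simp only: mat_ip_emat)
  qed
  have hu: "hua (symP s) normsq_hess z j k = 2 * ((if j = k then (\<Sum>a\<in>UNIV. Vmat z $ a $ a) else 0) + s * Vmat z $ k $ j)" for j k
  proof -
    have "hua (symP s) normsq_hess z j k = (\<Sum>a\<in>UNIV. \<Sum>b\<in>UNIV. 2 * ((if a = b then (if j = k then Vmat z $ a $ a else 0) else 0) + s * (if a = k then (if b = j then Vmat z $ k $ j else 0) else 0)))"
      unfolding hua_def mix_normsq_hess i wv by (intro sum.cong refl) (auto simp: algebra_simps)
    also have "\<dots> = 2 * ((\<Sum>a\<in>UNIV. \<Sum>b\<in>UNIV. if a = b then (if j = k then Vmat z $ a $ a else 0) else 0) + s * (\<Sum>a\<in>UNIV. \<Sum>b\<in>UNIV. if a = k then (if b = j then Vmat z $ k $ j else 0) else 0))"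
      by (simp only: sum.distrib sum_distrib_left[symmetric])
    also have "(\<Sum>a\<in>UNIV. \<Sum>b\<in>UNIV. if a = k then (if b = j then Vmat z $ k $ j else 0) else 0) = (\<Sum>a\<in>UNIV. if a = k then (\<Sum>b\<in>UNIV. if b = j then Vmat z $ k $ j else 0) else 0)"
      by (intro sum.cong refl) auto
    finally show ?thesis by simp
  qed
  have h: "Vmat z $ k $ j = cnj (Vmat z $ j $ k)" for j k using adj_nth[of "Vmat z" k j] by simp
  have "lap (symP s) normsq_hess z = (\<Sum>j\<in>UNIV. \<Sum>k\<in>UNIV. 2 * ((if j = k then Vmat z $ j $ j * (\<Sum>a\<in>UNIV. Vmat z $ a $ a) else 0) + s * (Vmat z $ j $ k * cnj (Vmat z $ j $ k))))"
    unfolding lap_def hu Vm_eq by (intro sum.cong refl) (auto simp: algebra_simps h[symmetric])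
  also have "\<dots> = 2 * ((\<Sum>j\<in>UNIV. Vmat z $ j $ j) * (\<Sum>a\<in>UNIV. Vmat z $ a $ a) + s * (\<Sum>j\<in>UNIV. \<Sum>k\<in>UNIV. Vmat z $ j $ k * cnj (Vmat z $ j $ k)))"
  proof -
    have "(\<Sum>j\<in>UNIV. \<Sum>k\<in>UNIV. if j = k then Vmat z $ j $ j * (\<Sum>a\<in>UNIV. Vmat z $ a $ a) else 0) = (\<Sum>j\<in>UNIV. Vmat z $ j $ j) * (\<Sum>a\<in>UNIV. Vmat z $ a $ a)"
      by (simp add: sum_distrib_right)
    then show ?thesis by (simp only: sum.distrib sum_distrib_left[symmetric])
  qed
  also have "(\<Sum>j\<in>UNIV. \<Sum>k\<in>UNIV. Vmat z $ j $ k * cnj (Vmat z $ j $ k)) = of_real ((norm (Vmat z))\<^sup>2)"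
    unfolding norm_sq_matrix of_real_sum complex_norm_square ..
  finally have l: "lap (symP s) normsq_hess z = 2 * ((\<Sum>j\<in>UNIV. Vmat z $ j $ j) * (\<Sum>a\<in>UNIV. Vmat z $ a $ a) + s * of_real ((norm (Vmat z))\<^sup>2))" .
  have im: "Im s = 0" using s by auto
  show ?thesis unfolding l trace_Vmat by (simp add: im power2_eq_square)
qed

text \<open>The bordered matrix is antisymmetric of odd size, hence singular.\<close>

lemma antisym_kernel:
  fixes z :: "complex^'n^'n" and x :: "complex^'n"
  assumes ev: "even CARD('n)" and z: "z \<in> symL (-1)" and x: "x \<noteq> 0"
  shows "\<exists>w c. w \<noteq> 0 \<and> z *v w = c *s x \<and> (\<Sum>j\<in>UNIV. x $ j * w $ j) = 0"
proof -
  have za: "z $ j $ i = - z $ i $ j" for i j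
    using arg_cong[OF symL_transpose[OF z], of "\<lambda>M. M $ i $ j"] by simp
  define B :: "complex^('n option)^('n option)" where
    "B = (\<chi> p q. case p of Some i \<Rightarrow> (case q of Some j \<Rightarrow> z $ i $ j | None \<Rightarrow> x $ i) | None \<Rightarrow> (case q of Some j \<Rightarrow> - x $ j | None \<Rightarrow> 0))"
  have neg: "- B = (\<chi> i j. if i = j then -1 else 0) ** B"
    by (simp add: vec_eq_iff matrix_mul_nth if_distrib[of "\<lambda>x. x * _"] cong: if_cong)
  have "transpose B $ p $ q = (- B) $ p $ q" for p q
  proof (cases p; cases q)
    fix i j assume "p = Some i" "q = Some j"
    then show ?thesis using za[of i j] by (simp add: B_def)
  qed (simp_all add: B_def)
  then have "transpose B = - B" unfolding vec_eq_iff by blast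
  then have "det B = det (- B)" by (metis det_transpose)
  also have "\<dots> = det (\<chi> i j :: 'n option. if i = j then -1 else (0::complex)) * det B"
    by (subst neg) (rule det_mul)
  also have "det (\<chi> i j :: 'n option. if i = j then -1 else (0::complex)) = (\<Prod>i\<in>(UNIV::'n option set). -1)"
    by (subst det_diagonal) auto
  also have "\<dots> = -1" using ev by simp
  finally have "det B = 0" by simp
  then obtain u where u: "u \<noteq> 0" "B *v u = 0" using det_zero_kernel by blast
  define w where "w = (\<chi> i. u $ Some i)"
  have sp: "(\<Sum>q\<in>UNIV. f q) = f None + (\<Sum>j\<in>UNIV. f (Some j))" for f :: "'n option \<Rightarrow> complex"
    unfolding UNIV_option_conv by (simp add: sum.reindex)
  have e1: "(z *v w) $ i + x $ i * u $ None = 0" for i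
  proof -
    have "(B *v u) $ Some i = 0" using u(2) by simp
    then show ?thesis by (simp add: B_def matrix_vector_mult_def sp w_def add.commute)
  qed
  have e2: "(\<Sum>j\<in>UNIV. x $ j * w $ j) = 0"
  proof -
    have "(B *v u) $ None = 0" using u(2) by simp
    then show ?thesis by (simp add: B_def matrix_vector_mult_def sp w_def sum_negf)
  qed
  have "w \<noteq> 0"
  proof
    assume w0: "w = 0"
    obtain i where "x $ i \<noteq> 0" using x by (metis vec_eq_iff zero_index)
    then have "u $ None = 0" using e1[of i] w0 by simp
    moreover have "u $ Some j = 0" for j using arg_cong[OF w0, of "\<lambda>v. v $ j"] by (simp add: w_def)
    ultimately have "u = 0" by (metis vec_eq_iff zero_index option.exhaust)
    then show False using u(1) by simp
  qed
  moreover have "z *v w = (- u $ None) *s x"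
    using e1 by (simp add: vec_eq_iff add_eq_0_iff mult.commute)
  ultimately show ?thesis using e2 by blast
qed

section \<open>A spectral estimate for antisymmetric matrices of even order\<close>

lemma outer_diff: "outer (a - b) c = outer a c - outer b c" by (simp add: vec_eq_iff algebra_simps)
lemma outer_smult: "outer (c *s a) b = cscale c (outer a b)" by (simp add: vec_eq_iff mult.assoc)

text \<open>The singular values of an antisymmetric matrix come in equal pairs, for even order
  including the value 0, so twice the largest eigenvalue of \<open>Vmat z\<close> is at most the
  trace. In place of a spectral decomposition, each \<open>x\<close> receives an orthogonal unit
  vector \<open>y\<close> at which the form is at least as large.\<close>

lemma antisym_Vmat_form:
  fixes z :: "complex^'n^'n" and x :: "complex^'n"
  assumes ev: "even CARD('n)" and z: "z \<in> symL (-1)" "z \<in> contractions" and x: "norm x = 1"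
  shows "2 * Re (cin x (Vmat z *v x)) \<le> Re (\<Sum>j\<in>UNIV. Vmat z $ j $ j)"
proof -
  have "x \<noteq> 0" using x by auto
  then obtain w0 c0 where w0: "w0 \<noteq> 0" "z *v w0 = c0 *s x" "(\<Sum>j\<in>UNIV. x $ j * w0 $ j) = 0"
    using antisym_kernel[OF ev z(1)] by blast
  define r where "r = complex_of_real (1 / norm w0)"
  define w where "w = r *s w0"
  define c where "c = r * c0"
  \<comment> \<open>Antisymmetry turns \<open>z *v w = c *s x\<close> into
    \<open>norm (adj z *v y) = cmod c\<close> and into the lower bound \<open>cmod c\<close> for
    \<open>norm (adj z *v x)\<close>; orthogonality of \<open>x\<close> and \<open>y\<close> is the
    side condition on the kernel vector.\<close>
  define y where "y = cnj_vec w"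
  have "w = (1 / norm w0) *\<^sub>R w0" unfolding w_def r_def by (simp add: vec_eq_iff scaleR_conv_of_real[where 'a = complex])
  then have nw: "norm w = 1" using w0(1) by simp
  have zw: "z *v w = c *s x" unfolding w_def c_def mv_smult w0(2) by (simp add: vec_eq_iff)
  have xw: "(\<Sum>j\<in>UNIV. x $ j * w $ j) = 0"
  proof -
    have "(\<Sum>j\<in>UNIV. x $ j * w $ j) = r * (\<Sum>j\<in>UNIV. x $ j * w0 $ j)"
      by (simp add: w_def sum_distrib_left mult.left_commute)
    then show ?thesis using w0(3) by simp
  qed
  have ny: "norm y = 1" using nw by (simp add: y_def)
  have yx: "cin y x = 0" using xw by (simp add: cin_def y_def mult.commute)
  have xy: "cin x y = 0" using yx cin_cnj[of y x] by simp
  have s1: "(-1::complex) = 1 \<or> (-1::complex) = -1" by simp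
  have nc: "norm (c *s x) = cmod c"
  proof -
    have "(norm (c *s x))\<^sup>2 = (cmod c * norm x)\<^sup>2"
      unfolding norm_sq_vec power_mult_distrib by (simp add: norm_mult power_mult_distrib sum_distrib_left)
    then show ?thesis using x by (simp add: power2_eq_iff_nonneg)
  qed
  have neg1: "norm ((-1) *s v) = norm v" for v :: "complex^'n"
    unfolding norm_vec_def by simp
  have ay: "norm (adj z *v y) = cmod c"
  proof -
    have "norm (cnj_vec (z *v w)) = norm (adj z *v y)"
      unfolding cnj_vec_mv[OF z(1) s1] y_def by (rule neg1)
    then show ?thesis by (simp add: zw nc)
  qed
  have ax: "cmod c \<le> norm (adj z *v x)"
  proof -
    have za: "z $ j $ i = - z $ i $ j" for i j
      using arg_cong[OF symL_transpose[OF z(1)], of "\<lambda>M. M $ i $ j"] by simp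
    have "cin y (z *v cnj_vec x) = (\<Sum>i\<in>UNIV. \<Sum>j\<in>UNIV. w $ i * (z $ i $ j * cnj (x $ j)))"
      by (simp add: cin_def y_def matrix_vector_mult_def sum_distrib_left)
    also have "\<dots> = (\<Sum>j\<in>UNIV. \<Sum>i\<in>UNIV. w $ i * (z $ i $ j * cnj (x $ j)))" by (rule sum.swap)
    also have "\<dots> = (\<Sum>j\<in>UNIV. \<Sum>i\<in>UNIV. - (cnj (x $ j) * (z $ j $ i * w $ i)))"
    proof (intro sum.cong refl)
      fix i j
      show "w $ i * (z $ i $ j * cnj (x $ j)) = - (cnj (x $ j) * (z $ j $ i * w $ i))"
        by (simp add: za[of i j])
    qed
    also have "\<dots> = - cin x (z *v w)" by (simp add: cin_def matrix_vector_mult_def sum_distrib_left sum_negf)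
    also have "\<dots> = - c" unfolding zw by (simp add: cin_right cin_unit[OF x])
    finally have "cmod c = cmod (cin y (z *v cnj_vec x))" by simp
    also have "\<dots> \<le> norm (z *v cnj_vec x)" using norm_cin_le[of y "z *v cnj_vec x"] ny by simp
    also have "\<dots> = norm (adj z *v x)"
      using cnj_vec_mv[OF z(1) s1, of "cnj_vec x"] neg1[of "adj z *v x"] norm_cnj_vec[of "z *v cnj_vec x"] by simp
    finally show ?thesis .
  qed
  \<comment> \<open>The projection onto the complement of \<open>x\<close> and \<open>y\<close>. The
    compressed form has nonnegative trace, which is the trace of \<open>Vmat z\<close> minus the
    values at \<open>x\<close> and \<open>y\<close>.\<close>
  define Pj where "Pj = mat 1 - outer x x - outer y y"
  have pos: "0 \<le> Re (cin v (Vmat z *v v))" for v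
  proof -
    have "norm (adj z *v v) \<le> norm v" by (rule norm_adj_le) (use z(2) in \<open>auto simp: contractions_def\<close>)
    then show ?thesis by (simp add: cin_Vmat power_mono)
  qed
  have tro: "(\<Sum>j\<in>UNIV. (outer a b) $ j $ j) = cin b a" for a b :: "complex^'n"
    by (simp add: cin_def mult.commute)
  have pip: "adj Pj ** Vmat z ** Pj = Vmat z - outer (Vmat z *v x) x - outer (Vmat z *v y) y - outer x (Vmat z *v x) - outer y (Vmat z *v y)
      + cscale (cin x (Vmat z *v x)) (outer x x) + cscale (cin y (Vmat z *v y)) (outer y y)
      + cscale (cin x (Vmat z *v y)) (outer x y) + cscale (cin y (Vmat z *v x)) (outer y x)"
    unfolding Pj_def
    by (simp add: adj_diff matrix_mul_sub_ldistrib matrix_mul_sub_rdistrib mult_outer outer_mult outer_mult_outer adj_Vmat matrix_mul_assoc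
        cin_adj[of _ "Vmat z"] matrix_vector_mult_diff_rdistrib outer_mv outer_diff outer_smult)
  have "(\<Sum>j\<in>UNIV. (adj Pj ** Vmat z ** Pj) $ j $ j) = (\<Sum>j\<in>UNIV. Vmat z $ j $ j) - cin x (Vmat z *v x) - cin y (Vmat z *v y)"
    unfolding pip vector_add_component vector_minus_component sum.distrib sum_subtractf tro cscale_nth sum_distrib_left[symmetric]
    using cin_adj[of x "Vmat z" x] cin_adj[of y "Vmat z" y]
    by (simp add: cin_unit[OF x] cin_unit[OF ny] xy yx)
  moreover have "(adj Pj ** Vmat z ** Pj) $ j $ j = cin (Pj *v axis j 1) (Vmat z *v (Pj *v axis j 1))" for j
  proof -
    have "cin (Pj *v axis j 1) (Vmat z *v (Pj *v axis j 1)) = cin (axis j 1) ((adj Pj ** Vmat z ** Pj) *v axis j 1)"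
      by (simp add: matrix_vector_mul_assoc[symmetric] cin_adj[of "axis j 1" "adj Pj"])
    also have "\<dots> = (adj Pj ** Vmat z ** Pj) $ j $ j"
      by (simp add: cin_def axis_def matrix_vector_mult_def if_distrib[of cnj] if_distrib[of "\<lambda>x. x * _"] if_distrib[of "\<lambda>x. _ * x"] cong: if_cong)
    finally show ?thesis by simp
  qed
  ultimately have "Re (\<Sum>j\<in>UNIV. Vmat z $ j $ j) - Re (cin x (Vmat z *v x)) - Re (cin y (Vmat z *v y)) = (\<Sum>j\<in>UNIV. Re (cin (Pj *v axis j 1) (Vmat z *v (Pj *v axis j 1))))"
    by (metis (no_types, lifting) Re_sum minus_complex.sel(1) sum.cong)
  moreover have "\<dots> \<ge> 0" by (intro sum_nonneg pos)
  moreover have "Re (cin x (Vmat z *v x)) \<le> Re (cin y (Vmat z *v y))"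
    unfolding cin_Vmat Re_complex_of_real x ny ay using ax by (simp add: power_mono)
  ultimately show ?thesis by linarith
qed

text \<open>With \<open>t\<close> half the trace, the form of \<open>V = Vmat z\<close> is bounded
  by \<open>t\<close>. For positive \<open>V\<close> this implies \<open>V^2 \<le> t V\<close>, and
  taking traces gives the claim.\<close>

lemma antisym_norm_Vmat:
  fixes z :: "complex^'n^'n"
  assumes ev: "even CARD('n)" and z: "z \<in> symL (-1)" "z \<in> domI"
  shows "2 * (norm (Vmat z))\<^sup>2 \<le> (Re (\<Sum>j\<in>UNIV. Vmat z $ j $ j))\<^sup>2"
proof -
  have zc: "z \<in> contractions" using z(2) domI_subset_contractions by blast
  define t where "t = Re (\<Sum>j\<in>UNIV. Vmat z $ j $ j) / 2"
  have unit: "Re (cin v (Vmat z *v v)) \<le> t * (norm v)\<^sup>2" for v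
  proof (cases "v = 0")
    case True then show ?thesis by (simp add: cin_left)
  next
    case False
    let ?u = "complex_of_real (1 / norm v) *s v"
    have "?u = (1 / norm v) *\<^sub>R v" by (simp add: vec_eq_iff scaleR_conv_of_real[where 'a = complex])
    then have "norm ?u = 1" using False by simp
    from antisym_Vmat_form[OF ev z(1) zc this] have "Re (cin ?u (Vmat z *v ?u)) \<le> t" by (simp only: t_def)
    moreover have "cin ?u (Vmat z *v ?u) = of_real (1 / (norm v)\<^sup>2) * cin v (Vmat z *v v)"
      by (simp add: mv_smult cin_left cin_right power2_eq_square)
    moreover have "Re (of_real a * c) = a * Re c" for a c by simp
    ultimately have "1 / (norm v)\<^sup>2 * Re (cin v (Vmat z *v v)) \<le> t" by (simp only:)
    then show ?thesis using False by (simp add: field_simps)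
  qed
  have "axis undefined 1 \<noteq> (0::complex^'n)" by (simp add: axis_eq_0_iff)
  from Vmat_posdef[OF z(2) this] unit[of "axis undefined 1"] have "0 < t * (norm (axis undefined 1 :: complex^'n))\<^sup>2" by linarith
  then have t: "t > 0" by (simp add: zero_less_mult_iff)
  have sq: "(norm (Vmat z *v v))\<^sup>2 \<le> t * Re (cin v (Vmat z *v v))" for v
  proof -
    let ?a = "Vmat z *v v"
    \<comment> \<open>Nonnegativity of the form at \<open>v - V v / t\<close>, combined with the
      bound \<open>t\<close> applied to \<open>V v\<close>, yields
      \<open>V^2 \<le> t V\<close>.\<close>
    define x where "x = v - complex_of_real (1 / t) *s ?a"
    have "0 \<le> Re (cin x (Vmat z *v x))"
      using Vmat_posdef[OF z(2), of x] by (cases "x = 0") (auto simp: cin_left)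
    also have "cin x (Vmat z *v x) = cin v ?a - of_real (1 / t) * cin ?a ?a - of_real (1 / t) * cin ?a ?a + of_real (1 / t * (1 / t)) * cin ?a (Vmat z *v ?a)"
      unfolding x_def matrix_vector_mult_diff_distrib mv_smult
      using cin_adj[of v "Vmat z" ?a] by (simp add: cin_left cin_right algebra_simps)
    also have "Re \<dots> = Re (cin v ?a) - 2 / t * (norm ?a)\<^sup>2 + 1 / t * (1 / t) * Re (cin ?a (Vmat z *v ?a))"
      unfolding cin_self by (simp del: of_real_power of_real_divide of_real_mult add: Re_complex_of_real)
    also have "\<dots> \<le> Re (cin v ?a) - 2 / t * (norm ?a)\<^sup>2 + 1 / t * (1 / t) * (t * (norm ?a)\<^sup>2)"
      using t by (intro add_left_mono mult_left_mono unit) auto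
    also have "\<dots> = Re (cin v ?a) - (norm ?a)\<^sup>2 / t" using t by (simp add: field_simps)
    finally show ?thesis using t by (simp add: field_simps)
  qed
  have col: "(Vmat z *v axis j 1) $ i = Vmat z $ i $ j" for i j
    by (simp add: matrix_vector_mult_def axis_def if_distrib cong: if_cong)
  have ax: "cin (axis j 1) x = x $ j" for j and x :: "complex^'n"
    by (simp add: cin_def axis_def if_distrib[of cnj] if_distrib[of "\<lambda>x. x * _"] cong: if_cong)
  have "(norm (Vmat z))\<^sup>2 = (\<Sum>j\<in>UNIV. (norm (Vmat z *v axis j 1))\<^sup>2)"
    unfolding norm_sq_matrix norm_sq_vec col by (rule sum.swap)
  also have "\<dots> \<le> (\<Sum>j\<in>UNIV. t * Re (Vmat z $ j $ j))"
    using sq[of "axis _ 1"] by (intro sum_mono) (simp add: ax col)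
  also have "\<dots> = t * (2 * t)" unfolding sum_distrib_left[symmetric] t_def by simp
  finally show ?thesis unfolding t_def by (simp add: power2_eq_square)
qed

lemma hua_domain_sym:
  assumes s: "s = 1 \<or> (s = -1 \<and> even CARD('n))"
  shows "hua_domain (symP s :: complex^'n^'n \<Rightarrow> complex^'n^'n) (symL s) symK"
proof
  have s': "s = 1 \<or> s = -1" using s by blast
  have ss: "s * s = 1" using s by auto
  show "symP s (x + y) = symP s x + symP s y" for x y :: "complex^'n^'n" by (simp add: symP_def transpose_add cscale_add)
  show "symP s (cscale c x) = cscale c (symP s x)" for c and x :: "complex^'n^'n" by (simp add: vec_eq_iff symP_def algebra_simps)
  show "symP s x \<in> symL s" for x :: "complex^'n^'n"
    by (simp add: symP_def symL_def transpose_add transpose_cscale cscale_add cscale_cscale ss cscale_one)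
  show "x + y \<in> symL s" if "x \<in> symL s" "y \<in> symL s" for x y :: "complex^'n^'n"
    using that by (simp add: symL_def transpose_add cscale_add)
  show "cscale c x \<in> symL s" if "x \<in> symL s" for c and x :: "complex^'n^'n"
    using that by (simp add: symL_def transpose_cscale cscale_cscale mult.commute)
  show "\<exists>A D. mobius z0 A D \<and> (\<forall>z\<in>contractions \<inter> symL s. mobius.\<phi> z0 A D z \<in> symL s \<and>
           (\<forall>x. mobius.Q z0 A D z ** symP s x ** mobius.R z0 A D z = symP s (mobius.Q z0 A D z ** x ** mobius.R z0 A D z)))"
    if z0: "z0 \<in> domI" "z0 \<in> symL s" for z0 :: "complex^'n^'n"
  proof -
    obtain D :: "complex^'n^'n" where D: "adj D ** Wmat z0 ** D = mat 1" using Wmat_factor[OF z0(1)] by blast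
    show ?thesis using sym_mobius[OF s' z0 D] by blast
  qed
  show "adj k ** k = mat 1 \<and> adj h ** h = mat 1" if kh: "(k, h) \<in> symK" for k h :: "complex^'n^'n"
  proof -
    have k: "adj k ** k = mat 1" and h: "h = transpose k" using kh by (auto simp: symK_def)
    have "adj h ** h = transpose (k ** adj k)" by (simp add: h matrix_transpose_mul transpose_adj)
    then show ?thesis using k by (simp add: unitary_comm)
  qed
  show "k ** z ** h \<in> symL s" if "(k, h) \<in> symK" "z \<in> symL s" for k h z :: "complex^'n^'n"
    using that by (auto simp: symK_def symL_def matrix_transpose_mul matrix_mul_assoc cscale_mult_l cscale_mult_r)
  show "k ** symP s x ** h = symP s (k ** x ** h)" if "(k, h) \<in> symK" for k h x :: "complex^'n^'n"
    using that by (auto simp: symK_def symP_def matrix_transpose_mul matrix_mul_assoc cscale_mult_l cscale_mult_r matrix_add_ldistrib matrix_mul_add_rdistrib)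
  show "(mat 1, mat 1) \<in> symK" by (simp add: symK_def)
  show "Y = 0" if "\<xi> \<in> symL s" "Vmat \<xi> = 0" "(\<Sum>i\<in>UNIV. Y $ i $ i) = 0"
    "\<And>k h. (k, h) \<in> symK \<Longrightarrow> k ** \<xi> ** h = \<xi> \<Longrightarrow> adj k ** Y ** k = Y" for \<xi> Y :: "complex^'n^'n"
    by (rule symK_stab_aux[OF s' that(1-3)]) (rule that(4), auto simp: symK_def)
  show "\<exists>c>0. \<forall>z\<in>domI \<inter> symL s. c * (Re (\<Sum>j\<in>UNIV. Vmat z $ j $ j))\<^sup>2 \<le> Re (lap (symP s :: complex^'n^'n \<Rightarrow> complex^'n^'n) normsq_hess z)"
  proof (intro exI[of _ 1] conjI ballI)
    fix z :: "complex^'n^'n" assume "z \<in> domI \<inter> symL s"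
    then have z: "z \<in> domI" "z \<in> symL s" by auto
    \<comment> \<open>With \<open>T\<close> the trace, \<open>s = -1\<close> leaves at least
      \<open>2 * (T\<^sup>2 - T\<^sup>2 / 2) = T\<^sup>2\<close>, so the constant 1 works again; for
      \<open>s = 1\<close> the extra term is nonnegative.\<close>
    have "2 * (norm (Vmat z))\<^sup>2 \<le> (Re (\<Sum>j\<in>UNIV. Vmat z $ j $ j))\<^sup>2" if "s = -1"
      using antisym_norm_Vmat[of z] z s that by auto
    then show "1 * (Re (\<Sum>j\<in>UNIV. Vmat z $ j $ j))\<^sup>2 \<le> Re (lap (symP s) normsq_hess z)"
      unfolding sym_lap_normsq_hess[OF s' z(2)] using s' by auto
  qed simp
qed

section \<open>From Wirtinger derivatives in coordinates to Hessians\<close>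

lemma C2_on_twice_diff:
  assumes "C2_on S f" "open S" "p \<in> S"
  shows "twice_diff f p"
proof -
  obtain f' f'' where f: "\<And>x. x \<in> S \<Longrightarrow> (f has_derivative blinfun_apply (f' x)) (at x)"
    "\<And>x. x \<in> S \<Longrightarrow> (f' has_derivative blinfun_apply (f'' x)) (at x)"
    using assms(1) unfolding C2_on_def by blast
  have "((\<lambda>x. blinfun_apply (f' x) w) has_derivative (\<lambda>v. blinfun_apply (blinfun_apply (f'' p) v) w)) (at p)" for w
    by (rule bounded_linear.has_derivative[OF blinfun.bounded_linear_left f(2)[OF assms(3)]])
  moreover have "\<forall>\<^sub>F x in nhds p. (f has_derivative blinfun_apply (f' x)) (at x)"
    using eventually_nhds_in_open[OF assms(2,3)] by eventually_elim (rule f(1))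
  ultimately have "has_hess f (\<lambda>x. blinfun_apply (f' x)) (\<lambda>v w. blinfun_apply (blinfun_apply (f'' p) v) w) p"
    unfolding has_hess_def by blast
  then show ?thesis by (rule twice_diffI)
qed

lemma d2_mix:
  assumes "twice_diff f p"
  shows "d2 f j a k b p = mix (hessian f p) (emat 1 j a) (emat 1 k b)"
proof -
  obtain f1 where f: "has_hess f f1 (hessian f p) p" using twice_diff_hessian[OF assms] by blast
  let ?H = "hessian f p"
  have e: "emat \<i> j a = cscale \<i> (emat 1 j a)" for j a by (rule emat_eq_cscale)
  note d = has_hess_frechet_differentiable[OF f]
  have "((\<lambda>x. (frechet_derivative f (at x) (emat 1 k b) + \<i> * frechet_derivative f (at x) (emat \<i> k b)) / 2) has_derivative
      (\<lambda>v. (?H v (emat 1 k b) + \<i> * ?H v (emat \<i> k b)) / 2)) (at p)"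
    unfolding divide_inverse by (intro has_derivative_mult_left has_derivative_add has_derivative_mult_right d)
  from frechet_derivative_at[OF this, symmetric]
  have "frechet_derivative (\<lambda>y. wzb f k b y) (at p) = (\<lambda>v. (?H v (emat 1 k b) + \<i> * ?H v (emat \<i> k b)) / 2)"
    unfolding wzb_def .
  then show ?thesis unfolding d2_def wz_def mix_def e by (simp add: field_simps)
qed

lemma Delta1jk_hua: "twice_diff u z \<Longrightarrow> Delta1jk u j k z = hua (\<lambda>x. x) (hessian u z) z j k"
  unfolding Delta1jk_def hua_def by (simp add: d2_mix)

lemma Delta1_lap: "twice_diff u z \<Longrightarrow> Delta1 u z = lap (\<lambda>x. x) (hessian u z) z"
  unfolding Delta1_def lap_def by (simp add: Delta1jk_hua)

text \<open>Applied to \<open>u \<circ> symf\<close> and \<open>u \<circ> asymf\<close>, which see a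
  direction only through \<open>symf\<close> or \<open>asymf\<close>. A coordinate direction
  \<open>emat 1 (min j a) (max j a)\<close> may thus be replaced by the corresponding tangent
  direction of the domain.\<close>

lemma hessian_compose_linear_idem:
  assumes f: "twice_diff f z" and T: "linear T" "T z = z" and ft: "\<And>x. f (T x) = f x"
  shows "hessian f z v w = hessian f z (T v) (T w)"
proof -
  obtain f1 where H: "has_hess f f1 (hessian f z) z" using twice_diff_hessian[OF f] by blast
  then have "has_hess f f1 (hessian f z) (T z)" by (simp add: T)
  from has_hess_compose_linear[OF this T(1)] have "has_hess f (\<lambda>x w. f1 (T x) (T w)) (\<lambda>v w. hessian f z (T v) (T w)) z"
    unfolding ft .
  from has_hess_hessian[OF this] show ?thesis by (simp add: fun_eq_iff)
qed

lemma mix_compose_idem: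
  assumes f: "twice_diff f z" and T: "linear T" "T z = z" "\<And>x. T (cscale \<i> x) = cscale \<i> (T x)" and ft: "\<And>x. f (T x) = f x"
  shows "mix (hessian f z) v w = mix (hessian f z) (T v) (T w)"
  unfolding mix_def T(3)[symmetric] using hessian_compose_linear_idem[OF f T(1,2) ft] by metis

lemma linear_symf: "linear symf" and symf_cscale: "symf (cscale c x) = cscale c (symf x)"
  by (auto intro!: linearI simp: vec_eq_iff symf_def)
lemma linear_asymf: "linear asymf" and asymf_cscale: "asymf (cscale c x) = cscale c (asymf x)"
  by (auto intro!: linearI simp: vec_eq_iff asymf_def)

lemma symf_fixed: "z \<in> symL 1 \<Longrightarrow> symf z = z" and symf_symL: "symf x \<in> symL 1"
  by (auto simp: symL_def symf_def vec_eq_iff)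

lemma asymf_symL: "asymf x \<in> symL (-1)"
  by (auto simp: symL_def asymf_def vec_eq_iff)

lemma asymf_fixed: assumes "z \<in> symL (-1)" shows "asymf z = z"
proof -
  have za: "z $ j $ i = - z $ i $ j" for i j
    using arg_cong[OF symL_transpose[OF assms], of "\<lambda>M. M $ i $ j"] by simp
  have "asymf z $ p $ q = z $ p $ q" for p q
    using za[of p q] za[of p p] by (cases p q rule: linorder_cases) (auto simp: asymf_def)
  then show ?thesis by (simp add: vec_eq_iff)
qed

lemma domII_eq: "domII = domI \<inter> symL 1"
  by (auto simp: domII_def symL_def vec_eq_iff)

lemma domIII_eq: "domIII = domI \<inter> symL (-1)"
proof -
  have "(transpose z = cscale (-1) z) = (\<forall>j a. z $ a $ j = - z $ j $ a)" for z :: "complex^'a^'a"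
    unfolding vec_eq_iff by simp
  then show ?thesis unfolding domIII_def symL_def by blast
qed

text \<open>Off the diagonal symmetrising fills two entries once, on the diagonal it doubles a
  single entry; this is the origin of the weight.\<close>

lemma symP_emat_sym: "symP 1 (emat 1 j a) = cscale (1 / (1 - (if j = a then 1 else 0) / 2)) (symf (emat 1 (min j a) (max j a)))"
  by (cases j a rule: linorder_cases) (auto simp: vec_eq_iff symP_def symf_def min_def max_def)

text \<open>Antisymmetrising annihilates diagonal directions and changes sign with the order of the
  indices, which the vanishing weight and \<open>sgnIII\<close> record.\<close>

lemma symP_emat_antisym: "symP (-1) (emat 1 j a) = cscale ((1 - (if j = a then 1 else 0)) * sgnIII j a) (asymf (emat 1 (min j a) (max j a)))"
  by (cases j a rule: linorder_cases) (auto simp: vec_eq_iff symP_def asymf_def sgnIII_def min_def max_def)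

lemma symL_Wm_eq: "z \<in> symL s \<Longrightarrow> s = 1 \<or> s = -1 \<Longrightarrow> Wm z a b = Vm z a b"
  unfolding Wm_eq Vm_eq using symL_Wmat[of z s] transpose_nth[of "Wmat z" a b] by simp

lemma Delta2jk_hua:
  assumes z: "z \<in> symL 1" and f: "twice_diff (u \<circ> symf) z"
  shows "Delta2jk u j k z = hua (symP 1) (hessian (u \<circ> symf) z) z j k"
proof -
  let ?H = "hessian (u \<circ> symf) z"
  have bil: "bilinear ?H" using twice_diff_hessian[OF f] has_hess_bilinear by blast
  have ft: "(u \<circ> symf) (symf x) = (u \<circ> symf) x" for x by (simp only: o_apply symf_fixed[OF symf_symL])
  have m: "mix ?H v w = mix ?H (symf v) (symf w)" for v w
    by (rule mix_compose_idem[OF f linear_symf symf_fixed[OF z] symf_cscale ft])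
  show ?thesis
    unfolding Delta2jk_def hua_def d2_II_def d2_mix[OF f] symP_emat_sym mix_sesq(3)[OF bil] mix_sesq(4)[OF bil] m[symmetric]
    by (intro sum.cong refl) (auto simp: symL_Wm_eq[OF z])
qed

lemma Delta3jk_hua:
  assumes z: "z \<in> symL (-1)" and f: "twice_diff (u \<circ> asymf) z"
  shows "Delta3jk u j k z = hua (symP (-1)) (hessian (u \<circ> asymf) z) z j k"
proof -
  let ?H = "hessian (u \<circ> asymf) z"
  have bil: "bilinear ?H" using twice_diff_hessian[OF f] has_hess_bilinear by blast
  have ft: "(u \<circ> asymf) (asymf x) = (u \<circ> asymf) x" for x by (simp only: o_apply asymf_fixed[OF asymf_symL])
  have m: "mix ?H v w = mix ?H (asymf v) (asymf w)" for v w
    by (rule mix_compose_idem[OF f linear_asymf asymf_fixed[OF z] asymf_cscale ft])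
  have c: "cnj (sgnIII k b) = sgnIII k b" for k b :: 'a by (simp add: sgnIII_def)
  show ?thesis
    unfolding Delta3jk_def hua_def d2_III_def d2_mix[OF f] symP_emat_antisym mix_sesq(3)[OF bil] mix_sesq(4)[OF bil] m[symmetric]
    by (intro sum.cong refl) (auto simp: symL_Wm_eq[OF z] c)
qed

lemma Delta2_lap: "z \<in> symL 1 \<Longrightarrow> twice_diff (u \<circ> symf) z \<Longrightarrow> Delta2 u z = lap (symP 1) (hessian (u \<circ> symf) z) z / 4"
  unfolding Delta2_def lap_def by (simp add: Delta2jk_hua)

lemma Delta3_lap: "z \<in> symL (-1) \<Longrightarrow> twice_diff (u \<circ> asymf) z \<Longrightarrow> Delta3 u z = lap (symP (-1)) (hessian (u \<circ> asymf) z) z / 4"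
  unfolding Delta3_def lap_def by (simp add: Delta3jk_hua)

section \<open>The equivalences for the three domains\<close>

lemma (in hua_domain) hua_iff:
  assumes "\<And>p. p \<in> DL \<Longrightarrow> twice_diff u p" "continuous_on (closure DL) u"
  shows "(\<forall>p\<in>DL. lap P (hessian u p) p = 0) \<longleftrightarrow> (\<forall>j k. \<forall>p\<in>DL. hua P (hessian u p) p j k = 0)"
proof
  assume "\<forall>p\<in>DL. lap P (hessian u p) p = 0"
  then have "harmonic u" unfolding harmonic_def using assms by blast
  then show "\<forall>j k. \<forall>p\<in>DL. hua P (hessian u p) p j k = 0" using hua_equations by blast
qed (simp add: lap_def)

lemma hua_equivalence_I:
  fixes u :: "complex^'n^'m \<Rightarrow> complex"
  assumes mn: "CARD('m) \<le> CARD('n)" and u: "C2_on domI u" "continuous_on (closure domI) u"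
  shows "(\<forall>z\<in>domI. Delta1 u z = 0) \<longleftrightarrow> (\<forall>j k. \<forall>z\<in>domI. Delta1jk u j k z = 0)"
proof -
  interpret hua_domain "\<lambda>x :: complex^'n^'m. x" UNIV "{(k, h). adj k ** k = mat 1 \<and> adj h ** h = mat 1}"
    by (rule hua_domain_I[OF mn])
  have DL: "DL = domI" by (simp add: DL_def)
  have t: "twice_diff u z" if "z \<in> domI" for z by (rule C2_on_twice_diff[OF u(1) open_domI that])
  show ?thesis using hua_iff[of u] t u(2) by (simp add: DL Delta1_lap Delta1jk_hua)
qed

lemma hua_equivalence_II:
  fixes u :: "complex^('p::{finite,linorder})^('p::{finite,linorder}) \<Rightarrow> complex"
  assumes u: "C2_on {w. symf w \<in> domII} (u \<circ> symf)" "continuous_on (closure domII) u"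
  shows "(\<forall>z\<in>domII. Delta2 u z = 0) \<longleftrightarrow> (\<forall>j k. \<forall>z\<in>domII. Delta2jk u j k z = 0)"
proof -
  interpret hua_domain "symP 1 :: complex^('p::{finite,linorder})^('p::{finite,linorder}) \<Rightarrow> complex^('p::{finite,linorder})^('p::{finite,linorder})" "symL 1" symK
    by (rule hua_domain_sym) simp
  have DL: "DL = domII" by (simp add: DL_def domII_eq)
  \<comment> \<open>Symmetry of \<open>symf w\<close> is automatic, so this is the preimage of the
    open set \<open>domI\<close>, and it is open in the space of all matrices.\<close>
  have "{w. symf w \<in> (domII :: (complex^('p::{finite,linorder})^('p::{finite,linorder})) set)} = symf -` domI" using symf_symL by (auto simp: domII_eq)
  moreover have "open (symf -` (domI :: (complex^('p::{finite,linorder})^('p::{finite,linorder})) set))"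
    by (rule open_vimage[OF open_domI]) (simp add: linear_continuous_on linear_symf flip: linear_conv_bounded_linear)
  ultimately have op: "open {w. symf w \<in> (domII :: (complex^('p::{finite,linorder})^('p::{finite,linorder})) set)}" by simp
  have z: "z \<in> symL 1" "symf z = z" if "z \<in> domII" for z :: "complex^('p::{finite,linorder})^('p::{finite,linorder})"
    using that symf_fixed by (auto simp: domII_eq)
  have t: "twice_diff (u \<circ> symf) z" if "z \<in> domII" for z
    by (rule C2_on_twice_diff[OF u(1) op]) (use that z in simp)
  \<comment> \<open>The closure still consists of symmetric matrices, on which \<open>symf\<close>
    is the identity, so continuity of \<open>u\<close> passes to
    \<open>u \<circ> symf\<close>.\<close>
  have "symf z = z" if "z \<in> closure domII" for z :: "complex^('p::{finite,linorder})^('p::{finite,linorder})"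
    using that closure_DL symf_fixed unfolding DL by blast
  then have c: "continuous_on (closure domII) (u \<circ> symf)"
    by (intro continuous_on_eq[OF u(2)]) simp
  show ?thesis using hua_iff[of "u \<circ> symf"] t c z by (simp add: DL Delta2_lap Delta2jk_hua)
qed

lemma hua_equivalence_III:
  fixes u :: "complex^('q::{finite,linorder})^('q::{finite,linorder}) \<Rightarrow> complex"
  assumes ev: "even CARD('q)" and u: "C2_on {w. asymf w \<in> domIII} (u \<circ> asymf)" "continuous_on (closure domIII) u"
  shows "(\<forall>z\<in>domIII. Delta3 u z = 0) \<longleftrightarrow> (\<forall>j k. \<forall>z\<in>domIII. Delta3jk u j k z = 0)"
proof -
  interpret hua_domain "symP (-1) :: complex^('q::{finite,linorder})^('q::{finite,linorder}) \<Rightarrow> complex^('q::{finite,linorder})^('q::{finite,linorder})" "symL (-1)" symK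
    by (rule hua_domain_sym) (simp add: ev)
  have DL: "DL = domIII" by (simp add: DL_def domIII_eq)
  have "{w. asymf w \<in> (domIII :: (complex^('q::{finite,linorder})^('q::{finite,linorder})) set)} = asymf -` domI" using asymf_symL by (auto simp: domIII_eq)
  moreover have "open (asymf -` (domI :: (complex^('q::{finite,linorder})^('q::{finite,linorder})) set))"
    by (rule open_vimage[OF open_domI]) (simp add: linear_continuous_on linear_asymf flip: linear_conv_bounded_linear)
  ultimately have op: "open {w. asymf w \<in> (domIII :: (complex^('q::{finite,linorder})^('q::{finite,linorder})) set)}" by simp
  have z: "z \<in> symL (-1)" "asymf z = z" if "z \<in> domIII" for z :: "complex^('q::{finite,linorder})^('q::{finite,linorder})"
    using that asymf_fixed by (auto simp: domIII_eq)
  have t: "twice_diff (u \<circ> asymf) z" if "z \<in> domIII" for z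
    by (rule C2_on_twice_diff[OF u(1) op]) (use that z in simp)
  have "asymf z = z" if "z \<in> closure domIII" for z :: "complex^('q::{finite,linorder})^('q::{finite,linorder})"
    using that closure_DL asymf_fixed unfolding DL by blast
  then have c: "continuous_on (closure domIII) (u \<circ> asymf)"
    by (intro continuous_on_eq[OF u(2)]) simp
  show ?thesis using hua_iff[of "u \<circ> asymf"] t c z by (simp add: DL Delta3_lap Delta3jk_hua)
qed

theorem theorem2p2:
  shows
   "(\<forall>u :: complex^'n^'m \<Rightarrow> complex.
       CARD('m) \<le> CARD('n) \<longrightarrow> C2_on domI u \<longrightarrow> continuous_on (closure domI) u \<longrightarrow>
       ((\<forall>z\<in>domI. Delta1 u z = 0) \<longleftrightarrow> (\<forall>j k. \<forall>z\<in>domI. Delta1jk u j k z = 0)))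
    \<and>
    (\<forall>u :: complex^('p::{finite,linorder})^('p::{finite,linorder}) \<Rightarrow> complex.
       C2_on {w. symf w \<in> domII} (u \<circ> symf) \<longrightarrow> continuous_on (closure domII) u \<longrightarrow>
       ((\<forall>z\<in>domII. Delta2 u z = 0) \<longleftrightarrow> (\<forall>j k. \<forall>z\<in>domII. Delta2jk u j k z = 0)))
    \<and>
    (\<forall>u :: complex^('q::{finite,linorder})^('q::{finite,linorder}) \<Rightarrow> complex.
       even CARD('q) \<longrightarrow>
       C2_on {w. asymf w \<in> domIII} (u \<circ> asymf) \<longrightarrow> continuous_on (closure domIII) u \<longrightarrow>
       ((\<forall>z\<in>domIII. Delta3 u z = 0) \<longleftrightarrow> (\<forall>j k. \<forall>z\<in>domIII. Delta3jk u j k z = 0)))"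
  using hua_equivalence_I hua_equivalence_II hua_equivalence_III by blast

end
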